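(* Let $\mathbf{P}:=(P_1,\dots,P_n)^T$ be a complex-adjoint invariant vector distributional operator with vector distributional Fourier transform $\hat{\mathbf{p}}:=(\hat p_1,\dots,\hat p_n)^T$ which is nonzero on $\mathbb{R}^d\setminus\{0\}$. Suppose that $x\mapsto\|\hat{\mathbf{p}}(x)\|_2^{-1}$ belongs to $\mathcal{SI}$ and that $\|\hat{\mathbf{p}}(x)\|_2=\Theta(\|x\|_2^m)$ as $\|x\|_2\to0$ for some $m\in\mathbb{N}_0$. Let $G\in\mathrm{Re}(\mathrm{C}(\mathbb{R}^d))\cap\mathcal{SI}$ be an even Green function with respect to $L=\mathbf{P}^{*T}\mathbf{P}=\sum_{j=1}^nP_j^*P_j$. Then $$\mathrm{H}_{\mathbf{P}}(\mathbb{R}^d)\cap \mathrm{C}(\mathbb{R}^d)\cap \mathrm{L}_2(\mathbb{R}^d)\subseteq\mathcal{N}_G^m(\mathbb{R}^d).$$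
   Context: Function classes. $\mathrm{Re}(\mathcal{E})$ denotes the real-valued members of a function space $\mathcal{E}$. $\mathcal{SI}$ is the set of $f:\mathbb{R}^d\to\mathbb{C}$ (possibly defined only almost everywhere) such that $f(x)=\mathcal{O}(\|x\|_2^{k})$ as $\|x\|_2\to\infty$ for some $k\in\mathbb{N}_0$. $f=\Theta(g)$ means there are positive constants $M_1,M_2$ with $M_1|g|\le|f|\le M_2|g|$ (in the indicated limit). $\mathcal{FT}:=\{f\in \mathrm{C}^\infty(\mathbb{R}^d): D^\alpha f\in\mathcal{SI}\text{ for each }\alpha\in\mathbb{N}_0^d\}$. Distributions. $\mathcal{S}$ is the (complex-valued) Schwartz space on $\mathbb{R}^d$ with its usual Fréchet topology, $\mathcal{S}'$ the space of tempered distributions, $\langle T,\gamma\rangle:=T(\gamma)$ (bilinear pairing). Each $f\in \mathrm{L}_1^{loc}(\mathbb{R}^d)\cap\mathcal{SI}$ is identified with the tempered distribution $\gamma\mapsto\int f\gamma$ (so functions equal almost everywhere are identified). The Fourier transform on $\mathcal{S}$ is $\hat\gamma(x)=(2\pi)^{-d/2}\int\gamma(y)e^{-ix^Ty}\,dy$, and for $T\in\mathcal{S}'$, $\langle\hat T,\gamma\rangle:=\langle T,\hat\gamma\rangle$. $\delta_0$ is the Dirac distribution at the origin. Distributional operators. A linear operator $P:\mathcal{S}'\to\mathcal{S}'$ is a distributional operator, with (distributional) adjoint the linear operator $P^*:\mathcal{S}'\to\mathcal{S}'$, if $P|_{\mathcal{S}}$ and $P^*|_{\mathcal{S}}$ are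 continuous operators from $\mathcal{S}$ into $\mathcal{S}$ and $\langle PT,\gamma\rangle=\langle T,P^*\gamma\rangle$, $\langle P^*T,\gamma\rangle=\langle T,P\gamma\rangle$ for all $T\in\mathcal{S}'$, $\gamma\in\mathcal{S}$. $P$ is complex-adjoint invariant if $\overline{P\gamma}=P\overline{\gamma}$ for each $\gamma\in\mathcal{S}$. A function $\hat p\in\mathcal{FT}$ is the distributional Fourier transform of $P$ if $\langle\widehat{PT},\gamma\rangle=\langle\hat T,\hat p\gamma\rangle$ for all $T\in\mathcal{S}'$, $\gamma\in\mathcal{S}$. A vector distributional operator $\mathbf{P}=(P_1,\dots,P_n)^T$ is a vector of distributional operators; it is complex-adjoint invariant if each $P_j$ is, and its distributional Fourier transform is the vector of those of the $P_j$. $\mathbf{P}^*=(P_1^*,\dots,P_n^* )^T$. Green function. $G\in\mathcal{S}'$ is a (full-space) Green function with respect to a distributional operator $L$ if $LG=\delta_0$ in $\mathcal{S}'$. Generalized Sobolev space. For $\mathbf{P}=(P_1,\dots,P_n)^T$, $$\mathrm{H}_{\mathbf{P}}(\mathbb{R}^d):=\{f\in\mathrm{Re}(\mathrm{L}_1^{loc}(\mathbb{R}^d))\cap\mathcal{SI}: P_jf\in \mathrm{L}_2(\mathbb{R}^d),\ j=1,\dots,n\},$$ with semi-inner product $(f,g)_{\mathrm{H}_{\mathbf{P}}(\mathbb{R}^d)}:=\sum_{j=1}^n\int_{\mathbb{R}^d}P_jf(x)\overline{P_jg(x)}\,dx$. Conditional positive definiteness. $\pi_{m-1}(\mathbb{R}^d)$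 is the space of real polynomials on $\mathbb{R}^d$ of degree at most $m-1$, with $\pi_{-1}(\mathbb{R}^d):=\{0\}$. A continuous even function $\Phi:\mathbb{R}^d\to\mathbb{R}$ is conditionally positive definite of order $m\in\mathbb{N}_0$ if for all $N\in\mathbb{N}$, all pairwise distinct $x_1,\dots,x_N\in\mathbb{R}^d$ and all $c\in\mathbb{R}^N\setminus\{0\}$ with $\sum_j c_jp(x_j)=0$ for all $p\in\pi_{m-1}(\mathbb{R}^d)$, one has $\sum_{j,k}c_jc_k\Phi(x_j-x_k)>0$. (In the paper, the stated hypotheses on $\mathbf{P}$ and $G$ are those under which $G$ is asserted to be conditionally positive definite of order $m$, so that its native space is defined.) Native space (Wendland). Let $\Phi$ be conditionally positive definite of order $m$. Let $F_\Phi$ be the space of functions $\sum_{j=1}^N\alpha_j\Phi(\cdot-x_j)$, $\alpha_j\in\mathbb{R}$, $x_j\in\mathbb{R}^d$, with $\sum_j\alpha_jp(x_j)=0$ for all $p\in\pi_{m-1}(\mathbb{R}^d)$, with inner product $\big(\sum_j\alpha_j\Phi(\cdot-x_j),\sum_k\beta_k\Phi(\cdot-y_k)\big)_\Phi:=\sum_{j,k}\alpha_j\beta_k\Phi(x_j-y_k)$, and let $\mathcal{F}_\Phi$ be its Hilbert space completion. Fix a $\pi_{m-1}(\mathbb{R}^d)$-unisolvent set $\{\xi_1,\dots,\xi_Q\}$, $Q=\dim\pi_{m-1}(\mathbb{R}^d)$, with Lagrange basis $q_1,\dots,q_Q$, and set $\Pi f:=\sum_kf(\xi_k)q_k$ and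 $R:\mathcal{F}_\Phi\to \mathrm{C}(\mathbb{R}^d)$, $R(f)(x):=\big(f,\Phi(\cdot-x)-\sum_kq_k(x)\Phi(\cdot-\xi_k)\big)_\Phi$ ($R$ is injective). The native space is $\mathcal{N}_\Phi^m(\mathbb{R}^d):=\pi_{m-1}(\mathbb{R}^d)+R(\mathcal{F}_\Phi)$ with semi-inner product $(f,g)_{\mathcal{N}_\Phi^m(\mathbb{R}^d)}:=\big(R^{-1}(f-\Pi f),R^{-1}(g-\Pi g)\big)_\Phi$; it does not depend on the choice of unisolvent set.
   Formalization: G is additionally assumed conditionally positive definite of order m, the condition under which its native space is defined; the stated hypotheses do not imply it (e.g. d=3, P the Laplacian, G = -|x|/(8π) plus a large multiple of an even harmonic quartic). *)

theory Defs
  imports "HOL-Analysis.Analysis" "HOL-Library.Landau_Symbols"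
begin

section \<open>Function classes\<close>

text \<open>
  Functions that are only defined almost everywhere are represented by total functions, so the growth
  condition has to ignore null sets. For continuous functions this makes no difference.
\<close>

definition slowly_increasing :: "(real^'d \<Rightarrow> 'b::real_normed_vector) \<Rightarrow> bool" where
  "slowly_increasing f \<longleftrightarrow>
     (\<exists>k::nat. \<exists>C r. AE x in lebesgue. r \<le> norm x \<longrightarrow> norm (f x) \<le> C * norm x ^ k)"

definition locally_integrable :: "(real^'d \<Rightarrow> 'b::{banach, second_countable_topology}) \<Rightarrow> bool" where
  "locally_integrable f \<longleftrightarrow> (\<forall>K. compact K \<longrightarrow> set_integrable lebesgue K f)"

definition square_integrable :: "(real^'d \<Rightarrow> 'b::{banach, second_countable_topology}) \<Rightarrow> bool" where
  "square_integrable f \<longleftrightarrow>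
     f \<in> borel_measurable lebesgue \<and> integrable lebesgue (\<lambda>x. (norm (f x))\<^sup>2)"

definition partial :: "'d \<Rightarrow> (real^'d \<Rightarrow> 'b::real_normed_vector) \<Rightarrow> real^'d \<Rightarrow> 'b" where
  "partial i f x = frechet_derivative f (at x) (axis i 1)"

text \<open>
  For a smooth function, \<open>D\<^sup>\<alpha>\<close> is \<open>partials is\<close> for any list \<open>is\<close> in which each coordinate \<open>i\<close>
  occurs \<open>\<alpha> i\<close> times; quantifying over all lists is quantifying over all multi-indices.
\<close>

primrec partials :: "'d list \<Rightarrow> (real^'d \<Rightarrow> 'b::real_normed_vector) \<Rightarrow> real^'d \<Rightarrow> 'b" where
  "partials [] f = f"
| "partials (i # is) f = partial i (partials is f)"

definition smooth :: "(real^'d \<Rightarrow> 'b::real_normed_vector) \<Rightarrow> bool" where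
  "smooth f \<longleftrightarrow> (\<forall>is. partials is f differentiable_on UNIV)"

text \<open>The class \<open>FT\<close> of admissible distributional Fourier transforms.\<close>

definition FT_class :: "(real^'d \<Rightarrow> complex) set" where
  "FT_class = {f. smooth f \<and> (\<forall>is. slowly_increasing (partials is f))}"


section \<open>Tempered distributions\<close>

definition schwartz :: "(real^'d \<Rightarrow> complex) set" where
  "schwartz = {\<gamma>. smooth \<gamma> \<and>
     (\<forall>k is. bdd_above (range (\<lambda>x. (1 + norm x) ^ k * norm (partials is \<gamma> x))))}"

definition schwartz_seminorm :: "nat \<Rightarrow> 'd list \<Rightarrow> (real^'d \<Rightarrow> complex) \<Rightarrow> real" where
  "schwartz_seminorm k is \<gamma> = (SUP x. (1 + norm x) ^ k * norm (partials is \<gamma> x))"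

definition schwartz_topology :: "(real^'d \<Rightarrow> complex) topology" where
  "schwartz_topology = topology_generated_by
     {{\<eta> \<in> schwartz. schwartz_seminorm k is (\<lambda>x. \<eta> x - \<gamma> x) < r} | \<gamma> k is r. \<gamma> \<in> schwartz}"

type_synonym 'd distr = "(real^'d \<Rightarrow> complex) \<Rightarrow> complex"

text \<open>
  Functionals on the Schwartz space are total functions, made unique by the value 0 outside of it;
  hence equality of distributions is equality in HOL, and sums and multiples are pointwise.
\<close>

definition tempered :: "'d::finite distr set" where
  "tempered = {T. (\<forall>\<gamma>. \<gamma> \<notin> schwartz \<longrightarrow> T \<gamma> = 0) \<and>
     (\<forall>a. \<forall>\<gamma>\<in>schwartz. \<forall>\<eta>\<in>schwartz. T (\<lambda>x. a * \<gamma> x + \<eta> x) = a * T \<gamma> + T \<eta>) \<and>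
     continuous_map schwartz_topology euclidean T}"

definition distr_of :: "(real^'d::finite \<Rightarrow> complex) \<Rightarrow> 'd distr" where
  "distr_of f = (\<lambda>\<gamma>. if \<gamma> \<in> schwartz then LINT x|lebesgue. f x * \<gamma> x else 0)"

definition dirac0 :: "'d::finite distr" where
  "dirac0 = (\<lambda>\<gamma>. if \<gamma> \<in> schwartz then \<gamma> 0 else 0)"

definition fourier :: "(real^'d::finite \<Rightarrow> complex) \<Rightarrow> real^'d \<Rightarrow> complex" where
  "fourier \<gamma> x = complex_of_real ((2 * pi) powr (- real CARD('d) / 2)) *
     (LINT y|lebesgue. \<gamma> y * exp (- \<i> * complex_of_real (x \<bullet> y)))"

definition fourier_distr :: "'d::finite distr \<Rightarrow> 'd distr" where
  "fourier_distr T = (\<lambda>\<gamma>. if \<gamma> \<in> schwartz then T (fourier \<gamma>) else 0)"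


section \<open>Distributional operators\<close>

definition distr_linear :: "('d::finite distr \<Rightarrow> 'd distr) \<Rightarrow> bool" where
  "distr_linear P \<longleftrightarrow> (\<forall>T\<in>tempered. P T \<in> tempered) \<and>
     (\<forall>a. \<forall>T\<in>tempered. \<forall>U\<in>tempered. P (\<lambda>\<gamma>. a * T \<gamma> + U \<gamma>) = (\<lambda>\<gamma>. a * P T \<gamma> + P U \<gamma>))"

text \<open>
  The restriction of an operator to the Schwartz space, as a map on functions. There is at most one
  candidate for the value, because a Schwartz function is determined by its distribution.
\<close>

definition on_schwartz ::
  "('d::finite distr \<Rightarrow> 'd distr) \<Rightarrow> (real^'d \<Rightarrow> complex) \<Rightarrow> real^'d \<Rightarrow> complex" where
  "on_schwartz P \<gamma> = (SOME \<eta>. \<eta> \<in> schwartz \<and> P (distr_of \<gamma>) = distr_of \<eta>)"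

definition continuous_on_schwartz :: "('d::finite distr \<Rightarrow> 'd distr) \<Rightarrow> bool" where
  "continuous_on_schwartz P \<longleftrightarrow>
     (\<forall>\<gamma>\<in>schwartz. \<exists>\<eta>\<in>schwartz. P (distr_of \<gamma>) = distr_of \<eta>) \<and>
     continuous_map schwartz_topology schwartz_topology (on_schwartz P)"

text \<open>\<open>P\<close> is a distributional operator with distributional adjoint \<open>Q\<close>.\<close>

definition distributional_operator ::
  "('d::finite distr \<Rightarrow> 'd distr) \<Rightarrow> ('d distr \<Rightarrow> 'd distr) \<Rightarrow> bool" where
  "distributional_operator P Q \<longleftrightarrow>
     distr_linear P \<and> distr_linear Q \<and> continuous_on_schwartz P \<and> continuous_on_schwartz Q \<and>
     (\<forall>T\<in>tempered. \<forall>\<gamma>\<in>schwartz. P T \<gamma> = T (on_schwartz Q \<gamma>) \<and> Q T \<gamma> = T (on_schwartz P \<gamma>))"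

definition complex_adjoint_invariant :: "('d::finite distr \<Rightarrow> 'd distr) \<Rightarrow> bool" where
  "complex_adjoint_invariant P \<longleftrightarrow>
     (\<forall>\<gamma>\<in>schwartz. (\<lambda>x. cnj (on_schwartz P \<gamma> x)) = on_schwartz P (\<lambda>x. cnj (\<gamma> x)))"

definition is_distr_fourier_transform ::
  "(real^'d::finite \<Rightarrow> complex) \<Rightarrow> ('d distr \<Rightarrow> 'd distr) \<Rightarrow> bool" where
  "is_distr_fourier_transform p P \<longleftrightarrow> p \<in> FT_class \<and>
     (\<forall>T\<in>tempered. \<forall>\<gamma>\<in>schwartz. fourier_distr (P T) \<gamma> = fourier_distr T (\<lambda>x. p x * \<gamma> x))"

definition adj_compose ::
  "('n::finite \<Rightarrow> 'd::finite distr \<Rightarrow> 'd distr) \<Rightarrow> ('n \<Rightarrow> 'd distr \<Rightarrow> 'd distr) \<Rightarrow> 'd distr \<Rightarrow> 'd distr"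
  where
  "adj_compose Padj P = (\<lambda>T \<gamma>. \<Sum>j\<in>UNIV. Padj j (P j T) \<gamma>)"

definition green_function :: "('d::finite distr \<Rightarrow> 'd distr) \<Rightarrow> 'd distr \<Rightarrow> bool" where
  "green_function L E \<longleftrightarrow> E \<in> tempered \<and> L E = dirac0"

text \<open>
  The distribution \<open>P j f\<close> is in \<open>L\<^sub>2\<close> if it is represented by a square integrable function.
\<close>

definition gen_sobolev ::
  "('n::finite \<Rightarrow> 'd::finite distr \<Rightarrow> 'd distr) \<Rightarrow> (real^'d \<Rightarrow> real) set" where
  "gen_sobolev P = {f. locally_integrable f \<and> slowly_increasing f \<and>
     (\<forall>j. \<exists>h. square_integrable h \<and> P j (distr_of (\<lambda>x. complex_of_real (f x))) = distr_of h)}"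


section \<open>Native spaces\<close>

text \<open>Real polynomials of degree less than \<open>m\<close>; only the zero polynomial for \<open>m = 0\<close>.\<close>

definition multi_indices :: "nat \<Rightarrow> ('d::finite \<Rightarrow> nat) set" where
  "multi_indices m = {\<alpha>. sum \<alpha> UNIV < m}"

definition poly_space :: "nat \<Rightarrow> (real^'d \<Rightarrow> real) set" where
  "poly_space m = {\<lambda>x. \<Sum>\<alpha>\<in>multi_indices m. a \<alpha> * (\<Prod>i\<in>UNIV. (x $ i) ^ \<alpha> i) | a. True}"

text \<open>
  Centres and coefficients annihilating \<open>poly_space m\<close>. Terms with equal centres can be collected,
  so a finite set of centres with one coefficient for each is enough.
\<close>

definition annihilates :: "nat \<Rightarrow> (real^'d) set \<Rightarrow> (real^'d \<Rightarrow> real) \<Rightarrow> bool" where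
  "annihilates m X c \<longleftrightarrow> finite X \<and> (\<forall>p\<in>poly_space m. (\<Sum>x\<in>X. c x * p x) = 0)"

definition cond_pos_def :: "nat \<Rightarrow> (real^'d \<Rightarrow> real) \<Rightarrow> bool" where
  "cond_pos_def m \<Phi> \<longleftrightarrow> continuous_on UNIV \<Phi> \<and> (\<forall>x. \<Phi> (- x) = \<Phi> x) \<and>
     (\<forall>X c. annihilates m X c \<and> (\<exists>x\<in>X. c x \<noteq> 0) \<longrightarrow>
        0 < (\<Sum>x\<in>X. \<Sum>y\<in>X. c x * c y * \<Phi> (x - y)))"

definition translate_comb ::
  "(real^'d \<Rightarrow> real) \<Rightarrow> (real^'d) set \<Rightarrow> (real^'d \<Rightarrow> real) \<Rightarrow> real^'d \<Rightarrow> real" where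
  "translate_comb \<Phi> X c = (\<lambda>y. \<Sum>x\<in>X. c x * \<Phi> (y - x))"

definition pre_native :: "(real^'d \<Rightarrow> real) \<Rightarrow> nat \<Rightarrow> (real^'d \<Rightarrow> real) set" where
  "pre_native \<Phi> m = {translate_comb \<Phi> X c | X c. annihilates m X c}"

text \<open>For even \<open>\<Phi>\<close> the value below does not depend on the representations of \<open>f\<close> and \<open>g\<close>.\<close>

definition pre_inner ::
  "(real^'d \<Rightarrow> real) \<Rightarrow> nat \<Rightarrow> (real^'d \<Rightarrow> real) \<Rightarrow> (real^'d \<Rightarrow> real) \<Rightarrow> real" where
  "pre_inner \<Phi> m f g = (THE r. \<exists>X a Y b. annihilates m X a \<and> annihilates m Y b \<and>
     f = translate_comb \<Phi> X a \<and> g = translate_comb \<Phi> Y b \<and>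
     r = (\<Sum>x\<in>X. \<Sum>y\<in>Y. a x * b y * \<Phi> (x - y)))"

definition pre_dist ::
  "(real^'d \<Rightarrow> real) \<Rightarrow> nat \<Rightarrow> (real^'d \<Rightarrow> real) \<Rightarrow> (real^'d \<Rightarrow> real) \<Rightarrow> real" where
  "pre_dist \<Phi> m f g = sqrt (pre_inner \<Phi> m (\<lambda>x. f x - g x) (\<lambda>x. f x - g x))"

text \<open>
  The Hilbert space completion of \<open>pre_native \<Phi> m\<close>: Cauchy sequences modulo null sequences, with the
  inner product extended by taking limits.
\<close>

definition pre_Cauchy :: "(real^'d \<Rightarrow> real) \<Rightarrow> nat \<Rightarrow> (nat \<Rightarrow> real^'d \<Rightarrow> real) set" where
  "pre_Cauchy \<Phi> m = {s. (\<forall>n. s n \<in> pre_native \<Phi> m) \<and>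
     (\<forall>e>0. \<exists>M. \<forall>i\<ge>M. \<forall>j\<ge>M. pre_dist \<Phi> m (s i) (s j) < e)}"

definition null_rel ::
  "(real^'d \<Rightarrow> real) \<Rightarrow> nat \<Rightarrow> ((nat \<Rightarrow> real^'d \<Rightarrow> real) \<times> (nat \<Rightarrow> real^'d \<Rightarrow> real)) set" where
  "null_rel \<Phi> m = {(s, t). s \<in> pre_Cauchy \<Phi> m \<and> t \<in> pre_Cauchy \<Phi> m \<and>
     (\<lambda>n. pre_dist \<Phi> m (s n) (t n)) \<longlonglongrightarrow> 0}"

definition completion_space ::
  "(real^'d \<Rightarrow> real) \<Rightarrow> nat \<Rightarrow> (nat \<Rightarrow> real^'d \<Rightarrow> real) set set" where
  "completion_space \<Phi> m = pre_Cauchy \<Phi> m // null_rel \<Phi> m"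

definition completion_inner ::
  "(real^'d \<Rightarrow> real) \<Rightarrow> nat \<Rightarrow> (nat \<Rightarrow> real^'d \<Rightarrow> real) set \<Rightarrow> (nat \<Rightarrow> real^'d \<Rightarrow> real) set \<Rightarrow> real" where
  "completion_inner \<Phi> m A B =
     (THE r. \<exists>s\<in>A. \<exists>t\<in>B. (\<lambda>n. pre_inner \<Phi> m (s n) (t n)) \<longlonglongrightarrow> r)"

definition completion_embed ::
  "(real^'d \<Rightarrow> real) \<Rightarrow> nat \<Rightarrow> (real^'d \<Rightarrow> real) \<Rightarrow> (nat \<Rightarrow> real^'d \<Rightarrow> real) set" where
  "completion_embed \<Phi> m f = null_rel \<Phi> m `` {\<lambda>_. f}"

text \<open>
  Unisolvent sets with exactly as many points as the dimension of the polynomial space, for which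
  the monomials are a basis.
\<close>

definition unisolvent :: "nat \<Rightarrow> (real^'d) set \<Rightarrow> bool" where
  "unisolvent m \<Xi> \<longleftrightarrow> finite \<Xi> \<and> card \<Xi> = card (multi_indices m :: ('d \<Rightarrow> nat) set) \<and>
     (\<forall>p\<in>poly_space m. (\<forall>\<xi>\<in>\<Xi>. p \<xi> = 0) \<longrightarrow> p = (\<lambda>_. 0))"

definition lagrange :: "nat \<Rightarrow> (real^'d) set \<Rightarrow> real^'d \<Rightarrow> real^'d \<Rightarrow> real" where
  "lagrange m \<Xi> \<xi> = (THE q. q \<in> poly_space m \<and> (\<forall>\<eta>\<in>\<Xi>. q \<eta> = (if \<eta> = \<xi> then 1 else 0)))"

definition native_R ::
  "(real^'d \<Rightarrow> real) \<Rightarrow> nat \<Rightarrow> (real^'d) set \<Rightarrow> (nat \<Rightarrow> real^'d \<Rightarrow> real) set \<Rightarrow> real^'d \<Rightarrow> real" where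
  "native_R \<Phi> m \<Xi> A x = completion_inner \<Phi> m A
     (completion_embed \<Phi> m (\<lambda>y. \<Phi> (y - x) - (\<Sum>\<xi>\<in>\<Xi>. lagrange m \<Xi> \<xi> x * \<Phi> (y - \<xi>))))"

text \<open>
  As the native space does not depend on the unisolvent set \<open>\<Xi>\<close>, the set is a parameter. The definition
  is meaningful if \<open>cond_pos_def m \<Phi>\<close> and \<open>unisolvent m \<Xi>\<close>.
\<close>

definition native_space :: "(real^'d \<Rightarrow> real) \<Rightarrow> nat \<Rightarrow> (real^'d) set \<Rightarrow> (real^'d \<Rightarrow> real) set" where
  "native_space \<Phi> m \<Xi> =
     {\<lambda>x. p x + native_R \<Phi> m \<Xi> A x | p A. p \<in> poly_space m \<and> A \<in> completion_space \<Phi> m}"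

end

theory Submission
  imports Defs "HOL-Probability.Probability" "HOL-Library.Function_Algebras"
begin

text \<open>
  By the Riesz representation theorem, \<open>f\<close> lies in the native space iff
  \<open>(\<Sum>x. c x * f x)\<^sup>2 \<le> K * Q c\<close> for all finitely supported \<open>c\<close> annihilating polynomials of degree
  less than \<open>m\<close>, where \<open>Q c = (\<Sum>x. \<Sum>y. c x * c y * G (x - y))\<close>.

  The operators \<open>P j\<close> are Fourier multipliers, hence commute with translations and convolutions. For a
  real Schwartz function \<open>\<psi>\<close> the Green property therefore gives \<open>\<psi> = G * L \<psi>\<close>, and \<open>L \<psi>\<close>, whose Fourier
  transform vanishes at the origin to order \<open>m\<close>, annihilates the polynomials as well. So \<open>\<psi>\<close> is in the
  native space with norm given by \<open>\<integral> \<psi> L \<psi> = (\<Sum>j. \<integral> (P j \<psi>)\<^sup>2)\<close>, which is the estimate with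
  \<open>K\<close> equal to this energy.

  A general \<open>f\<close> is approximated by \<open>\<psi> = (f 1\<^sub>R) * \<phi>\<close> with a narrow Gaussian \<open>\<phi>\<close> and the indicator \<open>1\<^sub>R\<close> of
  a large ball. Since \<open>f\<close> is in \<open>L\<^sub>2\<close>, Young's inequality shows that \<open>P j \<psi> = (f 1\<^sub>R) * P j \<phi>\<close> is close
  to \<open>f * P j \<phi> = P j f * \<phi>\<close>, whose norm is at most that of \<open>P j f\<close>; so the energies stay bounded.
\<close>


section \<open>Riesz representation in semi-inner product spaces\<close>

text \<open>The distribution in \<open>multiplier_eq\<close> takes the default value 0 whenever
  \<open>p j * \<gamma>\<close> or its transform leaves the Schwartz space, and this is never
  excluded. Operators are therefore tested on Gaussians, whose transforms are explicit, and the
  multiplier is used only for identities and upper bounds that survive the default value. The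
  moments of \<open>L \<psi>\<close> come from finite differences of characters: the size of a
  transform near the origin is bounded, its derivatives are not touched.

  Riesz is used twice. For \<psi> any crude constant suffices to start it; the squared norms of the
  representing sequence then converge to \<open>\<integral> \<psi> L \<psi>\<close>, the constant
  wanted. Point evaluations do not annihilate polynomials in general and are replaced by
  \<open>interp_error\<close>, whose polynomial correction disappears when integrated against
  \<open>L \<psi>\<close>.

  The order of the two limits for \<open>f\<close> matters: the cut-off error carries the
  \<open>L1\<close> norm of \<open>P j \<phi>\<close>, which is not controlled as \<phi> narrows. So
  the ball grows with \<phi> fixed, and the Gaussian narrows afterwards.\<close>

lemma nonneg_quadratic_discriminant:
  fixes a b c :: real
  assumes "0 \<le> a" "\<And>t. 0 \<le> a * t\<^sup>2 + 2 * b * t + c"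
  shows "b\<^sup>2 \<le> a * c"
proof (cases "a = 0")
  case True
  have "b = 0"
  proof (rule ccontr)
    assume "b \<noteq> 0"
    \<comment> \<open>At this \<open>t\<close> the linear function \<open>2 * b * t + c\<close> has
      the value -1.\<close>
    then show False using assms(2)[of "- (c + 1) / (2 * b)"] True by (simp add: field_simps)
  qed
  then show ?thesis using True by simp
next
  case False
  with assms(1) have "a > 0" by simp
  then show ?thesis using assms(2)[of "- b / a"] by (simp add: field_simps power2_eq_square)
qed

text \<open>The single operation \<open>lc a u v\<close>, read as a u + v, stands for the whole
  linear structure. It obeys no vector space axioms of its own; only the effect on \<open>Q\<close>
  matters, because vectors are ever compared through \<open>Q\<close> alone. \<open>Q\<close> may be
  degenerate.\<close>

locale semi_inner_space =
  fixes V :: "'v set" and lc :: "real \<Rightarrow> 'v \<Rightarrow> 'v \<Rightarrow> 'v" and Q :: "'v \<Rightarrow> 'v \<Rightarrow> real"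
  assumes lc_closed: "\<And>a u v. u \<in> V \<Longrightarrow> v \<in> V \<Longrightarrow> lc a u v \<in> V"
    and Q_lc: "\<And>a u v w. u \<in> V \<Longrightarrow> v \<in> V \<Longrightarrow> w \<in> V \<Longrightarrow> Q (lc a u v) w = a * Q u w + Q v w"
    and Q_sym: "\<And>u v. u \<in> V \<Longrightarrow> v \<in> V \<Longrightarrow> Q u v = Q v u"
    and Q_nonneg: "\<And>u. u \<in> V \<Longrightarrow> 0 \<le> Q u u"
begin

lemma Q_lc_right: "u \<in> V \<Longrightarrow> v \<in> V \<Longrightarrow> w \<in> V \<Longrightarrow> Q w (lc a u v) = a * Q w u + Q w v"
  by (metis Q_lc Q_sym lc_closed)

lemma Q_lc_lc:
  assumes "u \<in> V" "v \<in> V"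
  shows "Q (lc a u v) (lc a u v) = a\<^sup>2 * Q u u + 2 * a * Q u v + Q v v"
  using assms by (simp add: Q_lc Q_lc_right lc_closed Q_sym[of v u] power2_eq_square algebra_simps)

lemma Cauchy_Schwarz:
  assumes "u \<in> V" "v \<in> V"
  shows "(Q u v)\<^sup>2 \<le> Q u u * Q v v"
proof (rule nonneg_quadratic_discriminant[OF Q_nonneg[OF assms(1)]])
  fix t
  show "0 \<le> Q u u * t\<^sup>2 + 2 * Q u v * t + Q v v"
    using Q_nonneg[OF lc_closed[OF assms, of t]] assms by (simp add: Q_lc_lc algebra_simps)
qed

text \<open>
  The sequence minimizes \<open>Q u u - 2 * l u\<close>; it represents \<open>l\<close> in the completion of \<open>V\<close>.
\<close>

lemma Riesz_sequence:
  assumes ne: "V \<noteq> {}"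
    and l_lc: "\<And>a u v. u \<in> V \<Longrightarrow> v \<in> V \<Longrightarrow> l (lc a u v) = a * l u + l v"
    and l_bound: "\<And>u. u \<in> V \<Longrightarrow> (l u)\<^sup>2 \<le> C * Q u u"
  obtains \<sigma> :: "nat \<Rightarrow> 'v" and K where
    "\<And>n. \<sigma> n \<in> V"
    "\<And>e. e > 0 \<Longrightarrow> \<exists>M. \<forall>i\<ge>M. \<forall>j\<ge>M. Q (lc (-1) (\<sigma> j) (\<sigma> i)) (lc (-1) (\<sigma> j) (\<sigma> i)) < e"
    "\<And>w. w \<in> V \<Longrightarrow> (\<lambda>n. Q (\<sigma> n) w) \<longlonglongrightarrow> l w"
    "\<And>n. Q (\<sigma> n) (\<sigma> n) \<le> K"
    "(\<lambda>n. Q (\<sigma> n) (\<sigma> n) - l (\<sigma> n)) \<longlonglongrightarrow> 0"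
proof -
  \<comment> \<open>The given constant may be negative; the estimates below need a nonnegative
    one.\<close>
  define D where "D = \<bar>C\<bar>"
  have D: "D \<ge> 0" and lD: "(l u)\<^sup>2 \<le> D * Q u u" if "u \<in> V" for u
    using l_bound[OF that] mult_right_mono[OF abs_ge_self[of C] Q_nonneg[OF that]] unfolding D_def by auto
  define J where "J u = Q u u - 2 * l u" for u
  \<comment> \<open>If \<open>J u < - D\<close>, then squaring \<open>Q u u + D < 2 * l u\<close>
    and inserting the bound for \<open>l\<close> gives \<open>(Q u u - D)^2 < 0\<close>.\<close>
  have J_ge: "J u \<ge> - D" if "u \<in> V" for u
  proof (rule ccontr)
    assume "\<not> J u \<ge> - D"
    then have "Q u u + D < 2 * l u" by (simp add: J_def)
    moreover have "0 \<le> Q u u + D" using Q_nonneg[OF that] D[OF that] by simp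
    ultimately have "(Q u u + D)\<^sup>2 < (2 * l u)\<^sup>2" by (intro power_strict_mono) auto
    also have "\<dots> \<le> 4 * (D * Q u u)" using lD[OF that] by (simp add: power2_eq_square)
    finally have "(Q u u - D)\<^sup>2 < 0" by (simp add: power2_eq_square algebra_simps)
    then show False by (simp add: not_less[symmetric])
  qed
  define d where "d = Inf (J ` V)"
  have bdd: "bdd_below (J ` V)" using J_ge by (intro bdd_belowI[of _ "- D"]) auto
  have d_le: "d \<le> J u" if "u \<in> V" for u unfolding d_def using bdd that by (intro cInf_lower) auto
  have "\<exists>u\<in>V. J u < d + 1 / real (Suc n)" for n
  proof -
    have "Inf (J ` V) < d + 1 / real (Suc n)" by (simp add: d_def)
    then show ?thesis using cInf_less_iff[OF _ bdd] ne by auto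
  qed
  then obtain \<sigma> where \<sigma>: "\<And>n. \<sigma> n \<in> V" and J\<sigma>: "\<And>n. J (\<sigma> n) < d + 1 / real (Suc n)" by metis
  \<comment> \<open>From \<open>2 * l u \<le> Q u u / 2 + 2 * D\<close> follows
    \<open>Q u u / 2 \<le> J u + 2 * D\<close>, and \<open>J (\<sigma> n) < d + 1\<close>.\<close>
  define K where "K = 2 * (d + 1 + 2 * D)"
  have K: "Q (\<sigma> n) (\<sigma> n) \<le> K" for n
  proof -
    have "2 * l (\<sigma> n) \<le> Q (\<sigma> n) (\<sigma> n) / 2 + 2 * D"
    proof (rule ccontr)
      assume "\<not> ?thesis"
      then have "Q (\<sigma> n) (\<sigma> n) / 2 + 2 * D < 2 * l (\<sigma> n)" by simp
      moreover have "0 \<le> Q (\<sigma> n) (\<sigma> n) / 2 + 2 * D" using Q_nonneg[OF \<sigma>] D[OF \<sigma>] by simp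
      ultimately have "(Q (\<sigma> n) (\<sigma> n) / 2 + 2 * D)\<^sup>2 < (2 * l (\<sigma> n))\<^sup>2" by (intro power_strict_mono) auto
      also have "\<dots> \<le> 4 * (D * Q (\<sigma> n) (\<sigma> n))" using lD[OF \<sigma>] by (simp add: power2_eq_square)
      finally have "(Q (\<sigma> n) (\<sigma> n) / 2 - 2 * D)\<^sup>2 < 0" by (simp add: power2_eq_square algebra_simps)
      then show False by (simp add: not_less[symmetric])
    qed
    moreover have "J (\<sigma> n) < d + 1" using J\<sigma>[of n] by (rule less_le_trans) simp
    ultimately show ?thesis by (simp add: J_def K_def)
  qed
  \<comment> \<open>Quantified first variation: \<open>J (lc t w u) - d\<close> is a nonnegative
    quadratic in \<open>t\<close>, so its discriminant bounds the failure of \<open>u\<close> to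
    represent \<open>l\<close> at \<open>w\<close>.\<close>
  have var: "(Q u w - l w)\<^sup>2 \<le> Q w w * (J u - d)" if u: "u \<in> V" and w: "w \<in> V" for u w
  proof (rule nonneg_quadratic_discriminant[OF Q_nonneg[OF w]])
    fix t
    have "d \<le> J (lc t w u)" using d_le lc_closed[OF w u] by blast
    then show "0 \<le> Q w w * t\<^sup>2 + 2 * (Q u w - l w) * t + (J u - d)"
      using u w by (simp add: J_def Q_lc_lc l_lc Q_sym[of w u] algebra_simps)
  qed
  \<comment> \<open>Parallelogram law, with \<open>J\<close> at least \<open>d\<close> at the
    midpoint of \<open>u\<close> and \<open>v\<close>.\<close>
  have par: "Q (lc (-1) v u) (lc (-1) v u) \<le> 2 * (J u - d) + 2 * (J v - d)"
    if u: "u \<in> V" and v: "v \<in> V" for u v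
  proof -
    \<comment> \<open>This is v/2, written as -v/2 + v because no zero vector is available for
      scaling.\<close>
    define h where "h = lc (-1/2) v v"
    have h: "h \<in> V" unfolding h_def by (intro lc_closed v)
    have hQ: "Q h w = Q v w / 2" if "w \<in> V" for w
      using that v by (simp add: h_def Q_lc)
    have lh: "l h = l v / 2" using v by (simp add: h_def l_lc)
    have "d \<le> J (lc (1/2) u h)" using d_le lc_closed[OF u h] by blast
    moreover have "Q u h = Q u v / 2" using hQ[OF u] Q_sym u v h by simp
    moreover have "Q h h = Q v v / 4" using hQ[OF h] hQ[OF v] Q_sym v h by simp
    ultimately have "4 * d \<le> Q u u + 2 * Q u v + Q v v - 4 * l u - 4 * l v"
      using u h by (simp add: J_def Q_lc_lc l_lc lh field_simps power2_eq_square)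
    then show ?thesis
      using u v by (simp add: J_def Q_lc_lc Q_sym[of v u] algebra_simps)
  qed
  have lim0: "(\<lambda>n. J (\<sigma> n) - d) \<longlonglongrightarrow> 0"
  proof (rule tendsto_sandwich[OF _ _ tendsto_const])
    show "\<forall>\<^sub>F n in sequentially. 0 \<le> J (\<sigma> n) - d" using d_le \<sigma> by simp
    show "\<forall>\<^sub>F n in sequentially. J (\<sigma> n) - d \<le> 1 / real (Suc n)"
      using J\<sigma> by (intro always_eventually allI) (smt (verit))
    show "(\<lambda>n. 1 / real (Suc n)) \<longlonglongrightarrow> 0" using LIMSEQ_Suc[OF lim_1_over_n] by simp
  qed
  have conv: "(\<lambda>n. Q (\<sigma> n) w - l w) \<longlonglongrightarrow> 0" if w: "w \<in> V" for w
  proof -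
    have "(\<lambda>n. (Q (\<sigma> n) w - l w)\<^sup>2) \<longlonglongrightarrow> 0"
    proof (rule tendsto_sandwich[OF _ _ tendsto_const])
      show "\<forall>\<^sub>F n in sequentially. 0 \<le> (Q (\<sigma> n) w - l w)\<^sup>2" by simp
      show "\<forall>\<^sub>F n in sequentially. (Q (\<sigma> n) w - l w)\<^sup>2 \<le> Q w w * (J (\<sigma> n) - d)"
        using var \<sigma> w by simp
      show "(\<lambda>n. Q w w * (J (\<sigma> n) - d)) \<longlonglongrightarrow> 0" using tendsto_mult_right_zero[OF lim0] .
    qed
    from tendsto_real_sqrt[OF this] show ?thesis by (simp add: tendsto_rabs_zero_iff)
  qed
  \<comment> \<open>Here the test vector in \<open>var\<close> is \<open>\<sigma> n\<close> itself,
    so the factor \<open>Q w w\<close> varies with \<open>n\<close> and is replaced by the uniform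
    bound \<open>K\<close>.\<close>
  have conv2: "(\<lambda>n. Q (\<sigma> n) (\<sigma> n) - l (\<sigma> n)) \<longlonglongrightarrow> 0"
  proof -
    have "(\<lambda>n. (Q (\<sigma> n) (\<sigma> n) - l (\<sigma> n))\<^sup>2) \<longlonglongrightarrow> 0"
    proof (rule tendsto_sandwich[OF _ _ tendsto_const])
      show "\<forall>\<^sub>F n in sequentially. 0 \<le> (Q (\<sigma> n) (\<sigma> n) - l (\<sigma> n))\<^sup>2" by simp
      have "(Q (\<sigma> n) (\<sigma> n) - l (\<sigma> n))\<^sup>2 \<le> K * (J (\<sigma> n) - d)" for n
        using var[OF \<sigma> \<sigma>, of n n] mult_right_mono[OF K[of n], of "J (\<sigma> n) - d"] d_le[OF \<sigma>, of n]
        by linarith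
      then show "\<forall>\<^sub>F n in sequentially. (Q (\<sigma> n) (\<sigma> n) - l (\<sigma> n))\<^sup>2 \<le> K * (J (\<sigma> n) - d)" by simp
      show "(\<lambda>n. K * (J (\<sigma> n) - d)) \<longlonglongrightarrow> 0" using tendsto_mult_right_zero[OF lim0] .
    qed
    from tendsto_real_sqrt[OF this] show ?thesis by (simp add: tendsto_rabs_zero_iff)
  qed
  have Cau: "\<exists>M. \<forall>i\<ge>M. \<forall>j\<ge>M. Q (lc (-1) (\<sigma> j) (\<sigma> i)) (lc (-1) (\<sigma> j) (\<sigma> i)) < e" if "e > 0" for e
  proof -
    have "\<forall>\<^sub>F n in sequentially. J (\<sigma> n) - d < e / 4" by (rule order_tendstoD(2)[OF lim0]) (use that in simp)
    then obtain M where M: "\<And>n. n \<ge> M \<Longrightarrow> J (\<sigma> n) - d < e / 4" unfolding eventually_sequentially by auto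
    have "Q (lc (-1) (\<sigma> j) (\<sigma> i)) (lc (-1) (\<sigma> j) (\<sigma> i)) < e" if "i \<ge> M" "j \<ge> M" for i j
    proof -
      have "2 * (J (\<sigma> i) - d) + 2 * (J (\<sigma> j) - d) < 2 * (e / 4) + 2 * (e / 4)"
        using M[OF that(1)] M[OF that(2)] by (intro add_strict_mono mult_strict_left_mono) auto
      also have "\<dots> = e" by simp
      finally show ?thesis using par[OF \<sigma>[of i] \<sigma>[of j]] by (rule le_less_trans[rotated])
    qed
    then show ?thesis by blast
  qed
  show ?thesis using that[OF \<sigma> Cau _ K conv2] conv by (simp add: LIM_zero_iff)
qed

end

section \<open>Finitely supported coefficients and the kernel form\<close>

text \<open>Coefficients are functions on the whole space instead of being tied to a set of centres.
  Linear combinations are then pointwise, and no sets of centres have to be merged.\<close>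

definition pairing :: "('a \<Rightarrow> real) \<Rightarrow> ('a \<Rightarrow> real) \<Rightarrow> real" where
  "pairing c f = (\<Sum>x | c x \<noteq> 0. c x * f x)"

lemma pairing_eq:
  assumes "finite X" "{x. c x \<noteq> 0} \<subseteq> X"
  shows "pairing c f = (\<Sum>x\<in>X. c x * f x)"
  unfolding pairing_def by (rule sum.mono_neutral_left) (use assms in auto)

definition fsupp :: "('a \<Rightarrow> real) set" where "fsupp = {c. finite {x. c x \<noteq> 0}}"

lemma fsupp_lc: "c \<in> fsupp \<Longrightarrow> d \<in> fsupp \<Longrightarrow> (\<lambda>x. a * c x + d x) \<in> fsupp"
  unfolding fsupp_def
  by (auto intro: finite_subset[of _ "{x. c x \<noteq> 0} \<union> {x. d x \<noteq> 0}"])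

lemma pairing_lc:
  assumes "c \<in> fsupp" "d \<in> fsupp"
  shows "pairing (\<lambda>x. a * c x + d x) f = a * pairing c f + pairing d f"
proof -
  let ?X = "{x. c x \<noteq> 0} \<union> {x. d x \<noteq> 0}"
  have X: "finite ?X" using assms by (simp add: fsupp_def)
  have "pairing (\<lambda>x. a * c x + d x) f = (\<Sum>x\<in>?X. (a * c x + d x) * f x)" by (rule pairing_eq[OF X]) auto
  also have "\<dots> = a * (\<Sum>x\<in>?X. c x * f x) + (\<Sum>x\<in>?X. d x * f x)"
    by (simp add: sum_distrib_left sum.distrib algebra_simps)
  also have "(\<Sum>x\<in>?X. c x * f x) = pairing c f" by (rule pairing_eq[OF X, symmetric]) auto
  also have "(\<Sum>x\<in>?X. d x * f x) = pairing d f" by (rule pairing_eq[OF X, symmetric]) auto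
  finally show ?thesis .
qed

lemma pairing_sum_right: "pairing c (\<lambda>x. \<Sum>i\<in>I. f i x) = (\<Sum>i\<in>I. pairing c (f i))"
  unfolding pairing_def by (subst sum.swap) (simp add: sum_distrib_left)

lemma pairing_cmult_right: "pairing c (\<lambda>x. r * f x) = r * pairing c f"
  by (simp add: pairing_def sum_distrib_left algebra_simps)

lemma pairing_swap: "pairing c (\<lambda>x. pairing d (\<lambda>y. h x y)) = pairing d (\<lambda>y. pairing c (\<lambda>x. h x y))"
  unfolding pairing_def by (simp add: sum_distrib_left mult.left_commute sum.swap[of _ "{x. d x \<noteq> 0}"])

definition annihilators :: "nat \<Rightarrow> (real^'d \<Rightarrow> real) set" where
  "annihilators m = {c \<in> fsupp. \<forall>p\<in>poly_space m. pairing c p = 0}"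

definition kernel_form :: "(real^'d \<Rightarrow> real) \<Rightarrow> (real^'d \<Rightarrow> real) \<Rightarrow> (real^'d \<Rightarrow> real) \<Rightarrow> real" where
  "kernel_form \<Phi> c d = pairing c (\<lambda>x. pairing d (\<lambda>y. \<Phi> (x - y)))"

lemma annihilators_annihilates: "c \<in> annihilators m \<Longrightarrow> annihilates m {x. c x \<noteq> 0} c"
  by (simp add: annihilators_def annihilates_def fsupp_def pairing_def)

lemma annihilators_lc: "c \<in> annihilators m \<Longrightarrow> d \<in> annihilators m \<Longrightarrow> (\<lambda>x. a * c x + d x) \<in> annihilators m"
  by (simp add: annihilators_def fsupp_lc pairing_lc)

lemma annihilators_fsupp: "c \<in> annihilators m \<Longrightarrow> c \<in> fsupp" by (simp add: annihilators_def)

lemma semi_inner_annihilators: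
  fixes \<Phi> :: "real^'d \<Rightarrow> real"
  assumes "cond_pos_def m \<Phi>"
  shows "semi_inner_space (annihilators m) (\<lambda>a c d x. a * c x + d x) (kernel_form \<Phi>)"
proof
  have even: "\<Phi> (- x) = \<Phi> x" for x using assms by (simp add: cond_pos_def_def)
  fix a :: real and c d e :: "real^'d \<Rightarrow> real"
  assume c: "c \<in> annihilators m" and d: "d \<in> annihilators m"
  show "(\<lambda>x. a * c x + d x) \<in> annihilators m" using c d by (rule annihilators_lc)
  show "kernel_form \<Phi> (\<lambda>x. a * c x + d x) e = a * kernel_form \<Phi> c e + kernel_form \<Phi> d e"
    using c d by (simp add: kernel_form_def pairing_lc annihilators_fsupp)
  have "kernel_form \<Phi> c d = pairing d (\<lambda>y. pairing c (\<lambda>x. \<Phi> (x - y)))" unfolding kernel_form_def by (rule pairing_swap)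
  also have "\<dots> = kernel_form \<Phi> d c"
    unfolding kernel_form_def using even by (metis (no_types, lifting) ext minus_diff_eq)
  finally show "kernel_form \<Phi> c d = kernel_form \<Phi> d c" .
next
  fix c :: "real^'d \<Rightarrow> real"
  assume c: "c \<in> annihilators m"
  have "kernel_form \<Phi> c c = (\<Sum>x | c x \<noteq> 0. \<Sum>y | c y \<noteq> 0. c x * c y * \<Phi> (x - y))"
    by (simp add: kernel_form_def pairing_def sum_distrib_left mult_ac)
  moreover have "0 \<le> \<dots>"
  proof (cases "\<exists>x\<in>{x. c x \<noteq> 0}. c x \<noteq> 0")
    case True
    then show ?thesis using assms annihilators_annihilates[OF c] unfolding cond_pos_def_def
      by (intro less_imp_le) blast
  qed simp
  ultimately show "0 \<le> kernel_form \<Phi> c c" by simp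
qed

section \<open>Lagrange bases\<close>

text \<open>Induction over the variables: with the others fixed, the sum is a polynomial in the
  coordinate \<open>j\<close> that vanishes identically, so the coefficient of each power is zero.
  The hypothesis that exponents in \<open>S\<close> are separated by \<open>I\<close> passes to the
  slices with a fixed exponent of \<open>j\<close>, and for empty \<open>I\<close> it leaves a
  single exponent.\<close>

lemma monomials_independent_aux:
  fixes a :: "('i::finite \<Rightarrow> nat) \<Rightarrow> real"
  assumes "finite I" "finite S"
    and "\<And>\<alpha> \<beta>. \<alpha> \<in> S \<Longrightarrow> \<beta> \<in> S \<Longrightarrow> (\<And>i. i \<in> I \<Longrightarrow> \<alpha> i = \<beta> i) \<Longrightarrow> \<alpha> = \<beta>"
    and "\<And>x :: real^'i. (\<Sum>\<alpha>\<in>S. a \<alpha> * (\<Prod>i\<in>I. (x $ i) ^ \<alpha> i)) = 0"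
    and "\<alpha> \<in> S"
  shows "a \<alpha> = 0"
  using assms
proof (induction I arbitrary: S \<alpha> rule: finite_induct)
  case empty
  then have "S = {\<alpha>}" by auto
  then show ?case using empty.prems(3) by simp
next
  case (insert j I)
  define N where "N = Max ((\<lambda>\<alpha>. \<alpha> j) ` S)"
  have N: "\<beta> j \<le> N" if "\<beta> \<in> S" for \<beta>
    unfolding N_def using insert.prems(1) that by (intro Max_ge) auto
  define S' where "S' k = {\<beta> \<in> S. \<beta> j = k}" for k
  have *: "(\<Sum>\<beta>\<in>S' k. a \<beta> * (\<Prod>i\<in>I. (x $ i) ^ \<beta> i)) = 0" for k and x :: "real^'i"
  proof -
    define c where "c k = (\<Sum>\<beta>\<in>S' k. a \<beta> * (\<Prod>i\<in>I. (x $ i) ^ \<beta> i))" for k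
    have "(\<Sum>k\<le>N. c k * t ^ k) = 0" for t
    proof -
      define y where "y = (\<chi> i. if i = j then t else x $ i)"
      have p: "(\<Prod>i\<in>I. (y $ i) ^ \<beta> i) = (\<Prod>i\<in>I. (x $ i) ^ \<beta> i)" for \<beta>
        by (rule prod.cong) (use insert.hyps in \<open>auto simp: y_def\<close>)
      have "0 = (\<Sum>\<beta>\<in>S. a \<beta> * (\<Prod>i\<in>insert j I. (y $ i) ^ \<beta> i))"
        using insert.prems(3) by simp
      also have "\<dots> = (\<Sum>\<beta>\<in>S. t ^ \<beta> j * (a \<beta> * (\<Prod>i\<in>I. (x $ i) ^ \<beta> i)))"
        using insert.hyps by (simp add: p) (simp add: y_def mult_ac)
      also have "\<dots> = (\<Sum>k\<le>N. \<Sum>\<beta>\<in>S' k. t ^ \<beta> j * (a \<beta> * (\<Prod>i\<in>I. (x $ i) ^ \<beta> i)))"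
        unfolding S'_def by (rule sum.group[symmetric]) (use insert.prems(1) N in auto)
      also have "\<dots> = (\<Sum>k\<le>N. c k * t ^ k)"
        unfolding c_def sum_distrib_right
        by (intro sum.cong refl) (simp add: S'_def mult_ac)
      finally show ?thesis by simp
    qed
    then have "\<forall>k\<le>N. c k = 0" using polyfun_eq_0[of c N] by blast
    moreover have "c k = 0" if "k > N"
    proof -
      have "S' k = {}" using N that unfolding S'_def by fastforce
      then show ?thesis by (simp add: c_def)
    qed
    ultimately show ?thesis using c_def not_le by metis
  qed
  show ?case
  proof (rule insert.IH[of "S' (\<alpha> j)"])
    show "finite (S' (\<alpha> j))" "\<alpha> \<in> S' (\<alpha> j)" using insert.prems by (auto simp: S'_def)
    show "\<beta> = \<gamma>" if "\<beta> \<in> S' (\<alpha> j)" "\<gamma> \<in> S' (\<alpha> j)" "\<And>i. i \<in> I \<Longrightarrow> \<beta> i = \<gamma> i" for \<beta> \<gamma>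
      by (rule insert.prems(2)) (use that in \<open>auto simp: S'_def\<close>)
  qed (use * in auto)
qed

lemma finite_multi_indices: "finite (multi_indices m :: ('i::finite \<Rightarrow> nat) set)"
proof (rule finite_subset)
  show "(multi_indices m :: ('i \<Rightarrow> nat) set) \<subseteq> {f. \<forall>i. f i \<in> {..<m}}"
  proof
    fix \<alpha> :: "'i \<Rightarrow> nat" assume "\<alpha> \<in> multi_indices m"
    then have "\<alpha> i < m" for i
      using member_le_sum[of i UNIV \<alpha>] by (simp add: multi_indices_def)
    then show "\<alpha> \<in> {f. \<forall>i. f i \<in> {..<m}}" by simp
  qed
  show "finite {f :: 'i \<Rightarrow> nat. \<forall>i. f i \<in> {..<m}}"
    using finite_PiE[of "UNIV :: 'i set" "\<lambda>_. {..<m}"] by (simp add: PiE_UNIV_domain Pi_def)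
qed

lemma monomials_independent:
  fixes a :: "('i::finite \<Rightarrow> nat) \<Rightarrow> real"
  assumes "(\<lambda>x::real^'i. \<Sum>\<alpha>\<in>multi_indices m. a \<alpha> * (\<Prod>i\<in>UNIV. (x $ i) ^ \<alpha> i)) = (\<lambda>_. 0)"
    and "\<alpha> \<in> multi_indices m"
  shows "a \<alpha> = 0"
  by (rule monomials_independent_aux[of UNIV "multi_indices m"])
     (use assms in \<open>auto simp: finite_multi_indices fun_eq_iff\<close>)

lemma poly_space_lc:
  assumes "p \<in> poly_space m" "q \<in> poly_space m"
  shows "(\<lambda>x. r * p x + q x) \<in> poly_space m"
proof -
  from assms obtain a b where p: "p = (\<lambda>x. \<Sum>\<alpha>\<in>multi_indices m. a \<alpha> * (\<Prod>i\<in>UNIV. (x $ i) ^ \<alpha> i))"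
    and q: "q = (\<lambda>x. \<Sum>\<alpha>\<in>multi_indices m. b \<alpha> * (\<Prod>i\<in>UNIV. (x $ i) ^ \<alpha> i))"
    by (auto simp: poly_space_def)
  have "(\<lambda>x. r * p x + q x) = (\<lambda>x. \<Sum>\<alpha>\<in>multi_indices m. (r * a \<alpha> + b \<alpha>) * (\<Prod>i\<in>UNIV. (x $ i) ^ \<alpha> i))"
    by (auto simp: p q sum_distrib_left sum.distrib algebra_simps)
  then show ?thesis unfolding poly_space_def by (auto intro!: exI[of _ "\<lambda>\<alpha>. r * a \<alpha> + b \<alpha>"])
qed

lemma zero_in_poly_space: "(\<lambda>_. 0) \<in> poly_space m"
  unfolding poly_space_def by (auto intro!: exI[of _ "\<lambda>_. 0"])

lemma poly_space_sum:
  assumes "finite I" "\<And>i. i \<in> I \<Longrightarrow> p i \<in> poly_space m"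
  shows "(\<lambda>x. \<Sum>i\<in>I. r i * p i x) \<in> poly_space m"
  using assms
proof (induction I rule: finite_induct)
  case (insert i I)
  then show ?case using poly_space_lc[of "p i" m "\<lambda>x. \<Sum>i\<in>I. r i * p i x" "r i"] by auto
qed (simp add: zero_in_poly_space)

text \<open>A dimension count. By unisolvence the monomials stay independent after restriction to
  \<Xi>; there are as many of them as points, so they span all functions on \<Xi>, among them the
  indicator of \<xi>.\<close>

lemma Lagrange_basis_exists:
  fixes \<Xi> :: "(real^'i::finite) set"
  assumes uni: "unisolvent m \<Xi>" and \<xi>: "\<xi> \<in> \<Xi>"
  shows "\<exists>q\<in>poly_space m. \<forall>\<eta>\<in>\<Xi>. q \<eta> = (if \<eta> = \<xi> then 1 else 0)"
proof -
  have \<Xi>: "finite \<Xi>" "card \<Xi> = card (multi_indices m :: ('i \<Rightarrow> nat) set)"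
    and \<Xi>0: "\<And>p. p \<in> poly_space m \<Longrightarrow> (\<forall>\<xi>\<in>\<Xi>. p \<xi> = 0) \<Longrightarrow> p = (\<lambda>_. 0)"
    using uni by (auto simp: unisolvent_def)
  interpret vs: vector_space "\<lambda>(r::real) (f :: real^'i \<Rightarrow> real) x. r * f x"
    by unfold_locales (auto simp: fun_eq_iff algebra_simps)
  \<comment> \<open>Setting the monomials to zero off \<Xi> realizes the restriction inside the
    space of functions on the whole of \<open>real^'i\<close>, where they lie in the span of the
    finitely many indicators \<open>dl\<close>.\<close>
  define mon :: "('i \<Rightarrow> nat) \<Rightarrow> real^'i \<Rightarrow> real" where
    "mon \<alpha> x = (if x \<in> \<Xi> then \<Prod>i\<in>UNIV. (x $ i) ^ \<alpha> i else 0)" for \<alpha> x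
  define dl :: "real^'i \<Rightarrow> real^'i \<Rightarrow> real" where "dl \<eta> x = (if x = \<eta> then 1 else 0)" for \<eta> x
  have sum_app: "(\<Sum>i\<in>I. f i) x = (\<Sum>i\<in>I. f i x)" for I and f :: "'k \<Rightarrow> real^'i \<Rightarrow> real" and x
    by (induction I rule: infinite_finite_induct) auto
  have zero: "a \<alpha> = 0" if a: "\<And>x. (\<Sum>\<alpha>\<in>multi_indices m. a \<alpha> * mon \<alpha> x) = 0" and "\<alpha> \<in> multi_indices m" for a \<alpha>
  proof (rule monomials_independent[OF \<Xi>0 that(2)])
    show "(\<lambda>x::real^'i. \<Sum>\<alpha>\<in>multi_indices m. a \<alpha> * (\<Prod>i\<in>UNIV. (x $ i) ^ \<alpha> i)) \<in> poly_space m"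
      by (auto simp: poly_space_def)
    show "\<forall>\<xi>\<in>\<Xi>. (\<Sum>\<alpha>\<in>multi_indices m. a \<alpha> * (\<Prod>i\<in>UNIV. (\<xi> $ i) ^ \<alpha> i)) = 0"
    proof
      fix \<xi> assume "\<xi> \<in> \<Xi>"
      then show "(\<Sum>\<alpha>\<in>multi_indices m. a \<alpha> * (\<Prod>i\<in>UNIV. (\<xi> $ i) ^ \<alpha> i)) = 0"
        using a[of \<xi>] by (simp add: mon_def)
    qed
  qed
  have inj: "inj_on mon (multi_indices m)"
  proof (rule inj_onI)
    fix \<alpha> \<beta> :: "'i \<Rightarrow> nat"
    assume *: "\<alpha> \<in> multi_indices m" "\<beta> \<in> multi_indices m" "mon \<alpha> = mon \<beta>"
    show "\<alpha> = \<beta>"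
    proof (rule ccontr)
      assume ne: "\<alpha> \<noteq> \<beta>"
      define a where "a \<gamma> = (if \<gamma> = \<alpha> then 1 else if \<gamma> = \<beta> then - 1 else (0::real))" for \<gamma>
      have "(\<Sum>\<gamma>\<in>multi_indices m. a \<gamma> * mon \<gamma> x) = (\<Sum>\<gamma>\<in>{\<alpha>, \<beta>}. a \<gamma> * mon \<gamma> x)" for x
        by (rule sum.mono_neutral_right) (use * in \<open>auto simp: a_def finite_multi_indices\<close>)
      also have "\<dots> x = 0" for x using ne *(3) by (simp add: a_def)
      finally have "a \<alpha> = 0" using zero *(1) by blast
      then show False by (simp add: a_def)
    qed
  qed
  let ?M = "mon ` multi_indices m"
  have indep: "vs.independent ?M"
  proof (subst vs.independent_explicit_finite_subsets, intro allI ballI impI)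
    fix S u v
    assume S: "S \<subseteq> ?M" "finite S" and s0: "(\<Sum>v\<in>S. (\<lambda>x. u v * v x)) = 0" and v: "v \<in> S"
    from v S obtain \<alpha> where \<alpha>: "v = mon \<alpha>" "\<alpha> \<in> multi_indices m" by auto
    define a where "a \<beta> = (if mon \<beta> \<in> S then u (mon \<beta>) else 0)" for \<beta>
    have "a \<alpha> = 0"
    proof (rule zero[OF _ \<alpha>(2)])
      fix x
      have "(\<Sum>\<beta>\<in>multi_indices m. a \<beta> * mon \<beta> x) = (\<Sum>w\<in>?M. (if w \<in> S then u w else 0) * w x)"
        by (subst sum.reindex[OF inj]) (simp add: a_def)
      also have "\<dots> = (\<Sum>w\<in>S. u w * w x)"
        using S finite_multi_indices by (intro sum.mono_neutral_cong_right) auto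
      also have "\<dots> = 0" using fun_cong[OF s0, of x] by (simp add: sum_app)
      finally show "(\<Sum>\<beta>\<in>multi_indices m. a \<beta> * mon \<beta> x) = 0" .
    qed
    then show "u v = 0" using v by (simp add: a_def \<alpha>)
  qed
  have span: "f \<in> vs.span (dl ` \<Xi>)" if "\<And>x. x \<notin> \<Xi> \<Longrightarrow> f x = 0" for f
  proof -
    have "f = (\<Sum>\<eta>\<in>\<Xi>. (\<lambda>x. f \<eta> * dl \<eta> x))"
      using that \<Xi>(1) by (auto simp: fun_eq_iff sum_app dl_def if_distrib sum.delta cong: if_cong)
    moreover have "\<dots> \<in> vs.span (dl ` \<Xi>)"
      by (intro vs.span_sum vs.span_scale vs.span_base) auto
    ultimately show ?thesis by simp
  qed
  \<comment> \<open>Otherwise adjoining \<open>dl \<xi>\<close> would give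
    \<open>card \<Xi> + 1\<close> independent vectors in the span of \<open>card \<Xi>\<close>
    vectors.\<close>
  have "dl \<xi> \<in> vs.span ?M"
  proof (rule ccontr)
    assume "dl \<xi> \<notin> vs.span ?M"
    then have "vs.independent (insert (dl \<xi>) ?M)" "dl \<xi> \<notin> ?M"
      using vs.independent_insert[of "dl \<xi>" ?M] indep vs.span_base by auto
    moreover have "insert (dl \<xi>) ?M \<subseteq> vs.span (dl ` \<Xi>)"
      using \<xi> by (auto intro!: span simp: mon_def dl_def)
    ultimately have "card (insert (dl \<xi>) ?M) \<le> card (dl ` \<Xi>)"
      using vs.independent_span_bound[of "dl ` \<Xi>" "insert (dl \<xi>) ?M"] \<Xi>(1) by auto
    also have "\<dots> \<le> card \<Xi>" by (rule card_image_le[OF \<Xi>(1)])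
    also have "\<dots> = card ?M" using \<Xi>(2) card_image[OF inj] by simp
    finally show False using \<open>dl \<xi> \<notin> ?M\<close> by (simp add: card_insert_if finite_multi_indices)
  qed
  then obtain S u where S: "finite S" "S \<subseteq> ?M" "dl \<xi> = (\<Sum>v\<in>S. (\<lambda>x. u v * v x))"
    unfolding vs.span_explicit by auto
  define a where "a \<beta> = (if mon \<beta> \<in> S then u (mon \<beta>) else 0)" for \<beta>
  define q where "q = (\<lambda>x::real^'i. \<Sum>\<alpha>\<in>multi_indices m. a \<alpha> * (\<Prod>i\<in>UNIV. (x $ i) ^ \<alpha> i))"
  have "q \<eta> = (if \<eta> = \<xi> then 1 else 0)" if \<eta>: "\<eta> \<in> \<Xi>" for \<eta>
  proof -
    have "q \<eta> = (\<Sum>\<beta>\<in>multi_indices m. a \<beta> * mon \<beta> \<eta>)" using \<eta> by (simp add: q_def mon_def)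
    also have "\<dots> = (\<Sum>w\<in>?M. (if w \<in> S then u w else 0) * w \<eta>)"
      by (subst sum.reindex[OF inj]) (simp add: a_def)
    also have "\<dots> = (\<Sum>w\<in>S. u w * w \<eta>)"
      using S finite_multi_indices by (intro sum.mono_neutral_cong_right) auto
    also have "\<dots> = dl \<xi> \<eta>" using fun_cong[OF S(3), of \<eta>] by (simp add: sum_app)
    finally show ?thesis by (simp add: dl_def)
  qed
  moreover have "q \<in> poly_space m" by (auto simp: q_def poly_space_def)
  ultimately show ?thesis by blast
qed

lemma lagrange_props:
  fixes \<Xi> :: "(real^'i::finite) set"
  assumes uni: "unisolvent m \<Xi>" and \<xi>: "\<xi> \<in> \<Xi>"
  shows "lagrange m \<Xi> \<xi> \<in> poly_space m"
    and "\<eta> \<in> \<Xi> \<Longrightarrow> lagrange m \<Xi> \<xi> \<eta> = (if \<eta> = \<xi> then 1 else 0)"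
proof -
  have "\<exists>!q. q \<in> poly_space m \<and> (\<forall>\<eta>\<in>\<Xi>. q \<eta> = (if \<eta> = \<xi> then 1 else 0))"
  proof (rule ex_ex1I)
    show "\<exists>q. q \<in> poly_space m \<and> (\<forall>\<eta>\<in>\<Xi>. q \<eta> = (if \<eta> = \<xi> then 1 else 0))"
      using Lagrange_basis_exists[OF assms] by blast
    fix p q
    assume p: "p \<in> poly_space m \<and> (\<forall>\<eta>\<in>\<Xi>. p \<eta> = (if \<eta> = \<xi> then 1 else 0))"
      and q: "q \<in> poly_space m \<and> (\<forall>\<eta>\<in>\<Xi>. q \<eta> = (if \<eta> = \<xi> then 1 else 0))"
    have "(\<lambda>x. (-1) * p x + q x) = (\<lambda>_. 0)"
      using uni p q poly_space_lc[of p m q "-1"] unfolding unisolvent_def by auto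
    then show "p = q" by (auto simp: fun_eq_iff)
  qed
  from theI'[OF this] show "lagrange m \<Xi> \<xi> \<in> poly_space m"
    and "\<eta> \<in> \<Xi> \<Longrightarrow> lagrange m \<Xi> \<xi> \<eta> = (if \<eta> = \<xi> then 1 else 0)"
    unfolding lagrange_def by auto
qed

lemma lagrange_interpolation:
  fixes \<Xi> :: "(real^'i::finite) set"
  assumes uni: "unisolvent m \<Xi>" and p: "p \<in> poly_space m"
  shows "(\<Sum>\<xi>\<in>\<Xi>. lagrange m \<Xi> \<xi> x * p \<xi>) = p x"
proof -
  have fin: "finite \<Xi>" using uni by (simp add: unisolvent_def)
  let ?q = "\<lambda>x. (-1) * (\<Sum>\<xi>\<in>\<Xi>. p \<xi> * lagrange m \<Xi> \<xi> x) + p x"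
  have q1: "?q \<in> poly_space m"
    by (intro poly_space_lc poly_space_sum fin p lagrange_props[OF uni])
  have q2: "?q \<eta> = 0" if "\<eta> \<in> \<Xi>" for \<eta>
  proof -
    have "(\<Sum>\<xi>\<in>\<Xi>. p \<xi> * lagrange m \<Xi> \<xi> \<eta>) = (\<Sum>\<xi>\<in>\<Xi>. if \<eta> = \<xi> then p \<xi> else 0)"
      by (rule sum.cong) (use that lagrange_props(2)[OF uni] in auto)
    also have "\<dots> = p \<eta>" using fin that by simp
    finally have "(\<Sum>\<xi>\<in>\<Xi>. p \<xi> * lagrange m \<Xi> \<xi> \<eta>) = p \<eta>" .
    then show ?thesis by linarith
  qed
  have "\<forall>p\<in>poly_space m. (\<forall>\<xi>\<in>\<Xi>. p \<xi> = 0) \<longrightarrow> p = (\<lambda>_. 0)"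
    using uni by (simp add: unisolvent_def)
  from bspec[OF this q1] q2 have "?q = (\<lambda>_. 0)" by simp
  from fun_cong[OF this, of x] show ?thesis by (simp add: mult.commute)
qed

text \<open>The coefficients of the functional \<open>f \<mapsto> f x - \<Pi> f x\<close>, where
  \<Pi> is interpolation on \<Xi>. It replaces evaluation at \<open>x\<close> among the functionals
  that annihilate polynomials, and its combination of kernel translates is the one occurring in
  \<open>native_R\<close>. The two terms are subtracted because \<open>x\<close> itself may belong
  to \<Xi>.\<close>

definition interp_error :: "nat \<Rightarrow> (real^'d) set \<Rightarrow> real^'d \<Rightarrow> real^'d \<Rightarrow> real" where
  "interp_error m \<Xi> x z = (if z = x then 1 else 0) - (if z \<in> \<Xi> then lagrange m \<Xi> z x else 0)"

lemma pairing_interp_error: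
  assumes "finite \<Xi>"
  shows "pairing (interp_error m \<Xi> x) f = f x - (\<Sum>\<xi>\<in>\<Xi>. lagrange m \<Xi> \<xi> x * f \<xi>)"
proof -
  have "pairing (interp_error m \<Xi> x) f = (\<Sum>z\<in>insert x \<Xi>. interp_error m \<Xi> x z * f z)"
    by (rule pairing_eq) (use assms in \<open>auto simp: interp_error_def split: if_splits\<close>)
  also have "\<dots> = (\<Sum>z\<in>insert x \<Xi>. (if z = x then 1 else 0) * f z)
      - (\<Sum>z\<in>insert x \<Xi>. (if z \<in> \<Xi> then lagrange m \<Xi> z x else 0) * f z)"
    by (simp add: interp_error_def sum_subtractf[symmetric] algebra_simps del: sum.insert)
  also have "(\<Sum>z\<in>insert x \<Xi>. (if z = x then 1 else 0) * f z) = f x"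
    using assms by (simp add: if_distrib if_distribR sum.delta' del: sum.insert cong: if_cong)
  also have "(\<Sum>z\<in>insert x \<Xi>. (if z \<in> \<Xi> then lagrange m \<Xi> z x else 0) * f z)
      = (\<Sum>\<xi>\<in>\<Xi>. lagrange m \<Xi> \<xi> x * f \<xi>)"
    using assms by (intro sum.mono_neutral_cong_right) auto
  finally show ?thesis .
qed

lemma interp_error_annihilators:
  fixes \<Xi> :: "(real^'i::finite) set"
  assumes uni: "unisolvent m \<Xi>"
  shows "interp_error m \<Xi> x \<in> annihilators m"
proof -
  have fin: "finite \<Xi>" using uni by (simp add: unisolvent_def)
  have "finite {z. interp_error m \<Xi> x z \<noteq> 0}"
    by (rule finite_subset[of _ "insert x \<Xi>"]) (use fin in \<open>auto simp: interp_error_def split: if_splits\<close>)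
  then show ?thesis
    by (simp add: annihilators_def fsupp_def pairing_interp_error[OF fin] lagrange_interpolation[OF uni])
qed

section \<open>Membership in native spaces\<close>

definition tcomb :: "(real^'d \<Rightarrow> real) \<Rightarrow> (real^'d \<Rightarrow> real) \<Rightarrow> real^'d \<Rightarrow> real" where
  "tcomb \<Phi> c y = pairing c (\<lambda>x. \<Phi> (y - x))"

lemma annihilates_restrict:
  assumes "annihilates m X a"
  shows "(\<lambda>x. if x \<in> X then a x else 0) \<in> annihilators m"
    and "pairing (\<lambda>x. if x \<in> X then a x else 0) f = (\<Sum>x\<in>X. a x * f x)"
proof -
  have X: "finite X" using assms by (simp add: annihilates_def)
  show *: "pairing (\<lambda>x. if x \<in> X then a x else 0) f = (\<Sum>x\<in>X. a x * f x)" for f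
    by (subst pairing_eq[OF X]) (auto intro: sum.cong)
  have "finite {x. (if x \<in> X then a x else 0) \<noteq> 0}"
    by (rule finite_subset[OF _ X]) auto
  then show "(\<lambda>x. if x \<in> X then a x else 0) \<in> annihilators m"
    using assms by (simp add: annihilators_def fsupp_def * annihilates_def)
qed

lemma tcomb_translate_comb: "tcomb \<Phi> c = translate_comb \<Phi> {x. c x \<noteq> 0} c"
  by (simp add: tcomb_def translate_comb_def pairing_def fun_eq_iff)

lemma pre_native_eq: "pre_native \<Phi> m = tcomb \<Phi> ` annihilators m"
proof (intro equalityI subsetI)
  fix f assume "f \<in> pre_native \<Phi> m"
  then obtain X a where f: "f = translate_comb \<Phi> X a" and a: "annihilates m X a"
    by (auto simp: pre_native_def)
  have "f = tcomb \<Phi> (\<lambda>x. if x \<in> X then a x else 0)"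
    by (simp add: f tcomb_def annihilates_restrict(2)[OF a] translate_comb_def fun_eq_iff)
  then show "f \<in> tcomb \<Phi> ` annihilators m" using annihilates_restrict(1)[OF a] by blast
next
  fix f assume "f \<in> tcomb \<Phi> ` annihilators m"
  then show "f \<in> pre_native \<Phi> m"
    using annihilators_annihilates tcomb_translate_comb by (fastforce simp: pre_native_def)
qed

lemma tcomb_diff:
  assumes "c \<in> annihilators m" "d \<in> annihilators m"
  shows "tcomb \<Phi> c y - tcomb \<Phi> d y = tcomb \<Phi> (\<lambda>x. (-1) * d x + c x) y"
  unfolding tcomb_def by (subst pairing_lc) (use assms in \<open>auto simp: annihilators_fsupp\<close>)

text \<open>This is where \<open>pre_inner\<close> proves to be well defined. As \<Phi> is even, the
  double sum pairs the coefficients of one argument with the values of the other as a function;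
  doing so on each side in turn removes the dependence on both representations.\<close>

lemma pre_inner_tcomb:
  assumes even: "\<And>x. \<Phi> (- x) = \<Phi> x" and c: "c \<in> annihilators m" and d: "d \<in> annihilators m"
  shows "pre_inner \<Phi> m (tcomb \<Phi> c) (tcomb \<Phi> d) = kernel_form \<Phi> c d"
  unfolding pre_inner_def
proof (rule the_equality)
  let ?X = "{x. c x \<noteq> 0}" and ?Y = "{x. d x \<noteq> 0}"
  have "kernel_form \<Phi> c d = (\<Sum>x\<in>?X. \<Sum>y\<in>?Y. c x * d y * \<Phi> (x - y))"
    by (simp add: kernel_form_def pairing_def sum_distrib_left mult_ac)
  then show "\<exists>X a Y b. annihilates m X a \<and> annihilates m Y b \<and>
     tcomb \<Phi> c = translate_comb \<Phi> X a \<and> tcomb \<Phi> d = translate_comb \<Phi> Y b \<and>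
     kernel_form \<Phi> c d = (\<Sum>x\<in>X. \<Sum>y\<in>Y. a x * b y * \<Phi> (x - y))"
    using annihilators_annihilates[OF c] annihilators_annihilates[OF d] tcomb_translate_comb by blast
next
  fix r
  assume "\<exists>X a Y b. annihilates m X a \<and> annihilates m Y b \<and>
     tcomb \<Phi> c = translate_comb \<Phi> X a \<and> tcomb \<Phi> d = translate_comb \<Phi> Y b \<and>
     r = (\<Sum>x\<in>X. \<Sum>y\<in>Y. a x * b y * \<Phi> (x - y))"
  then obtain X a Y b where X: "tcomb \<Phi> c = translate_comb \<Phi> X a"
    and Y: "tcomb \<Phi> d = translate_comb \<Phi> Y b"
    and r: "r = (\<Sum>x\<in>X. \<Sum>y\<in>Y. a x * b y * \<Phi> (x - y))" by blast
  have even': "\<Phi> (x - y) = \<Phi> (y - x)" for x y using even[of "x - y"] by simp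
  have "r = (\<Sum>x\<in>X. a x * tcomb \<Phi> d x)"
    unfolding r Y by (simp add: translate_comb_def sum_distrib_left mult_ac)
  also have "\<dots> = (\<Sum>x\<in>X. pairing d (\<lambda>y. a x * \<Phi> (y - x)))"
    by (simp add: tcomb_def pairing_cmult_right even')
  also have "\<dots> = pairing d (tcomb \<Phi> c)"
    unfolding X by (simp add: translate_comb_def pairing_sum_right[abs_def] fun_eq_iff)
  also have "\<dots> = pairing c (\<lambda>x. pairing d (\<lambda>y. \<Phi> (y - x)))"
    unfolding tcomb_def by (rule pairing_swap)
  also have "\<dots> = kernel_form \<Phi> c d" by (simp add: kernel_form_def even')
  finally show "r = kernel_form \<Phi> c d" .
qed

lemma pre_dist_tcomb:
  assumes even: "\<And>x. \<Phi> (- x) = \<Phi> x" and c: "c \<in> annihilators m" and d: "d \<in> annihilators m"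
  shows "pre_dist \<Phi> m (tcomb \<Phi> c) (tcomb \<Phi> d)
    = sqrt (kernel_form \<Phi> (\<lambda>x. (-1) * d x + c x) (\<lambda>x. (-1) * d x + c x))"
  unfolding pre_dist_def tcomb_diff[OF c d]
  by (simp only: pre_inner_tcomb[where \<Phi>=\<Phi>, OF even annihilators_lc[OF d c] annihilators_lc[OF d c]])

text \<open>The bound makes \<open>c \<mapsto> pairing c f\<close> a bounded functional. Its Riesz
  sequence defines an element \<open>A\<close> of the completion, and testing with
  \<open>interp_error\<close> shows that \<open>native_R\<close> sends \<open>A\<close> to
  \<open>f - \<Pi> f\<close>; the interpolant \<open>\<Pi> f\<close> is the polynomial part.\<close>

lemma native_space_criterion:
  fixes \<Phi> :: "real^'d::finite \<Rightarrow> real"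
  assumes cpd: "cond_pos_def m \<Phi>" and uni: "unisolvent m \<Xi>"
    and bound: "\<And>c. c \<in> annihilators m \<Longrightarrow> (pairing c f)\<^sup>2 \<le> C * kernel_form \<Phi> c c"
  shows "f \<in> native_space \<Phi> m \<Xi>"
proof -
  have even: "\<Phi> (- x) = \<Phi> x" for x using cpd by (simp add: cond_pos_def_def)
  have fin: "finite \<Xi>" using uni by (simp add: unisolvent_def)
  interpret si: semi_inner_space "annihilators m" "\<lambda>a c d x. a * c x + d x" "kernel_form \<Phi>"
    by (rule semi_inner_annihilators[OF cpd])
  define ie where "ie = interp_error m \<Xi>"
  have ie: "ie x \<in> annihilators m" for x unfolding ie_def by (rule interp_error_annihilators[OF uni])
  have ne: "annihilators m \<noteq> ({} :: (real^'d \<Rightarrow> real) set)" using ie by blast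
  have l_lc: "pairing (\<lambda>x. a * c x + d x) f = a * pairing c f + pairing d f"
    if "c \<in> annihilators m" "d \<in> annihilators m" for a c d using that by (intro pairing_lc annihilators_fsupp)
  obtain \<sigma> K where \<sigma>: "\<And>n. \<sigma> n \<in> annihilators m"
    and Cau: "\<And>e. e > 0 \<Longrightarrow> \<exists>M. \<forall>i\<ge>M. \<forall>j\<ge>M. kernel_form \<Phi> (\<lambda>x. (-1) * \<sigma> j x + \<sigma> i x) (\<lambda>x. (-1) * \<sigma> j x + \<sigma> i x) < e"
    and lim: "\<And>c. c \<in> annihilators m \<Longrightarrow> (\<lambda>n. kernel_form \<Phi> (\<sigma> n) c) \<longlonglongrightarrow> pairing c f"
    and K: "\<And>n. kernel_form \<Phi> (\<sigma> n) (\<sigma> n) \<le> K"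
    by (rule si.Riesz_sequence[of "\<lambda>c. pairing c f" C, OF ne l_lc bound], assumption, assumption, assumption, rule that) blast+
  define s where "s n = tcomb \<Phi> (\<sigma> n)" for n
  have s: "s \<in> pre_Cauchy \<Phi> m"
    unfolding pre_Cauchy_def
  proof (intro CollectI conjI allI impI)
    show "s n \<in> pre_native \<Phi> m" for n unfolding s_def pre_native_eq using \<sigma> by blast
    fix e :: real assume "e > 0"
    then have "0 < e\<^sup>2" by simp
    from Cau[OF this] obtain M where M: "\<And>i j. i \<ge> M \<Longrightarrow> j \<ge> M \<Longrightarrow>
        kernel_form \<Phi> (\<lambda>x. (-1) * \<sigma> j x + \<sigma> i x) (\<lambda>x. (-1) * \<sigma> j x + \<sigma> i x) < e\<^sup>2" by blast
    have "pre_dist \<Phi> m (s i) (s j) < e" if "i \<ge> M" "j \<ge> M" for i j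
      unfolding s_def pre_dist_tcomb[where \<Phi>=\<Phi>, OF even \<sigma> \<sigma>]
      by (rule real_less_lsqrt) (use M[OF that] \<open>e > 0\<close> in auto)
    then show "\<exists>M. \<forall>i\<ge>M. \<forall>j\<ge>M. pre_dist \<Phi> m (s i) (s j) < e" by blast
  qed
  define A where "A = null_rel \<Phi> m `` {s}"
  have A: "A \<in> completion_space \<Phi> m" unfolding A_def completion_space_def by (rule quotientI[OF s])
  have dist0: "pre_dist \<Phi> m (tcomb \<Phi> c) (tcomb \<Phi> c) = 0" if "c \<in> annihilators m" for c
  proof -
    have "kernel_form \<Phi> (\<lambda>x. (-1) * c x + c x) (\<lambda>x. (-1) * c x + c x) = 0"
      using that by (simp only: si.Q_lc_lc) simp
    then show ?thesis by (simp only: pre_dist_tcomb[where \<Phi>=\<Phi>, OF even that that]) simp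
  qed
  have CS: "\<bar>kernel_form \<Phi> c d\<bar> \<le> sqrt (kernel_form \<Phi> c c) * sqrt (kernel_form \<Phi> d d)" if "c \<in> annihilators m" "d \<in> annihilators m" for c d
    using real_sqrt_le_mono[OF si.Cauchy_Schwarz[OF that]] by (simp add: real_sqrt_mult)
  have R: "native_R \<Phi> m \<Xi> A x = pairing (ie x) f" for x
  proof -
    define g where "g = tcomb \<Phi> (ie x)"
    have g: "(\<lambda>y. \<Phi> (y - x) - (\<Sum>\<xi>\<in>\<Xi>. lagrange m \<Xi> \<xi> x * \<Phi> (y - \<xi>))) = g"
      unfolding g_def ie_def tcomb_def by (simp add: pairing_interp_error[OF fin] fun_eq_iff)
    have cg: "(\<lambda>_. g) \<in> pre_Cauchy \<Phi> m"
      using ie[of x] dist0[OF ie] by (auto simp: pre_Cauchy_def g_def pre_native_eq)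
    show ?thesis unfolding native_R_def completion_inner_def g
    proof (rule the_equality)
      have "s \<in> A" using s dist0[OF \<sigma>] by (simp add: A_def null_rel_def s_def)
      moreover have "(\<lambda>_. g) \<in> completion_embed \<Phi> m g"
        using cg dist0[OF ie] by (simp add: completion_embed_def null_rel_def g_def)
      moreover have "(\<lambda>n. pre_inner \<Phi> m (s n) g) \<longlonglongrightarrow> pairing (ie x) f"
        unfolding s_def g_def pre_inner_tcomb[where \<Phi>=\<Phi>, OF even \<sigma> ie] by (rule lim[OF ie])
      ultimately show "\<exists>s\<in>A. \<exists>t\<in>completion_embed \<Phi> m g. (\<lambda>n. pre_inner \<Phi> m (s n) (t n)) \<longlonglongrightarrow> pairing (ie x) f"
        by (intro bexI[where x = s] bexI[where x = "\<lambda>_. g"]) simp_all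
    next
      \<comment> \<open>Uniqueness of the limit: arbitrary representatives of the two classes differ
        from the chosen ones by null sequences \<open>u\<close> and \<open>v\<close>.\<close>
      fix r assume "\<exists>s\<in>A. \<exists>t\<in>completion_embed \<Phi> m g. (\<lambda>n. pre_inner \<Phi> m (s n) (t n)) \<longlonglongrightarrow> r"
      then obtain s' t where s': "s' \<in> A" and t: "t \<in> completion_embed \<Phi> m g"
        and r: "(\<lambda>n. pre_inner \<Phi> m (s' n) (t n)) \<longlonglongrightarrow> r" by blast
      have "\<forall>n. \<exists>c. c \<in> annihilators m \<and> s' n = tcomb \<Phi> c"
        using s' by (auto simp: A_def null_rel_def pre_Cauchy_def pre_native_eq)
      then obtain \<sigma>' where \<sigma>': "\<And>n. \<sigma>' n \<in> annihilators m" and s'_eq: "\<And>n. s' n = tcomb \<Phi> (\<sigma>' n)" by metis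
      have "\<forall>n. \<exists>c. c \<in> annihilators m \<and> t n = tcomb \<Phi> c"
        using t by (auto simp: completion_embed_def null_rel_def pre_Cauchy_def pre_native_eq)
      then obtain \<tau> where \<tau>: "\<And>n. \<tau> n \<in> annihilators m" and t_eq: "\<And>n. t n = tcomb \<Phi> (\<tau> n)" by metis
      define u where "u n = (\<lambda>y. (-1) * \<sigma>' n y + \<sigma> n y)" for n
      define v where "v n = (\<lambda>y. (-1) * \<tau> n y + ie x y)" for n
      have u: "u n \<in> annihilators m" and v: "v n \<in> annihilators m" for n
        unfolding u_def v_def by (rule annihilators_lc[OF \<sigma>' \<sigma>], rule annihilators_lc[OF \<tau> ie])
      have "(\<lambda>n. pre_dist \<Phi> m (s n) (s' n)) \<longlonglongrightarrow> 0"
        using s' by (simp add: A_def null_rel_def)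
      then have u0: "(\<lambda>n. sqrt (kernel_form \<Phi> (u n) (u n))) \<longlonglongrightarrow> 0"
        unfolding s_def s'_eq pre_dist_tcomb[where \<Phi>=\<Phi>, OF even \<sigma> \<sigma>'] u_def .
      have "(\<lambda>n. pre_dist \<Phi> m g (t n)) \<longlonglongrightarrow> 0"
        using t by (simp add: completion_embed_def null_rel_def)
      then have v0: "(\<lambda>n. sqrt (kernel_form \<Phi> (v n) (v n))) \<longlonglongrightarrow> 0"
        unfolding g_def t_eq pre_dist_tcomb[where \<Phi>=\<Phi>, OF even ie \<tau>] v_def .
      \<comment> \<open>Expansion of the form at \<open>\<sigma> - u\<close> and
        \<open>ie x - v\<close>. Every term on the right contains a null sequence, and the other
        factors stay bounded.\<close>
      have eq: "kernel_form \<Phi> (\<sigma>' n) (\<tau> n) - kernel_form \<Phi> (\<sigma> n) (ie x)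
          = kernel_form \<Phi> (u n) (v n) - kernel_form \<Phi> (u n) (ie x) - kernel_form \<Phi> (\<sigma> n) (v n)" for n
        unfolding u_def v_def using \<sigma> \<sigma>' \<tau> ie
        by (simp only: si.Q_lc si.Q_lc_right si.lc_closed) (simp add: algebra_simps)
      have "(\<lambda>n. kernel_form \<Phi> (\<sigma>' n) (\<tau> n) - kernel_form \<Phi> (\<sigma> n) (ie x)) \<longlonglongrightarrow> 0"
      proof (rule Lim_null_comparison)
        have "norm (kernel_form \<Phi> (\<sigma>' n) (\<tau> n) - kernel_form \<Phi> (\<sigma> n) (ie x))
          \<le> sqrt (kernel_form \<Phi> (u n) (u n)) * sqrt (kernel_form \<Phi> (v n) (v n))
           + sqrt (kernel_form \<Phi> (u n) (u n)) * sqrt (kernel_form \<Phi> (ie x) (ie x))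
           + sqrt K * sqrt (kernel_form \<Phi> (v n) (v n))" (is "_ \<le> ?b n") for n
        proof -
          have "\<bar>kernel_form \<Phi> (\<sigma> n) (v n)\<bar> \<le> sqrt (kernel_form \<Phi> (\<sigma> n) (\<sigma> n)) * sqrt (kernel_form \<Phi> (v n) (v n))"
            by (rule CS[OF \<sigma> v])
          also have "\<dots> \<le> sqrt K * sqrt (kernel_form \<Phi> (v n) (v n))"
            using K si.Q_nonneg[OF v] by (intro mult_right_mono) auto
          finally show ?thesis
            using CS[OF u v, of n n] CS[OF u ie, of n x] unfolding eq real_norm_def by linarith
        qed
        then show "\<forall>\<^sub>F n in sequentially. norm (kernel_form \<Phi> (\<sigma>' n) (\<tau> n) - kernel_form \<Phi> (\<sigma> n) (ie x)) \<le> ?b n"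
          by simp
        have "?b \<longlonglongrightarrow> 0 * 0 + 0 * sqrt (kernel_form \<Phi> (ie x) (ie x)) + sqrt K * 0"
          by (intro tendsto_intros u0 v0)
        then show "?b \<longlonglongrightarrow> 0" by simp
      qed
      from tendsto_add[OF this lim[OF ie[of x]]]
      have "(\<lambda>n. kernel_form \<Phi> (\<sigma>' n) (\<tau> n)) \<longlonglongrightarrow> pairing (ie x) f" by simp
      moreover have "(\<lambda>n. kernel_form \<Phi> (\<sigma>' n) (\<tau> n)) \<longlonglongrightarrow> r"
        using r unfolding s'_eq t_eq pre_inner_tcomb[where \<Phi>=\<Phi>, OF even \<sigma>' \<tau>] .
      ultimately show "r = pairing (ie x) f" using LIMSEQ_unique by blast
    qed
  qed
  define p where "p x = (\<Sum>\<xi>\<in>\<Xi>. f \<xi> * lagrange m \<Xi> \<xi> x)" for x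
  have "p \<in> poly_space m" unfolding p_def[abs_def]
    by (intro poly_space_sum fin lagrange_props[OF uni])
  moreover have "f = (\<lambda>x. p x + native_R \<Phi> m \<Xi> A x)"
    unfolding R ie_def pairing_interp_error[OF fin] p_def by (simp add: fun_eq_iff mult.commute)
  ultimately show ?thesis using A unfolding native_space_def by blast
qed

section \<open>Schwartz functions\<close>

lemma partial_eqI: "(f has_derivative f') (at x) \<Longrightarrow> partial i f x = f' (axis i 1)"
  by (simp add: partial_def frechet_derivative_at[symmetric])

lemma has_derivative_partials:
  fixes f :: "real^'d \<Rightarrow> 'b::real_normed_vector"
  assumes "f differentiable (at x)"
  shows "(f has_derivative (\<lambda>h. \<Sum>i\<in>UNIV. (h $ i) *\<^sub>R partial i f x)) (at x)"
proof -
  let ?D = "frechet_derivative f (at x)"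
  have D: "(f has_derivative ?D) (at x)" using assms by (simp add: frechet_derivative_works)
  then have lin: "linear ?D" by (rule has_derivative_linear)
  have eq: "?D = (\<lambda>h. \<Sum>i\<in>UNIV. (h $ i) *\<^sub>R partial i f x)"
  proof (rule ext)
    fix h
    have "?D h = ?D (\<Sum>i\<in>UNIV. (h $ i) *\<^sub>R axis i 1)"
      using basis_expansion[of h] by (simp add: scalar_mult_eq_scaleR)
    also have "\<dots> = (\<Sum>i\<in>UNIV. (h $ i) *\<^sub>R partial i f x)"
      by (simp add: linear_sum[OF lin] linear_scale[OF lin] partial_def)
    finally show "?D h = (\<Sum>i\<in>UNIV. (h $ i) *\<^sub>R partial i f x)" .
  qed
  show ?thesis by (rule D[unfolded eq])
qed

lemma partials_append: "partials (is @ js) f = partials is (partials js f)"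
  by (induction "is") auto

text \<open>\<open>partials\<close> differentiates outermost first, so a class of functions closed
  under \<open>partial i\<close> contains all derivatives of its members. It then suffices to
  control the members themselves, and each proof below only has to find a class \<open>F\<close>
  large enough to be closed.\<close>

lemma schwartz_coinduct:
  assumes "f \<in> F"
    and diff: "\<And>f. f \<in> F \<Longrightarrow> f differentiable_on UNIV"
    and bound: "\<And>f k. f \<in> F \<Longrightarrow> \<exists>C. \<forall>x. (1 + norm x) ^ k * norm (f x) \<le> C"
    and part: "\<And>f i. f \<in> F \<Longrightarrow> partial i f \<in> F"
  shows "f \<in> schwartz"
proof -
  have F: "partials is f \<in> F" for "is" by (induction "is") (auto simp: assms(1) part)
  show ?thesis unfolding schwartz_def smooth_def
    using diff[OF F] bound[OF F] by (fastforce simp: bdd_above_def)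
qed

lemma schwartz_bound:
  assumes "\<gamma> \<in> schwartz"
  shows "\<exists>C. \<forall>x. (1 + norm x) ^ k * norm (\<gamma> x) \<le> C"
proof -
  have "bdd_above (range (\<lambda>x. (1 + norm x) ^ k * norm (partials [] \<gamma> x)))"
    by (rule assms[unfolded schwartz_def mem_Collect_eq, THEN conjunct2, rule_format])
  then obtain C where "\<forall>y\<in>range (\<lambda>x. (1 + norm x) ^ k * norm (\<gamma> x)). y \<le> C"
    unfolding bdd_above_def by auto
  then show ?thesis by blast
qed

lemma schwartz_partial: "\<gamma> \<in> schwartz \<Longrightarrow> partial i \<gamma> \<in> schwartz"
  unfolding schwartz_def smooth_def
  by (auto simp: partials_append[of _ "[i]", simplified, symmetric])

lemma schwartz_differentiable: "\<gamma> \<in> schwartz \<Longrightarrow> \<gamma> differentiable (at x)"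
  unfolding schwartz_def smooth_def differentiable_on_def
  by (metis (no_types, lifting) UNIV_I mem_Collect_eq partials.simps(1))

lemma schwartz_has_derivative:
  "\<gamma> \<in> schwartz \<Longrightarrow> (\<gamma> has_derivative (\<lambda>h. \<Sum>i\<in>UNIV. (h $ i) *\<^sub>R partial i \<gamma> x)) (at x)"
  by (intro has_derivative_partials schwartz_differentiable)

lemma schwartz_continuous: "\<gamma> \<in> schwartz \<Longrightarrow> continuous_on UNIV \<gamma>"
  using schwartz_differentiable differentiable_imp_continuous_within
  by (metis continuous_at_imp_continuous_on)

lemma schwartz_measurable [measurable]: "\<gamma> \<in> schwartz \<Longrightarrow> \<gamma> \<in> borel_measurable borel"
  by (intro borel_measurable_continuous_onI schwartz_continuous)

lemma sum_axis_scaleR: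
  "(\<Sum>j\<in>UNIV. (axis i (1::real) $ j) *\<^sub>R f j) = (f i :: 'b::real_vector)"
proof -
  have "(axis i (1::real) $ j) *\<^sub>R f j = (if j = i then f j else 0)" for j by (simp add: axis_def)
  then show ?thesis by simp
qed

lemma schwartz_lc:
  assumes "\<gamma> \<in> schwartz" "\<eta> \<in> schwartz"
  shows "(\<lambda>x. a * \<gamma> x + \<eta> x) \<in> schwartz"
proof (rule schwartz_coinduct)
  let ?F = "{\<lambda>x. a * \<gamma> x + \<eta> x | \<gamma> \<eta>. \<gamma> \<in> schwartz \<and> \<eta> \<in> schwartz}"
  show "(\<lambda>x. a * \<gamma> x + \<eta> x) \<in> ?F" using assms by blast
  fix f :: "real^'a \<Rightarrow> complex" and i and k :: nat assume "f \<in> ?F"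
  then obtain \<gamma> \<eta> where f: "f = (\<lambda>x. a * \<gamma> x + \<eta> x)" and S: "\<gamma> \<in> schwartz" "\<eta> \<in> schwartz" by blast
  note der = schwartz_has_derivative[OF S(1)] schwartz_has_derivative[OF S(2)]
  have D: "(f has_derivative (\<lambda>h. a * (\<Sum>i\<in>UNIV. (h $ i) *\<^sub>R partial i \<gamma> x)
      + (\<Sum>i\<in>UNIV. (h $ i) *\<^sub>R partial i \<eta> x))) (at x)" for x
    unfolding f by (intro has_derivative_add has_derivative_mult_right der)
  then show "f differentiable_on UNIV" by (auto simp: differentiable_on_def differentiable_def)
  have "partial i f = (\<lambda>x. a * partial i \<gamma> x + partial i \<eta> x)"
    by (rule ext) (simp add: partial_eqI[OF D] sum_axis_scaleR)
  then show "partial i f \<in> ?F" using S schwartz_partial by blast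
  obtain C D where C: "\<And>x. (1 + norm x) ^ k * norm (\<gamma> x) \<le> C" and D: "\<And>x. (1 + norm x) ^ k * norm (\<eta> x) \<le> D"
    using schwartz_bound S by metis
  have "(1 + norm x) ^ k * norm (f x) \<le> norm a * C + D" for x
  proof -
    have "(1 + norm x) ^ k * norm (f x) \<le> (1 + norm x) ^ k * (norm a * norm (\<gamma> x) + norm (\<eta> x))"
      unfolding f by (intro mult_left_mono order_trans[OF norm_triangle_ineq]) (auto simp: norm_mult)
    also have "\<dots> = norm a * ((1 + norm x) ^ k * norm (\<gamma> x)) + (1 + norm x) ^ k * norm (\<eta> x)"
      by (simp add: algebra_simps)
    also have "\<dots> \<le> norm a * C + D" by (intro add_mono mult_left_mono C D) auto
    finally show ?thesis .
  qed
  then show "\<exists>C. \<forall>x. (1 + norm x) ^ k * norm (f x) \<le> C" by blast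
qed

lemma schwartz_zero: "(\<lambda>_. 0) \<in> schwartz"
  by (rule schwartz_coinduct[of _ "{\<lambda>_. 0}"]) (auto simp: partial_def)

lemma schwartz_cmult: "\<gamma> \<in> schwartz \<Longrightarrow> (\<lambda>x. a * \<gamma> x) \<in> schwartz"
  using schwartz_lc[OF _ schwartz_zero] by simp

lemma schwartz_diff: "\<gamma> \<in> schwartz \<Longrightarrow> \<eta> \<in> schwartz \<Longrightarrow> (\<lambda>x. \<gamma> x - \<eta> x) \<in> schwartz"
  using schwartz_lc[of \<eta> \<gamma> "-1"] by simp

lemma schwartz_sum:
  "finite I \<Longrightarrow> (\<And>i. i \<in> I \<Longrightarrow> \<gamma> i \<in> schwartz) \<Longrightarrow> (\<lambda>x. \<Sum>i\<in>I. \<gamma> i x) \<in> schwartz"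
proof (induction I rule: finite_induct)
  case (insert i I)
  then show ?case using schwartz_lc[of "\<gamma> i" "\<lambda>x. \<Sum>i\<in>I. \<gamma> i x" 1] by simp
qed (simp add: schwartz_zero)

lemma schwartz_affine:
  fixes c :: real
  assumes c: "c \<noteq> 0" and \<gamma>: "\<gamma> \<in> schwartz"
  shows "(\<lambda>x. \<gamma> (c *\<^sub>R x + v)) \<in> schwartz"
proof (rule schwartz_coinduct)
  \<comment> \<open>The scalar \<open>a\<close> absorbs the powers of \<open>c\<close> produced by
    the chain rule.\<close>
  let ?F = "{\<lambda>x. a * \<gamma> (c *\<^sub>R x + v) | a \<gamma>. \<gamma> \<in> schwartz}"
  show "(\<lambda>x. \<gamma> (c *\<^sub>R x + v)) \<in> ?F" using \<gamma> by (auto intro!: exI[of _ "1::complex"])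
  fix f :: "real^'a \<Rightarrow> complex" and i and k :: nat assume "f \<in> ?F"
  then obtain a \<gamma> where f: "f = (\<lambda>x. a * \<gamma> (c *\<^sub>R x + v))" and S: "\<gamma> \<in> schwartz" by blast
  have D: "(f has_derivative (\<lambda>h. a * (\<Sum>i\<in>UNIV. ((c *\<^sub>R h + 0) $ i) *\<^sub>R partial i \<gamma> (c *\<^sub>R x + v)))) (at x)" for x
    unfolding f
    by (intro has_derivative_mult_right has_derivative_compose[OF _ schwartz_has_derivative[OF S]]
        has_derivative_add has_derivative_scaleR_right has_derivative_ident has_derivative_const)
  then show "f differentiable_on UNIV" by (auto simp: differentiable_on_def differentiable_def)
  have "partial i f = (\<lambda>x. (a * complex_of_real c) * partial i \<gamma> (c *\<^sub>R x + v))"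
  proof (rule ext)
    fix x
    have "(\<Sum>j\<in>UNIV. ((c *\<^sub>R axis i 1 + 0) $ j) *\<^sub>R partial j \<gamma> (c *\<^sub>R x + v))
        = c *\<^sub>R (\<Sum>j\<in>UNIV. (axis i (1::real) $ j) *\<^sub>R partial j \<gamma> (c *\<^sub>R x + v))"
      by (simp add: scaleR_sum_right)
    then show "partial i f x = (a * complex_of_real c) * partial i \<gamma> (c *\<^sub>R x + v)"
      unfolding partial_eqI[OF D] sum_axis_scaleR
      by (simp add: scaleR_conv_of_real[where 'a = complex])
  qed
  then show "partial i f \<in> ?F" using S schwartz_partial by blast
  obtain C where C: "\<And>x. (1 + norm x) ^ k * norm (\<gamma> x) \<le> C"
    using schwartz_bound S by metis
  \<comment> \<open>The constant comes from
    \<open>norm x \<le> (norm (c x + v) + norm v) / \<bar>c\<bar>\<close>; it exchanges the weight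
    at \<open>x\<close> for the weight at the transformed point.\<close>
  define K where "K = (1 + 1 / \<bar>c\<bar>) * (1 + norm v)"
  have K: "1 + norm x \<le> K * (1 + norm (c *\<^sub>R x + v))" for x
  proof -
    have "\<bar>c\<bar> * norm x = norm ((c *\<^sub>R x + v) - v)" by simp
    also have "\<dots> \<le> norm (c *\<^sub>R x + v) + norm v" by (rule norm_triangle_ineq4)
    finally have "norm x \<le> (norm (c *\<^sub>R x + v) + norm v) / \<bar>c\<bar>"
      using c by (simp add: field_simps)
    also have "\<dots> \<le> ((1 + norm v) * (1 + norm (c *\<^sub>R x + v))) / \<bar>c\<bar>"
      by (intro divide_right_mono) (auto simp: algebra_simps)
    finally have 1: "norm x \<le> ((1 + norm v) * (1 + norm (c *\<^sub>R x + v))) / \<bar>c\<bar>" .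
    have "1 * 1 \<le> (1 + norm v) * (1 + norm (c *\<^sub>R x + v))" by (intro mult_mono) auto
    moreover have "K * (1 + norm (c *\<^sub>R x + v)) = (1 + norm v) * (1 + norm (c *\<^sub>R x + v))
        + ((1 + norm v) * (1 + norm (c *\<^sub>R x + v))) / \<bar>c\<bar>"
      using c by (simp add: K_def field_simps)
    ultimately show ?thesis using 1 by linarith
  qed
  have "(1 + norm x) ^ k * norm (f x) \<le> K ^ k * norm a * C" for x
  proof -
    have "(1 + norm x) ^ k * norm (f x) \<le> (K * (1 + norm (c *\<^sub>R x + v))) ^ k * norm (f x)"
      by (intro mult_right_mono power_mono K) auto
    also have "\<dots> = K ^ k * norm a * ((1 + norm (c *\<^sub>R x + v)) ^ k * norm (\<gamma> (c *\<^sub>R x + v)))"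
      by (simp add: f norm_mult power_mult_distrib)
    also have "\<dots> \<le> K ^ k * norm a * C" by (intro mult_left_mono C) (auto simp: K_def)
    finally show ?thesis .
  qed
  then show "\<exists>C. \<forall>x. (1 + norm x) ^ k * norm (f x) \<le> C" by blast
qed

lemma schwartz_translate: "\<gamma> \<in> schwartz \<Longrightarrow> (\<lambda>x. \<gamma> (x + v)) \<in> schwartz"
  and schwartz_translate': "\<gamma> \<in> schwartz \<Longrightarrow> (\<lambda>x. \<gamma> (x - v)) \<in> schwartz"
  and schwartz_reflect: "\<gamma> \<in> schwartz \<Longrightarrow> (\<lambda>x. \<gamma> (v - x)) \<in> schwartz"
  using schwartz_affine[of 1 \<gamma> v] schwartz_affine[of 1 \<gamma> "- v"] schwartz_affine[of "-1" \<gamma> v] by simp_all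

section \<open>Characters and modulation of Schwartz functions\<close>

definition character :: "'a::real_inner \<Rightarrow> 'a \<Rightarrow> complex" where
  "character a x = exp (\<i> * complex_of_real (a \<bullet> x))"

lemma norm_character [simp]: "norm (character a x) = 1"
  by (simp add: character_def)

lemma character_add: "character a (x + y) = character a x * character a y"
  and character_add_left: "character (a + b) x = character a x * character b x"
  and character_zero [simp]: "character 0 x = 1" "character a 0 = 1"
  by (simp_all add: character_def inner_add_right inner_add_left exp_add[symmetric] algebra_simps inner_commute)

lemma character_cancel [simp]: "character a x * character (- a) x = 1" "character (- a) x * character a x = 1"
  by (simp_all add: character_add_left[symmetric])

lemma has_derivative_character:
  "(character a has_derivative (\<lambda>h. (\<i> * complex_of_real (a \<bullet> h)) * character a x)) (at x)"
proof -
  have "((\<lambda>x. exp (\<i> * complex_of_real (a \<bullet> x))) has_derivative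
      (\<lambda>h. exp (\<i> * complex_of_real (a \<bullet> x)) * (\<i> * complex_of_real (a \<bullet> h)))) (at x)"
    by (rule has_derivative_compose[where g = exp])
       (auto intro!: derivative_eq_intros simp: has_field_derivative_def[symmetric] DERIV_exp)
  then show ?thesis by (simp add: character_def[abs_def] mult_ac)
qed

lemma continuous_character: "continuous_on UNIV (character a)"
  using has_derivative_character has_derivative_continuous continuous_at_imp_continuous_on by metis

lemma character_measurable [measurable]: "character a \<in> borel_measurable borel"
  by (intro borel_measurable_continuous_onI continuous_character)

lemma schwartz_character:
  assumes "\<gamma> \<in> schwartz"
  shows "(\<lambda>x. character a x * \<gamma> x) \<in> schwartz"
proof (rule schwartz_coinduct)
  let ?F = "{\<lambda>x. character a x * \<gamma> x | \<gamma>. \<gamma> \<in> schwartz}"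
  show "(\<lambda>x. character a x * \<gamma> x) \<in> ?F" using assms by blast
  fix f :: "real^'a \<Rightarrow> complex" and i and k :: nat assume "f \<in> ?F"
  then obtain \<gamma> where f: "f = (\<lambda>x. character a x * \<gamma> x)" and S: "\<gamma> \<in> schwartz" by blast
  have D: "(f has_derivative (\<lambda>h. character a x * (\<Sum>i\<in>UNIV. (h $ i) *\<^sub>R partial i \<gamma> x)
      + ((\<i> * complex_of_real (a \<bullet> h)) * character a x) * \<gamma> x)) (at x)" for x
    unfolding f by (intro has_derivative_mult has_derivative_character schwartz_has_derivative S)
  then show "f differentiable_on UNIV" by (auto simp: differentiable_on_def differentiable_def)
  have "partial i f = (\<lambda>x. character a x * ((\<i> * complex_of_real (a $ i)) * \<gamma> x + partial i \<gamma> x))"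
    by (rule ext) (simp add: partial_eqI[OF D] sum_axis_scaleR inner_axis algebra_simps)
  then show "partial i f \<in> ?F"
    by (intro CollectI exI[of _ "\<lambda>x. (\<i> * complex_of_real (a $ i)) * \<gamma> x + partial i \<gamma> x"] conjI
        schwartz_lc S schwartz_partial)
  show "\<exists>C. \<forall>x. (1 + norm x) ^ k * norm (f x) \<le> C"
    using schwartz_bound[OF S] by (simp add: f norm_mult)
qed

text \<open>An equivalence for arbitrary \<open>f\<close>, as is the following one for translations:
  both serve to match case distinctions about functions \<open>p * \<gamma>\<close> and their
  transforms, which are not known to be Schwartz.\<close>

lemma schwartz_character_iff: "(\<lambda>x. character a x * f x) \<in> schwartz \<longleftrightarrow> f \<in> schwartz"
  using schwartz_character[of "\<lambda>x. character a x * f x" "- a"] schwartz_character[of f a]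
  by (auto simp: mult.assoc[symmetric])

lemma schwartz_translate_iff: "(\<lambda>x. f (x + v)) \<in> schwartz \<longleftrightarrow> f \<in> schwartz"
  using schwartz_translate[of "\<lambda>x. f (x + v)" "- v"] schwartz_translate[of f v] by auto

section \<open>Gaussians as Schwartz functions\<close>

text \<open>The parameter is the inverse variance. Large \<open>s\<close> means a narrow Gaussian,
  and the Fourier transform exchanges \<open>s\<close> and \<open>1 / s\<close>, fixing the case
  \<open>s = 1\<close>.\<close>

definition gauss :: "real \<Rightarrow> 'a::real_normed_vector \<Rightarrow> real" where
  "gauss s x = exp (- (s * (norm x)\<^sup>2 / 2))"

lemma polynomial_growth:
  fixes q :: "'a::euclidean_space \<Rightarrow> real"
  assumes "real_polynomial_function q"
  shows "\<exists>C k. \<forall>x. \<bar>q x\<bar> \<le> C * (1 + norm x) ^ k"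
  using assms
proof (induction q rule: real_polynomial_function.induct)
  case (linear f)
  then obtain K where K: "K > 0" "\<And>x. norm (f x) \<le> norm x * K" using bounded_linear.pos_bounded by blast
  have "\<bar>f x\<bar> \<le> K * (1 + norm x) ^ 1" for x using K(2)[of x] K(1) by (simp add: algebra_simps)
  then show ?case by blast
next
  case (const c)
  then show ?case by (intro exI[of _ "\<bar>c\<bar>"] exI[of _ 0]) auto
next
  case (add f g)
  then obtain C k D l where C: "\<And>x. \<bar>f x\<bar> \<le> C * (1 + norm x) ^ k" and D: "\<And>x. \<bar>g x\<bar> \<le> D * (1 + norm x) ^ l"
    by blast
  have "\<bar>f x + g x\<bar> \<le> (\<bar>C\<bar> + \<bar>D\<bar>) * (1 + norm x) ^ (k + l)" for x
  proof -
    have "\<bar>f x + g x\<bar> \<le> C * (1 + norm x) ^ k + D * (1 + norm x) ^ l"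
      using C[of x] D[of x] by linarith
    also have "\<dots> \<le> \<bar>C\<bar> * (1 + norm x) ^ (k + l) + \<bar>D\<bar> * (1 + norm x) ^ (k + l)"
      by (intro add_mono mult_mono power_increasing) auto
    finally show ?thesis by (simp add: algebra_simps)
  qed
  then show ?case by blast
next
  case (mult f g)
  then obtain C k D l where C: "\<And>x. \<bar>f x\<bar> \<le> C * (1 + norm x) ^ k" and D: "\<And>x. \<bar>g x\<bar> \<le> D * (1 + norm x) ^ l"
    by blast
  have "\<bar>f x * g x\<bar> \<le> (C * D) * (1 + norm x) ^ (k + l)" for x
    using mult_mono[OF C[of x] D[of x]] C[of x] by (simp add: abs_mult power_add mult_ac)
  then show ?case by blast
qed

lemma polynomial_derivative:
  fixes q :: "'a::euclidean_space \<Rightarrow> real"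
  assumes "real_polynomial_function q"
  shows "\<exists>q'. (\<forall>x. (q has_derivative q' x) (at x)) \<and> (\<forall>v. real_polynomial_function (\<lambda>x. q' x v))"
  using assms
proof (induction q rule: real_polynomial_function.induct)
  case (linear f)
  then show ?case
    by (intro exI[of _ "\<lambda>_. f"]) (auto intro: bounded_linear_imp_has_derivative)
next
  case (const c)
  then show ?case by (intro exI[of _ "\<lambda>_ _. 0"]) auto
next
  case (add f g)
  then obtain f' g' where *: "\<And>x. (f has_derivative f' x) (at x)" "\<And>v. real_polynomial_function (\<lambda>x. f' x v)"
    "\<And>x. (g has_derivative g' x) (at x)" "\<And>v. real_polynomial_function (\<lambda>x. g' x v)" by blast
  show ?case
    by (intro exI[of _ "\<lambda>x v. f' x v + g' x v"]) (auto intro: has_derivative_add *)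
next
  case (mult f g)
  then obtain f' g' where *: "\<And>x. (f has_derivative f' x) (at x)" "\<And>v. real_polynomial_function (\<lambda>x. f' x v)"
    "\<And>x. (g has_derivative g' x) (at x)" "\<And>v. real_polynomial_function (\<lambda>x. g' x v)" by blast
  show ?case
    by (intro exI[of _ "\<lambda>x v. f x * g' x v + f' x v * g x"])
       (auto intro!: has_derivative_mult * mult.hyps real_polynomial_function.intros(3,4))
qed

lemma gauss_decay: "\<exists>C. \<forall>x::'a::real_normed_vector. (1 + norm x) ^ k * gauss s x \<le> C" if s: "s > 0"
proof -
  have "\<exists>C. \<forall>t\<ge>0. (1 + t) ^ k * exp (- (s * t\<^sup>2 / 2)) \<le> C"
  proof -
    have "((\<lambda>t. (1 + t) ^ k * exp (- (s * t\<^sup>2 / 2))) \<longlongrightarrow> 0) at_top"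
      using s by real_asymp
    then have "\<forall>\<^sub>F t in at_top. (1 + t) ^ k * exp (- (s * t\<^sup>2 / 2)) < 1"
      by (rule order_tendstoD) simp
    then obtain T where T: "\<And>t. t \<ge> T \<Longrightarrow> (1 + t) ^ k * exp (- (s * t\<^sup>2 / 2)) < 1"
      by (auto simp: eventually_at_top_linorder)
    have "(1 + t) ^ k * exp (- (s * t\<^sup>2 / 2)) \<le> max 1 ((1 + \<bar>T\<bar>) ^ k)" if "t \<ge> 0" for t
    proof (cases "t \<ge> T")
      case True
      show ?thesis by (rule max.coboundedI1[OF less_imp_le[OF T[OF True]]])
    next
      case False
      have "(1 + t) ^ k * exp (- (s * t\<^sup>2 / 2)) \<le> (1 + \<bar>T\<bar>) ^ k * 1"
        using s False that by (intro mult_mono power_mono) auto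
      then show ?thesis by simp
    qed
    then show ?thesis by blast
  qed
  then show ?thesis unfolding gauss_def using norm_ge_zero by metis
qed

lemma schwartz_gauss:
  assumes s: "s > 0"
  shows "(\<lambda>x::real^'d. complex_of_real (gauss s x)) \<in> schwartz"
proof (rule schwartz_coinduct)
  \<comment> \<open>Derivatives of a Gaussian are polynomials times the same Gaussian.\<close>
  let ?F = "{\<lambda>x::real^'d. complex_of_real (q x * gauss s x) | q. real_polynomial_function q}"
  show "(\<lambda>x::real^'d. complex_of_real (gauss s x)) \<in> ?F"
    by (auto intro!: exI[of _ "\<lambda>_. 1"])
  fix f :: "real^'d \<Rightarrow> complex" and i and k :: nat assume "f \<in> ?F"
  then obtain q where f: "f = (\<lambda>x. complex_of_real (q x * gauss s x))" and q: "real_polynomial_function q" by blast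
  from polynomial_derivative[OF q] obtain q' where q': "\<And>x. (q has_derivative q' x) (at x)"
    "\<And>v. real_polynomial_function (\<lambda>x. q' x v)" by blast
  have G: "(gauss s has_derivative (\<lambda>h. - s * (x \<bullet> h) * gauss s x)) (at x)" for x :: "real^'d"
    unfolding gauss_def[abs_def] power2_norm_eq_inner
    by (auto intro!: derivative_eq_intros simp: inner_commute algebra_simps)
  have D: "(f has_derivative (\<lambda>h. complex_of_real (q x * (- s * (x \<bullet> h) * gauss s x) + q' x h * gauss s x))) (at x)" for x
    unfolding f by (intro has_derivative_of_real has_derivative_mult q' G)
  then show "f differentiable_on UNIV" by (auto simp: differentiable_on_def differentiable_def)
  have "partial i f = (\<lambda>x. complex_of_real ((q x * (- s * (x $ i)) + q' x (axis i 1)) * gauss s x))"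
    by (rule ext) (simp add: partial_eqI[OF D] inner_axis algebra_simps)
  moreover have "real_polynomial_function (\<lambda>x. q x * (- s * (x $ i)) + q' x (axis i 1))"
    by (intro real_polynomial_function.intros q q' bounded_linear_vec_nth)
  ultimately show "partial i f \<in> ?F"
    by (intro CollectI exI[of _ "\<lambda>x. q x * (- s * (x $ i)) + q' x (axis i 1)"] conjI)
  obtain C l where C: "\<And>x. \<bar>q x\<bar> \<le> C * (1 + norm x) ^ l" using polynomial_growth[OF q] by blast
  obtain D where D: "\<And>x::real^'d. (1 + norm x) ^ (k + l) * gauss s x \<le> D" using gauss_decay[OF s] by blast
  have C0: "C \<ge> 0" using C[of 0] by simp
  have "(1 + norm x) ^ k * norm (f x) \<le> C * D" for x
  proof -
    have "(1 + norm x) ^ k * norm (f x) \<le> (1 + norm x) ^ k * ((C * (1 + norm x) ^ l) * gauss s x)"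
      unfolding f norm_of_real abs_mult by (intro mult_left_mono mult_mono C order_trans[OF abs_ge_zero C]) (auto simp: gauss_def)
    also have "\<dots> = C * ((1 + norm x) ^ (k + l) * gauss s x)" by (simp add: power_add mult_ac)
    also have "\<dots> \<le> C * D" by (intro mult_left_mono D C0)
    finally show ?thesis .
  qed
  then show "\<exists>C. \<forall>x. (1 + norm x) ^ k * norm (f x) \<le> C" by blast
qed

section \<open>Integration of rapidly decaying against polynomially bounded functions\<close>

lemma integral_affine:
  fixes f :: "'a::euclidean_space \<Rightarrow> 'b::{banach, second_countable_topology}" and c :: real
  assumes [measurable]: "f \<in> borel_measurable borel" and c: "c \<noteq> 0"
  shows "(LINT x|lborel. f x) = \<bar>c\<bar> ^ DIM('a) *\<^sub>R (LINT x|lborel. f (t + c *\<^sub>R x))"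
    and "integrable lborel (\<lambda>x. f (t + c *\<^sub>R x)) \<longleftrightarrow> integrable lborel f"
proof -
  show "(LINT x|lborel. f x) = \<bar>c\<bar> ^ DIM('a) *\<^sub>R (LINT x|lborel. f (t + c *\<^sub>R x))"
    by (subst lborel_affine[OF c, of t], subst integral_density) (auto simp: integral_distr)
  have "integrable lborel f \<longleftrightarrow> integrable lborel (\<lambda>x. \<bar>c\<bar> ^ DIM('a) *\<^sub>R f (t + c *\<^sub>R x))"
    by (subst lborel_affine[OF c, of t], subst integrable_density) (auto simp: integrable_distr_eq)
  then show "integrable lborel (\<lambda>x. f (t + c *\<^sub>R x)) \<longleftrightarrow> integrable lborel f"
    using c integrable_scaleR_right[of "inverse (\<bar>c\<bar> ^ DIM('a))" lborel "\<lambda>x. \<bar>c\<bar> ^ DIM('a) *\<^sub>R f (t + c *\<^sub>R x)"]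
    by auto
qed

lemma integral_translate:
  fixes f :: "'a::euclidean_space \<Rightarrow> 'b::{banach, second_countable_topology}"
  assumes "f \<in> borel_measurable borel"
  shows "(LINT x|lborel. f (x + t)) = (LINT x|lborel. f x)"
    and "(LINT x|lborel. f (x - t)) = (LINT x|lborel. f x)"
    and "(LINT x|lborel. f (t - x)) = (LINT x|lborel. f x)"
    and "integrable lborel (\<lambda>x. f (x + t)) \<longleftrightarrow> integrable lborel f"
    and "integrable lborel (\<lambda>x. f (x - t)) \<longleftrightarrow> integrable lborel f"
    and "integrable lborel (\<lambda>x. f (t - x)) \<longleftrightarrow> integrable lborel f"
  using integral_affine[OF assms, of 1 t] integral_affine[OF assms, of 1 "- t"] integral_affine[OF assms, of "-1" t]
  by (simp_all add: add.commute)

text \<open>The exponent is chosen for a product bound: every coordinate satisfies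
  \<open>1 + (x \<bullet> b)^2 \<le> (1 + norm x)^2\<close>, so the function lies below a tensor
  product of the integrable functions \<open>1 / (1 + t^2)\<close>.\<close>

lemma inv_poly_integrable:
  "integrable lborel (\<lambda>x::'a::euclidean_space. inverse ((1 + norm x) ^ (2 * DIM('a))))"
proof -
  define h :: "real \<Rightarrow> real" where "h x = inverse (1 + x\<^sup>2)" for x
  have h0: "h x \<ge> 0" for x by (simp add: h_def)
  have [measurable]: "h \<in> borel_measurable borel" unfolding h_def[abs_def] by measurable
  have "integrable lborel h"
    using integrable_inverse_1_plus_square
    by (simp add: einterval_eq set_integrable_def h_def[abs_def])
  then have h_int: "(\<integral>\<^sup>+x. ennreal (h x) \<partial>lborel) = ennreal (LINT x|lborel. h x)"
    by (intro nn_integral_eq_integral) (auto simp: h0)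
  show ?thesis
  proof (rule integrableI_bounded)
    have "inverse ((1 + norm x) ^ (2 * DIM('a))) \<le> (\<Prod>b\<in>Basis. h (x \<bullet> b))" for x :: 'a
    proof -
      have "inverse ((1 + norm x) ^ (2 * DIM('a))) = (\<Prod>b\<in>(Basis :: 'a set). inverse ((1 + norm x)\<^sup>2))"
        by (simp add: power_mult power_inverse)
      also have "\<dots> \<le> (\<Prod>b\<in>Basis. h (x \<bullet> b))"
        unfolding h_def
      proof (intro prod_mono conjI le_imp_inverse_le)
        fix b :: 'a assume "b \<in> Basis"
        then have "(x \<bullet> b)\<^sup>2 \<le> (norm x)\<^sup>2" using Basis_le_norm by (metis abs_ge_zero power2_abs power_mono)
        then show "1 + (x \<bullet> b)\<^sup>2 \<le> (1 + norm x)\<^sup>2"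
          by (simp add: power2_eq_square algebra_simps) (use norm_ge_zero[of x] in linarith)
        show "0 < 1 + (x \<bullet> b)\<^sup>2" by (simp add: add_pos_nonneg)
      qed auto
      finally show ?thesis .
    qed
    then have le: "ennreal (norm (inverse ((1 + norm x) ^ (2 * DIM('a))))) \<le> (\<Prod>b\<in>Basis. ennreal (h (x \<bullet> b)))" for x :: 'a
      by (simp add: prod_ennreal h0 ennreal_leI)
    have "(\<integral>\<^sup>+x. ennreal (norm (inverse ((1 + norm x) ^ (2 * DIM('a))))) \<partial>(lborel :: 'a measure))
        \<le> (\<integral>\<^sup>+x. (\<Prod>b\<in>Basis. ennreal (h (x \<bullet> b))) \<partial>(lborel :: 'a measure))"
      by (rule nn_integral_mono) (rule le)
    also have "\<dots> = (\<Prod>b\<in>(Basis::'a set). ennreal (LINT x|lborel. h x))"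
      by (subst nn_integral_lborel_prod) (simp_all add: h_int)
    also have "\<dots> < \<infinity>" by (subst prod_ennreal) (auto simp: h0)
    finally show "(\<integral>\<^sup>+x. ennreal (norm (inverse ((1 + norm x) ^ (2 * DIM('a))))) \<partial>(lborel :: 'a measure)) < \<infinity>" .
  qed measurable
qed

definition poly_bounded :: "('a::real_normed_vector \<Rightarrow> 'b::real_normed_vector) \<Rightarrow> bool" where
  "poly_bounded u \<longleftrightarrow> (\<exists>C k. \<forall>x. norm (u x) \<le> C * (1 + norm x) ^ k)"

text \<open>Integrability of all weighted norms, without smoothness or pointwise decay. This admits
  the discontinuous cut-offs of \<open>f\<close>, and it is all that the first factor of a
  convolution has to satisfy.\<close>

definition rapid :: "('a::euclidean_space \<Rightarrow> complex) \<Rightarrow> bool" where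
  "rapid g \<longleftrightarrow> g \<in> borel_measurable borel \<and> (\<forall>k. integrable lborel (\<lambda>x. (1 + norm x) ^ k * norm (g x)))"

lemma rapid_measurable [measurable_dest]: "rapid g \<Longrightarrow> g \<in> borel_measurable borel"
  by (simp add: rapid_def)

lemma poly_boundedI: "(\<And>x. norm (u x) \<le> C * (1 + norm x) ^ k) \<Longrightarrow> poly_bounded u"
  unfolding poly_bounded_def by blast

lemma poly_boundedE:
  assumes "poly_bounded u"
  obtains C k where "\<And>x. norm (u x) \<le> C * (1 + norm x) ^ k" "C \<ge> 0"
proof -
  from assms obtain C k where *: "\<And>x. norm (u x) \<le> C * (1 + norm x) ^ k" unfolding poly_bounded_def by blast
  have "C \<ge> 0" using order_trans[OF norm_ge_zero *[of 0]] by simp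
  with * that show ?thesis by blast
qed

lemma poly_bounded_bounded: "(\<And>x. norm (u x) \<le> C) \<Longrightarrow> poly_bounded u"
  by (rule poly_boundedI[of _ C 0]) simp

lemma rapidI:
  fixes g :: "'a::euclidean_space \<Rightarrow> complex"
  assumes [measurable]: "g \<in> borel_measurable borel"
    and bound: "\<And>k. \<exists>C. \<forall>x. (1 + norm x) ^ k * norm (g x) \<le> C"
  shows "rapid g"
  unfolding rapid_def
proof (intro conjI allI assms(1))
  fix k
  obtain C where C: "\<And>x. (1 + norm x) ^ (k + 2 * DIM('a)) * norm (g x) \<le> C" using bound by blast
  have "0 < 1 + norm x" for x :: 'a by (simp add: add_pos_nonneg)
  then have pos: "0 < (1 + norm x) ^ l" for x :: 'a and l by simp
  show "integrable lborel (\<lambda>x. (1 + norm x) ^ k * norm (g x))"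
  proof (rule Bochner_Integration.integrable_bound)
    show "integrable lborel (\<lambda>x::'a. C * inverse ((1 + norm x) ^ (2 * DIM('a))))"
      by (intro integrable_mult_right inv_poly_integrable)
    have "(1 + norm x) ^ k * norm (g x) \<le> C * inverse ((1 + norm x) ^ (2 * DIM('a)))" for x
      using C[of x] pos[of x "2 * DIM('a)"] by (simp add: power_add field_simps)
    then show "AE x in lborel. norm ((1 + norm x) ^ k * norm (g x)) \<le> norm (C * inverse ((1 + norm x) ^ (2 * DIM('a))))"
      by (intro always_eventually allI) (smt (verit) norm_ge_zero real_norm_def zero_le_mult_iff zero_le_power)
  qed measurable
qed

lemma schwartz_rapid: "\<gamma> \<in> schwartz \<Longrightarrow> rapid \<gamma>"
  by (intro rapidI schwartz_measurable schwartz_bound)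

lemma rapid_mult:
  assumes g: "rapid g" and u: "poly_bounded u" and [measurable]: "u \<in> borel_measurable borel"
  shows "rapid (\<lambda>x. g x * u x)"
  unfolding rapid_def
proof (intro conjI allI)
  note rapid_measurable[OF g, measurable]
  show "(\<lambda>x. g x * u x) \<in> borel_measurable borel" by measurable
  fix k
  obtain C l where C: "\<And>x. norm (u x) \<le> C * (1 + norm x) ^ l" "C \<ge> 0" using u by (rule poly_boundedE) blast
  show "integrable lborel (\<lambda>x. (1 + norm x) ^ k * norm (g x * u x))"
  proof (rule Bochner_Integration.integrable_bound)
    show "integrable lborel (\<lambda>x. C * ((1 + norm x) ^ (k + l) * norm (g x)))"
      using g by (intro integrable_mult_right) (auto simp: rapid_def)
    have "(1 + norm x) ^ k * norm (g x * u x) \<le> C * ((1 + norm x) ^ (k + l) * norm (g x))" for x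
    proof -
      have "(1 + norm x) ^ k * norm (g x * u x) \<le> (1 + norm x) ^ k * (norm (g x) * (C * (1 + norm x) ^ l))"
        unfolding norm_mult by (intro mult_left_mono C) auto
      then show ?thesis by (simp add: power_add mult_ac)
    qed
    then show "AE x in lborel. norm ((1 + norm x) ^ k * norm (g x * u x)) \<le> norm (C * ((1 + norm x) ^ (k + l) * norm (g x)))"
      by (intro always_eventually allI) (simp add: C(2))
  qed measurable
qed

lemma rapid_integrable: assumes "rapid g" shows "integrable lborel g"
proof -
  have "integrable lborel (\<lambda>x. (1 + norm x) ^ 0 * norm (g x))" using assms unfolding rapid_def by blast
  then show ?thesis using integrable_norm_iff rapid_measurable[OF assms] by (simp add: integrable_norm_iff)
qed

lemma rapid_mult_integrable:
  "rapid g \<Longrightarrow> poly_bounded u \<Longrightarrow> u \<in> borel_measurable borel \<Longrightarrow> integrable lborel (\<lambda>x. g x * u x)"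
  by (intro rapid_integrable rapid_mult)

lemma schwartz_poly_bounded: "\<gamma> \<in> schwartz \<Longrightarrow> poly_bounded \<gamma>"
  using schwartz_bound[of \<gamma> 0] by (auto intro: poly_bounded_bounded)

lemma poly_bounded_translate:
  assumes "poly_bounded u"
  shows "poly_bounded (\<lambda>x. u (x + v))" and "poly_bounded (\<lambda>x. u (v - x))"
proof -
  obtain C k where C: "\<And>x. norm (u x) \<le> C * (1 + norm x) ^ k" "C \<ge> 0" using assms(1) by (rule poly_boundedE) blast
  have *: "norm (u y) \<le> (C * (1 + norm v) ^ k) * (1 + norm x) ^ k" if "norm y \<le> norm x + norm v" for x y
  proof -
    have "0 \<le> norm v * norm x" by simp
    then have y: "1 + norm y \<le> (1 + norm v) * (1 + norm x)"
      using that unfolding ring_distribs by linarith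
    have "norm (u y) \<le> C * (1 + norm y) ^ k" by (rule C)
    also have "\<dots> \<le> C * ((1 + norm v) * (1 + norm x)) ^ k"
      by (intro mult_left_mono power_mono C y) auto
    finally show ?thesis by (simp add: power_mult_distrib)
  qed
  show "poly_bounded (\<lambda>x. u (x + v))" "poly_bounded (\<lambda>x. u (v - x))"
    by (rule poly_boundedI, rule *, norm)+
qed

lemma poly_bounded_mult:
  fixes u v :: "'a::real_normed_vector \<Rightarrow> 'b::real_normed_algebra"
  assumes "poly_bounded u" "poly_bounded v"
  shows "poly_bounded (\<lambda>x. u x * v x)"
proof -
  obtain C k where C: "\<And>x. norm (u x) \<le> C * (1 + norm x) ^ k" "C \<ge> 0" using assms(1) by (rule poly_boundedE) blast
  obtain D l where D: "\<And>x. norm (v x) \<le> D * (1 + norm x) ^ l" "D \<ge> 0" using assms(2) by (rule poly_boundedE) blast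
  have "norm (u x * v x) \<le> (C * D) * (1 + norm x) ^ (k + l)" for x
    using order_trans[OF norm_mult_ineq mult_mono[OF C(1) D(1)], of x x] C(2)
    by (simp add: power_add mult_ac)
  then show ?thesis by (rule poly_boundedI)
qed

lemma poly_bounded_add:
  assumes "poly_bounded u" "poly_bounded v"
  shows "poly_bounded (\<lambda>x. u x + v x)"
proof -
  obtain C k where C: "\<And>x. norm (u x) \<le> C * (1 + norm x) ^ k" "C \<ge> 0" using assms(1) by (rule poly_boundedE) blast
  obtain D l where D: "\<And>x. norm (v x) \<le> D * (1 + norm x) ^ l" "D \<ge> 0" using assms(2) by (rule poly_boundedE) blast
  have "norm (u x + v x) \<le> (C + D) * (1 + norm x) ^ (k + l)" for x
  proof -
    have "norm (u x + v x) \<le> C * (1 + norm x) ^ k + D * (1 + norm x) ^ l"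
      by (rule norm_triangle_le) (rule add_mono[OF C(1) D(1)])
    also have "\<dots> \<le> C * (1 + norm x) ^ (k + l) + D * (1 + norm x) ^ (k + l)"
      by (intro add_mono mult_left_mono power_increasing C D) auto
    finally show ?thesis by (simp add: algebra_simps)
  qed
  then show ?thesis by (rule poly_boundedI)
qed

lemma poly_bounded_of_real: "poly_bounded (\<lambda>x. complex_of_real (u x)) \<longleftrightarrow> poly_bounded u"
  by (simp add: poly_bounded_def)

text \<open>For continuous \<open>f\<close> the points with \<open>r < norm x\<close> that violate
  the growth bound form an open set; being null it is empty. The remaining closed ball is compact,
  so \<open>f\<close> is bounded there.\<close>

lemma continuous_slowly_increasing_poly_bounded:
  fixes f :: "real^'d \<Rightarrow> 'b::real_normed_vector"
  assumes cont: "continuous_on UNIV f" and slow: "slowly_increasing f"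
  shows "poly_bounded f"
proof -
  from slow obtain k C r where ae: "AE x in lebesgue. r \<le> norm x \<longrightarrow> norm (f x) \<le> C * norm x ^ k"
    unfolding slowly_increasing_def by blast
  define U where "U = {x. r < norm x} \<inter> {x. C * norm x ^ k < norm (f x)}"
  have "open U" unfolding U_def
    by (intro open_Int open_Collect_less continuous_intros cont)
  have "AE x in lebesgue. x \<notin> U" using ae by eventually_elim (auto simp: U_def)
  then have "U \<in> null_sets lebesgue"
    using \<open>open U\<close> by (subst AE_iff_null_sets) auto
  then have "negligible U" by (simp add: negligible_iff_null_sets)
  then have U: "U = {}" using open_not_negligible[OF \<open>open U\<close>] by blast
  have "compact (f ` cball 0 \<bar>r\<bar>)"
    by (intro compact_continuous_image continuous_on_subset[OF cont]) auto
  then obtain B where B: "\<And>x. x \<in> cball 0 \<bar>r\<bar> \<Longrightarrow> norm (f x) \<le> B"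
    using compact_imp_bounded bounded_iff by (metis imageI)
  have "norm (f x) \<le> (\<bar>B\<bar> + \<bar>C\<bar>) * (1 + norm x) ^ k" for x
  proof (cases "norm x \<le> \<bar>r\<bar>")
    case True
    then have "norm (f x) \<le> \<bar>B\<bar> * 1" using B[of x] by simp
    also have "\<dots> \<le> (\<bar>B\<bar> + \<bar>C\<bar>) * (1 + norm x) ^ k" by (intro mult_mono one_le_power) auto
    finally show ?thesis .
  next
    case False
    then have "r < norm x" by linarith
    moreover have "x \<notin> U" using U by simp
    ultimately have "norm (f x) \<le> C * norm x ^ k" by (simp add: U_def not_less)
    also have "\<dots> \<le> (\<bar>B\<bar> + \<bar>C\<bar>) * (1 + norm x) ^ k" by (intro mult_mono power_mono) auto
    finally show ?thesis .
  qed
  then show ?thesis by (rule poly_boundedI)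
qed

lemma integral_lebesgue_lborel:
  fixes f :: "real^'d \<Rightarrow> 'b::{banach, second_countable_topology}"
  shows "f \<in> borel_measurable borel \<Longrightarrow> integral\<^sup>L lebesgue f = integral\<^sup>L lborel f"
  by (intro integral_completion) simp

lemma distr_of_eq:
  assumes "\<gamma> \<in> schwartz" and [measurable]: "f \<in> borel_measurable borel"
  shows "distr_of f \<gamma> = (LINT x|lborel. f x * \<gamma> x)"
proof -
  note schwartz_measurable[OF assms(1), measurable]
  show ?thesis unfolding distr_of_def using assms(1) by (simp add: integral_lebesgue_lborel)
qed

lemma schwartz_seminorm_bound:
  assumes "\<gamma> \<in> schwartz"
  shows "(1 + norm x) ^ k * norm (\<gamma> x) \<le> schwartz_seminorm k [] \<gamma>"
proof -
  obtain C where "\<And>x. (1 + norm x) ^ k * norm (\<gamma> x) \<le> C" using schwartz_bound[OF assms] by blast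
  then have "bdd_above (range (\<lambda>x. (1 + norm x) ^ k * norm (partials [] \<gamma> x)))"
    by (auto simp: bdd_above_def)
  from cSUP_upper[OF _ this, of x] show ?thesis by (simp add: schwartz_seminorm_def)
qed

text \<open>A single weighted supremum seminorm dominates the functional: \<open>k\<close> powers of
  the weight absorb the growth of \<open>f\<close>, and \<open>?N\<close> further powers make the
  majorant integrable.\<close>

lemma distr_of_tempered:
  fixes f :: "real^'d::finite \<Rightarrow> complex"
  assumes [measurable]: "f \<in> borel_measurable borel" and f: "poly_bounded f"
  shows "distr_of f \<in> tempered"
proof -
  obtain C k where C: "\<And>x. norm (f x) \<le> C * (1 + norm x) ^ k" "C \<ge> 0" using f by (rule poly_boundedE) blast
  let ?N = "2 * DIM(real^'d)"
  define I where "I = (LINT x|lborel. inverse ((1 + norm (x::real^'d)) ^ ?N))"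
  have int: "integrable lborel (\<lambda>x. f x * \<gamma> x)" if "\<gamma> \<in> schwartz" for \<gamma>
    using rapid_mult_integrable[OF schwartz_rapid[OF that] f] by (simp add: mult.commute)
  have lin: "distr_of f (\<lambda>x. a * \<gamma> x + \<eta> x) = a * distr_of f \<gamma> + distr_of f \<eta>"
    if "\<gamma> \<in> schwartz" "\<eta> \<in> schwartz" for a \<gamma> \<eta>
  proof -
    have "(LINT x|lborel. f x * (a * \<gamma> x + \<eta> x)) = (LINT x|lborel. a * (f x * \<gamma> x) + f x * \<eta> x)"
      by (simp add: algebra_simps)
    also have "\<dots> = a * (LINT x|lborel. f x * \<gamma> x) + (LINT x|lborel. f x * \<eta> x)"
      by (subst Bochner_Integration.integral_add) (auto intro!: int that)
    finally show ?thesis using that by (simp add: distr_of_eq schwartz_lc)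
  qed
  have bound: "norm (distr_of f \<gamma>) \<le> C * I * schwartz_seminorm (k + ?N) [] \<gamma>" if "\<gamma> \<in> schwartz" for \<gamma>
  proof -
    let ?s = "schwartz_seminorm (k + ?N) [] \<gamma>"
    have "norm (distr_of f \<gamma>) \<le> (LINT x|lborel. C * ?s * inverse ((1 + norm (x::real^'d)) ^ ?N))"
      unfolding distr_of_eq[OF that assms(1)]
    proof (rule order_trans[OF integral_norm_bound integral_mono])
      show "integrable lborel (\<lambda>x. norm (f x * \<gamma> x))" by (intro integrable_norm int that)
      show "integrable lborel (\<lambda>x::real^'d. C * ?s * inverse ((1 + norm x) ^ ?N))"
        by (intro integrable_mult_right inv_poly_integrable)
      fix x :: "real^'d"
      have pos: "0 < (1 + norm x) ^ l" for l by (simp add: add_pos_nonneg)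
      have "norm (f x * \<gamma> x) \<le> C * (1 + norm x) ^ k * norm (\<gamma> x)"
        unfolding norm_mult by (intro mult_right_mono C) auto
      also have "\<dots> = C * ((1 + norm x) ^ (k + ?N) * norm (\<gamma> x)) * inverse ((1 + norm x) ^ ?N)"
        using less_imp_neq[OF pos[of ?N]] by (simp add: power_add field_simps)
      also have "\<dots> \<le> C * ?s * inverse ((1 + norm x) ^ ?N)"
        using pos[of ?N] by (intro mult_right_mono mult_left_mono schwartz_seminorm_bound that C) auto
      finally show "norm (f x * \<gamma> x) \<le> C * ?s * inverse ((1 + norm x) ^ ?N)" .
    qed
    then show ?thesis by (simp add: I_def mult_ac)
  qed
  have top: "topspace schwartz_topology = (schwartz :: (real^'d \<Rightarrow> complex) set)"
  proof -
    \<comment> \<open>The whole Schwartz space is covered because each \<gamma> lies in a basic set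
      centred at itself; the radius exceeds the seminorm of the zero difference whatever its
      value.\<close>
    have "\<exists>k is r. \<gamma> \<in> {\<eta> \<in> schwartz. schwartz_seminorm k is (\<lambda>x. \<eta> x - \<gamma> x) < r}"
      if "\<gamma> \<in> schwartz" for \<gamma> :: "real^'d \<Rightarrow> complex"
      by (intro exI[of _ "0::nat"] exI[of _ "[]"]
          exI[of _ "schwartz_seminorm 0 [] (\<lambda>x. \<gamma> x - \<gamma> x) + 1"]) (use that in simp)
    then show ?thesis unfolding schwartz_topology_def topology_generated_by_topspace by blast
  qed
  have "continuous_map schwartz_topology euclidean (distr_of f)"
    unfolding continuous_map_def
  proof (intro conjI allI impI)
    show "distr_of f \<in> topspace schwartz_topology \<rightarrow> topspace euclidean" by simp
    fix U :: "complex set" assume "openin euclidean U"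
    then have U: "open U" by simp
    show "openin schwartz_topology {x \<in> topspace schwartz_topology. distr_of f x \<in> U}"
      unfolding top
    proof (subst openin_subopen, intro ballI)
      fix \<gamma> assume "\<gamma> \<in> {x \<in> schwartz. distr_of f x \<in> U}"
      then have \<gamma>: "\<gamma> \<in> schwartz" "distr_of f \<gamma> \<in> U" by auto
      obtain e where e: "e > 0" "ball (distr_of f \<gamma>) e \<subseteq> U" using U \<gamma>(2) openE by blast
      \<comment> \<open>The summand 1 keeps the quotient defined when the operator bound
        \<open>C * I\<close> is zero.\<close>
      define r where "r = e / (\<bar>C * I\<bar> + 1)"
      have r: "r > 0" using e by (simp add: r_def add_nonneg_pos)
      let ?B = "{\<eta> \<in> schwartz. schwartz_seminorm (k + ?N) [] (\<lambda>x. \<eta> x - \<gamma> x) < r}"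
      have "openin schwartz_topology ?B"
        unfolding schwartz_topology_def by (rule topology_generated_by_Basis) (use \<gamma> in blast)
      moreover have "\<gamma> \<in> ?B" using \<gamma> r by (simp add: schwartz_seminorm_def)
      moreover have "?B \<subseteq> {x \<in> schwartz. distr_of f x \<in> U}"
      proof
        fix \<eta> assume "\<eta> \<in> ?B"
        then have \<eta>: "\<eta> \<in> schwartz" and s: "schwartz_seminorm (k + ?N) [] (\<lambda>x. \<eta> x - \<gamma> x) < r" by auto
        have d: "(\<lambda>x. \<eta> x - \<gamma> x) \<in> schwartz" by (intro schwartz_diff \<eta> \<gamma>)
        have "distr_of f (\<lambda>x. \<eta> x - \<gamma> x) = distr_of f \<eta> - distr_of f \<gamma>"
          using lin[OF \<gamma>(1) \<eta>, of "-1"] by simp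
        moreover have "norm (distr_of f (\<lambda>x. \<eta> x - \<gamma> x)) < e"
        proof -
          have s0: "0 \<le> schwartz_seminorm (k + ?N) [] (\<lambda>x. \<eta> x - \<gamma> x)"
            using schwartz_seminorm_bound[OF d, of 0 "k + ?N"] by (rule order_trans[rotated]) simp
          have "norm (distr_of f (\<lambda>x. \<eta> x - \<gamma> x)) \<le> C * I * schwartz_seminorm (k + ?N) [] (\<lambda>x. \<eta> x - \<gamma> x)"
            by (rule bound[OF d])
          also have "\<dots> \<le> (\<bar>C * I\<bar> + 1) * schwartz_seminorm (k + ?N) [] (\<lambda>x. \<eta> x - \<gamma> x)"
            by (intro mult_right_mono s0) auto
          also have "\<dots> < (\<bar>C * I\<bar> + 1) * r" by (intro mult_strict_left_mono s) auto
          also have "\<dots> = e" by (simp add: r_def add_nonneg_pos[THEN less_imp_neq[THEN not_sym]])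
          finally show ?thesis .
        qed
        ultimately have "distr_of f \<eta> \<in> ball (distr_of f \<gamma>) e"
          by (simp add: dist_norm norm_minus_commute)
        then show "\<eta> \<in> {x \<in> schwartz. distr_of f x \<in> U}" using \<eta> e by blast
      qed
      ultimately show "\<exists>T. openin schwartz_topology T \<and> \<gamma> \<in> T \<and> T \<subseteq> {x \<in> schwartz. distr_of f x \<in> U}" by blast
    qed
  qed
  then show ?thesis using lin unfolding tempered_def by (auto simp: distr_of_def)
qed

section \<open>Convolution\<close>

lemma schwartz_partials_bound:
  assumes "\<gamma> \<in> schwartz"
  shows "\<exists>B\<ge>0. \<forall>x h. norm (\<Sum>i\<in>UNIV. (h $ i) *\<^sub>R partial i \<gamma> x) \<le> B * norm (h :: real^'d)"
proof -
  have "\<forall>i. \<exists>C. \<forall>x. norm (partial i \<gamma> x) \<le> C"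
    using schwartz_bound[OF schwartz_partial[OF assms], of 0] by simp
  then obtain C where C: "\<And>i x. norm (partial i \<gamma> x) \<le> C i" by metis
  have C0: "0 \<le> C i" for i using order_trans[OF norm_ge_zero C] .
  have "norm (\<Sum>i\<in>UNIV. (h $ i) *\<^sub>R partial i \<gamma> x) \<le> (\<Sum>i\<in>UNIV. C i) * norm h" for x and h :: "real^'d"
    unfolding sum_distrib_right
  proof (rule order_trans[OF norm_sum sum_mono])
    fix i
    show "norm ((h $ i) *\<^sub>R partial i \<gamma> x) \<le> C i * norm h"
      unfolding norm_scaleR by (subst mult.commute) (intro mult_mono C C0 component_le_norm_cart, simp)
  qed
  then show ?thesis using sum_nonneg[of UNIV C] C0 by blast
qed

lemma schwartz_Lipschitz:
  assumes "\<gamma> \<in> schwartz"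
  shows "\<exists>B\<ge>0. \<forall>x y. norm (\<gamma> x - \<gamma> y) \<le> B * norm (x - y)"
proof -
  obtain B where B: "B \<ge> 0" "\<And>x h. norm (\<Sum>i\<in>UNIV. (h $ i) *\<^sub>R partial i \<gamma> x) \<le> B * norm h"
    using schwartz_partials_bound[OF assms] by blast
  have "norm (\<gamma> x - \<gamma> y) \<le> B * norm (x - y)" for x y
    by (rule differentiable_bound[OF convex_UNIV schwartz_has_derivative[OF assms, THEN has_derivative_at_withinI]])
       (auto intro: onorm_bound B)
  then show ?thesis using B(1) by blast
qed

text \<open>The point is that \<open>B\<close> does not depend on \<open>z\<close>: the second order
  remainder can be integrated against any integrable function, which differentiates convolutions
  directly.\<close>

lemma schwartz_Taylor:
  assumes "\<gamma> \<in> (schwartz :: (real^'d::finite \<Rightarrow> complex) set)"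
  shows "\<exists>B. \<forall>z h. norm (\<gamma> (z + h) - \<gamma> z - (\<Sum>i\<in>UNIV. (h $ i) *\<^sub>R partial i \<gamma> z)) \<le> B * (norm h)\<^sup>2"
proof -
  have "\<forall>i. \<exists>B\<ge>0. \<forall>x y. norm (partial i \<gamma> x - partial i \<gamma> y) \<le> B * norm (x - y)"
    using schwartz_Lipschitz[OF schwartz_partial[OF assms]] by blast
  then obtain B where B: "\<And>i. B i \<ge> 0" "\<And>i x y. norm (partial i \<gamma> x - partial i \<gamma> y) \<le> B i * norm (x - y)"
    by metis
  define K where "K = (\<Sum>i\<in>UNIV. B i)"
  have "norm (\<gamma> (z + h) - \<gamma> z - (\<Sum>i\<in>UNIV. (h $ i) *\<^sub>R partial i \<gamma> z)) \<le> K * (norm h)\<^sup>2" for z h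
  proof -
    \<comment> \<open>Subtracting the linear part leaves a function whose derivative on the ball of
      radius \<open>norm h\<close> is at most \<open>K * norm h\<close>; the mean value inequality
      supplies the second factor \<open>norm h\<close>.\<close>
    define g where "g u = \<gamma> u - (\<Sum>i\<in>UNIV. (u $ i) *\<^sub>R partial i \<gamma> z)" for u
    have g: "(g has_derivative (\<lambda>h. (\<Sum>i\<in>UNIV. (h $ i) *\<^sub>R partial i \<gamma> x) - (\<Sum>i\<in>UNIV. (h $ i) *\<^sub>R partial i \<gamma> z)))
        (at x within cball z (norm h))" for x
      unfolding g_def
      by (intro has_derivative_diff schwartz_has_derivative[OF assms, THEN has_derivative_at_withinI]
          has_derivative_sum has_derivative_scaleR_left bounded_linear_imp_has_derivative bounded_linear_vec_nth)
    have "norm (g (z + h) - g z) \<le> (K * norm h) * norm ((z + h) - z)"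
    proof (rule differentiable_bound[OF convex_cball g])
      fix x assume "x \<in> cball z (norm h)"
      then have x: "norm (x - z) \<le> norm h" by (simp add: dist_norm norm_minus_commute)
      show "onorm (\<lambda>h. (\<Sum>i\<in>UNIV. (h $ i) *\<^sub>R partial i \<gamma> x) - (\<Sum>i\<in>UNIV. (h $ i) *\<^sub>R partial i \<gamma> z)) \<le> K * norm h"
      proof (rule onorm_bound)
        show "0 \<le> K * norm h" by (auto simp: K_def intro!: mult_nonneg_nonneg sum_nonneg B)
        fix v :: "real^'d"
        have "norm ((\<Sum>i\<in>UNIV. (v $ i) *\<^sub>R partial i \<gamma> x) - (\<Sum>i\<in>UNIV. (v $ i) *\<^sub>R partial i \<gamma> z))
          = norm (\<Sum>i\<in>UNIV. (v $ i) *\<^sub>R (partial i \<gamma> x - partial i \<gamma> z))"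
          by (simp add: sum_subtractf scaleR_diff_right)
        also have "\<dots> \<le> (\<Sum>i\<in>UNIV. B i * norm h * norm v)"
        proof (rule order_trans[OF norm_sum sum_mono])
          fix i
          have "norm (partial i \<gamma> x - partial i \<gamma> z) \<le> B i * norm h"
            by (rule order_trans[OF B(2) mult_left_mono[OF x B(1)]])
          then show "norm ((v $ i) *\<^sub>R (partial i \<gamma> x - partial i \<gamma> z)) \<le> B i * norm h * norm v"
            unfolding norm_scaleR by (subst mult.commute) (intro mult_mono component_le_norm_cart, auto intro: mult_nonneg_nonneg B)
        qed
        finally show "norm ((\<Sum>i\<in>UNIV. (v $ i) *\<^sub>R partial i \<gamma> x) - (\<Sum>i\<in>UNIV. (v $ i) *\<^sub>R partial i \<gamma> z))
          \<le> K * norm h * norm v" by (simp add: K_def sum_distrib_right)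
      qed
    qed (auto simp: dist_norm)
    moreover have "g (z + h) - g z = \<gamma> (z + h) - \<gamma> z - (\<Sum>i\<in>UNIV. (h $ i) *\<^sub>R partial i \<gamma> z)"
      by (simp add: g_def scaleR_add_left sum.distrib)
    ultimately show ?thesis by (simp add: power2_eq_square mult_ac)
  qed
  then show ?thesis by blast
qed

definition conv :: "('a::euclidean_space \<Rightarrow> complex) \<Rightarrow> ('a \<Rightarrow> complex) \<Rightarrow> 'a \<Rightarrow> complex" where
  "conv g \<phi> x = (LINT y|lborel. g y * \<phi> (x - y))"

lemma conv_integrable:
  assumes "rapid g" "poly_bounded \<phi>" and [measurable]: "\<phi> \<in> borel_measurable borel"
  shows "integrable lborel (\<lambda>y. g y * \<phi> (x - y))"
  by (rule rapid_mult_integrable) (use assms poly_bounded_translate(2) in auto)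

lemma conv_commute:
  assumes "g \<in> borel_measurable borel" "\<phi> \<in> borel_measurable borel"
  shows "conv g \<phi> x = conv \<phi> g x"
proof -
  note assms[measurable]
  have "(\<lambda>y. g y * \<phi> (x - y)) \<in> borel_measurable borel" by measurable
  from integral_translate(3)[OF this, of x] show ?thesis by (simp add: conv_def mult.commute)
qed

lemma conv_has_derivative:
  assumes g: "rapid g" and \<phi>: "\<phi> \<in> (schwartz :: (real^'d::finite \<Rightarrow> complex) set)"
  shows "(conv g \<phi> has_derivative (\<lambda>h. \<Sum>i\<in>UNIV. (h $ i) *\<^sub>R conv g (partial i \<phi>) x)) (at x)"
proof -
  note S = schwartz_poly_bounded schwartz_measurable schwartz_partial
  obtain B where B: "\<And>z h. norm (\<phi> (z + h) - \<phi> z - (\<Sum>i\<in>UNIV. (h $ i) *\<^sub>R partial i \<phi> z)) \<le> B * (norm h)\<^sup>2"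
    using schwartz_Taylor[OF \<phi>] by blast
  define K where "K = B * (LINT y|lborel. norm (g y))"
  let ?D = "\<lambda>h. \<Sum>i\<in>UNIV. (h $ i) *\<^sub>R conv g (partial i \<phi>) x"
  have est: "norm (conv g \<phi> (x + h) - conv g \<phi> x - ?D h) \<le> K * (norm h)\<^sup>2" for h
  proof -
    have i1: "integrable lborel (\<lambda>y. g y * \<phi> (x - y))" for x by (intro conv_integrable g S \<phi>)
    have i2: "integrable lborel (\<lambda>y. g y * partial i \<phi> (x - y))" for i by (intro conv_integrable g S \<phi>)
    have "conv g \<phi> (x + h) - conv g \<phi> x - ?D h = (LINT y|lborel. g y * \<phi> (x + h - y)
       - g y * \<phi> (x - y) - (\<Sum>i\<in>UNIV. (h $ i) *\<^sub>R (g y * partial i \<phi> (x - y))))"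
      unfolding conv_def
      by (subst Bochner_Integration.integral_diff Bochner_Integration.integral_sum,
          (intro i1 i2 integrable_scaleR_right Bochner_Integration.integrable_diff Bochner_Integration.integrable_sum)+)+ simp
    also have "\<dots> = (LINT y|lborel. g y * (\<phi> (x - y + h) - \<phi> (x - y) - (\<Sum>i\<in>UNIV. (h $ i) *\<^sub>R partial i \<phi> (x - y))))"
      by (intro Bochner_Integration.integral_cong refl)
         (simp add: algebra_simps sum_distrib_left)
    finally have eq: "conv g \<phi> (x + h) - conv g \<phi> x - ?D h
      = (LINT y|lborel. g y * (\<phi> (x - y + h) - \<phi> (x - y) - (\<Sum>i\<in>UNIV. (h $ i) *\<^sub>R partial i \<phi> (x - y))))" .
    have ig: "integrable lborel (\<lambda>y. norm (g y))" by (intro integrable_norm rapid_integrable g)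
    have "norm (conv g \<phi> (x + h) - conv g \<phi> x - ?D h) \<le> (LINT y|lborel. norm (g y) * (B * (norm h)\<^sup>2))"
      unfolding eq
    proof (rule Bochner_Integration.integral_norm_bound_integral)
      show "integrable lborel (\<lambda>y. norm (g y) * (B * (norm h)\<^sup>2))" by (intro integrable_mult_left ig)
      have "integrable lborel (\<lambda>y. g y * \<phi> (x + h - y)
       - g y * \<phi> (x - y) - (\<Sum>i\<in>UNIV. (h $ i) *\<^sub>R (g y * partial i \<phi> (x - y))))"
        by (intro i1 i2 integrable_scaleR_right Bochner_Integration.integrable_diff Bochner_Integration.integrable_sum)
      then show "integrable lborel (\<lambda>y. g y * (\<phi> (x - y + h) - \<phi> (x - y) - (\<Sum>i\<in>UNIV. (h $ i) *\<^sub>R partial i \<phi> (x - y))))"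
        by (rule Bochner_Integration.integrable_cong[THEN iffD1, rotated 2])
           (simp_all add: algebra_simps sum_distrib_left)
    qed (auto simp: norm_mult intro!: mult_left_mono B)
    then show ?thesis by (simp add: K_def mult_ac)
  qed
  show ?thesis
    unfolding has_derivative_at
  proof (intro conjI)
    show "bounded_linear ?D"
      by (intro bounded_linear_sum bounded_linear_scaleR_left[THEN bounded_linear_compose] bounded_linear_vec_nth)
    show "(\<lambda>h. norm (conv g \<phi> (x + h) - conv g \<phi> x - ?D h) / norm h) \<midarrow>0\<rightarrow> 0"
    proof (rule Lim_null_comparison)
      have "norm (norm (conv g \<phi> (x + h) - conv g \<phi> x - ?D h) / norm h) \<le> \<bar>K\<bar> * norm h" for h
      proof (cases "h = 0")
        case False
        have "norm (conv g \<phi> (x + h) - conv g \<phi> x - ?D h) \<le> \<bar>K\<bar> * (norm h)\<^sup>2"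
          by (rule order_trans[OF est]) (intro mult_right_mono, auto)
        then show ?thesis using False by (simp add: field_simps power2_eq_square)
      qed simp
      then show "\<forall>\<^sub>F h in at 0. norm (norm (conv g \<phi> (x + h) - conv g \<phi> x - ?D h) / norm h) \<le> \<bar>K\<bar> * norm h"
        by simp
      show "(\<lambda>h. \<bar>K\<bar> * norm h) \<midarrow>0\<rightarrow> 0" by (auto intro!: tendsto_eq_intros)
    qed
  qed
qed

text \<open>An inequality of Peetre type: it distributes a polynomial weight over the two factors of
  a convolution.\<close>

lemma one_plus_norm_le: "1 + norm x \<le> (1 + norm y) * (1 + norm (x - y))"
proof -
  have "norm x \<le> norm y + norm (x - y)" using norm_triangle_ineq[of y "x - y"] by simp
  moreover have "0 \<le> norm y * norm (x - y)" by simp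
  ultimately show ?thesis unfolding ring_distribs by linarith
qed

lemma schwartz_conv:
  assumes g: "rapid g" and \<phi>: "\<phi> \<in> (schwartz :: (real^'d::finite \<Rightarrow> complex) set)"
  shows "conv g \<phi> \<in> schwartz"
proof (rule schwartz_coinduct)
  let ?F = "conv g ` schwartz"
  show "conv g \<phi> \<in> ?F" using \<phi> by blast
  fix f :: "real^'d \<Rightarrow> complex" and i and k :: nat assume "f \<in> ?F"
  then obtain \<phi> where f: "f = conv g \<phi>" and \<phi>: "\<phi> \<in> schwartz" by blast
  note D = conv_has_derivative[OF g \<phi>]
  show "f differentiable_on UNIV" using D by (auto simp: f differentiable_on_def differentiable_def)
  have "partial i f = conv g (partial i \<phi>)"
    unfolding f by (rule ext) (subst partial_eqI[OF D], subst sum_axis_scaleR, simp)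
  then show "partial i f \<in> ?F" using schwartz_partial[OF \<phi>] by blast
  obtain C where C: "\<And>x. (1 + norm x) ^ k * norm (\<phi> x) \<le> C" using schwartz_bound[OF \<phi>] by blast
  have "(1 + norm x) ^ k * norm (f x) \<le> (LINT y|lborel. C * ((1 + norm y) ^ k * norm (g y)))" for x
  proof -
    have ig: "integrable lborel (\<lambda>y. C * ((1 + norm y) ^ k * norm (g y)))"
      using g by (intro integrable_mult_right) (simp add: rapid_def)
    have i1: "integrable lborel (\<lambda>y. g y * \<phi> (x - y))"
      by (intro conv_integrable g schwartz_poly_bounded schwartz_measurable \<phi>)
    have "(1 + norm x) ^ k * norm (f x) = norm (LINT y|lborel. (1 + norm x) ^ k *\<^sub>R (g y * \<phi> (x - y)))"
      by (simp add: f conv_def)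
    also have "\<dots> \<le> (LINT y|lborel. C * ((1 + norm y) ^ k * norm (g y)))"
    proof (rule Bochner_Integration.integral_norm_bound_integral[OF integrable_scaleR_right[OF i1] ig])
      fix y
      have "norm ((1 + norm x) ^ k *\<^sub>R (g y * \<phi> (x - y))) \<le> ((1 + norm y) * (1 + norm (x - y))) ^ k * norm (g y) * norm (\<phi> (x - y))"
        by (simp add: norm_mult mult.assoc[symmetric]) (intro mult_right_mono power_mono one_plus_norm_le, auto)
      also have "\<dots> = ((1 + norm y) ^ k * norm (g y)) * ((1 + norm (x - y)) ^ k * norm (\<phi> (x - y)))"
        by (simp add: power_mult_distrib mult_ac)
      also have "\<dots> \<le> ((1 + norm y) ^ k * norm (g y)) * C" by (intro mult_left_mono C) auto
      finally show "norm ((1 + norm x) ^ k *\<^sub>R (g y * \<phi> (x - y))) \<le> C * ((1 + norm y) ^ k * norm (g y))"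
        by (simp add: mult.commute)
    qed
    finally show ?thesis .
  qed
  then show "\<exists>C. \<forall>x. (1 + norm x) ^ k * norm (f x) \<le> C" by blast
qed

text \<open>The weight inequality splits the growth of \<open>u\<close> at \<open>x\<close> between
  the points \<open>y\<close> and \<open>x - y\<close>, where \<open>g\<close> and \<phi> absorb it.
  This gives the absolute integrability that Fubini needs.\<close>

lemma conv_Fubini:
  fixes g \<phi> u :: "'a::euclidean_space \<Rightarrow> complex"
  assumes g: "rapid g" and \<phi>: "rapid \<phi>" and u: "poly_bounded u" and [measurable]: "u \<in> borel_measurable borel"
  shows "(LINT x|lborel. conv g \<phi> x * u x) = (LINT y|lborel. g y * (LINT x|lborel. \<phi> (x - y) * u x))"
proof -
  note rapid_measurable[OF g, measurable] rapid_measurable[OF \<phi>, measurable]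
  obtain C k where C: "\<And>x. norm (u x) \<le> C * (1 + norm x) ^ k" "C \<ge> 0" using u by (rule poly_boundedE) blast
  define f where "f = (\<lambda>(y, x). g y * (\<phi> (x - y) * u x))"
  have [measurable]: "f \<in> borel_measurable (lborel \<Otimes>\<^sub>M lborel)" unfolding f_def by measurable
  define I where "I = (LINT x|lborel. (1 + norm x) ^ k * norm (\<phi> x))"
  have i\<phi>: "integrable lborel (\<lambda>x. (1 + norm x) ^ k * norm (\<phi> x))" using \<phi> by (simp add: rapid_def)
  have tr: "(LINT x|lborel. (1 + norm (x - y)) ^ k * norm (\<phi> (x - y))) = I"
       "integrable lborel (\<lambda>x. (1 + norm (x - y)) ^ k * norm (\<phi> (x - y)))" for y
    using integral_translate(2,5)[of "\<lambda>x. (1 + norm x) ^ k * norm (\<phi> x)" y] i\<phi> by (simp_all add: I_def)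
  have bnd: "norm (f (y, x)) \<le> (C * ((1 + norm y) ^ k * norm (g y))) * ((1 + norm (x - y)) ^ k * norm (\<phi> (x - y)))" for x y
  proof -
    have "norm (f (y, x)) \<le> norm (g y) * (norm (\<phi> (x - y)) * (C * ((1 + norm y) * (1 + norm (x - y))) ^ k))"
      unfolding f_def case_prod_conv norm_mult
      by (intro mult_left_mono order_trans[OF C(1)] power_mono one_plus_norm_le C(2)) auto
    then show ?thesis by (simp add: power_mult_distrib mult_ac)
  qed
  have iy: "integrable lborel (\<lambda>x. f (y, x))" for y
  proof (rule Bochner_Integration.integrable_bound)
    show "integrable lborel (\<lambda>x. (C * ((1 + norm y) ^ k * norm (g y))) * ((1 + norm (x - y)) ^ k * norm (\<phi> (x - y))))"
      by (intro integrable_mult_right tr)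
  qed (use bnd in \<open>auto intro!: always_eventually order_trans[OF bnd abs_ge_self]\<close>)
  have int: "integrable (lborel \<Otimes>\<^sub>M lborel) f"
  proof (rule lborel_pair.Fubini_integrable)
    show "integrable lborel (\<lambda>y. LINT x|lborel. norm (f (y, x)))"
    proof (rule Bochner_Integration.integrable_bound)
      show "integrable lborel (\<lambda>y. (C * I) * ((1 + norm y) ^ k * norm (g y)))"
        using g by (intro integrable_mult_right) (simp add: rapid_def)
      have "(LINT x|lborel. norm (f (y, x))) \<le> (C * I) * ((1 + norm y) ^ k * norm (g y))" for y
      proof -
        have "(LINT x|lborel. norm (f (y, x))) \<le> (LINT x|lborel. (C * ((1 + norm y) ^ k * norm (g y))) * ((1 + norm (x - y)) ^ k * norm (\<phi> (x - y))))"
          by (intro integral_mono integrable_norm iy integrable_mult_right tr bnd)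
        also have "\<dots> = (C * ((1 + norm y) ^ k * norm (g y))) * I"
          by (simp only: integral_mult_right_zero tr)
        finally show ?thesis by (simp add: mult_ac)
      qed
      then show "AE y in lborel. norm (LINT x|lborel. norm (f (y, x))) \<le> norm ((C * I) * ((1 + norm y) ^ k * norm (g y)))"
        by (intro always_eventually allI) (simp, rule order_trans[OF _ abs_ge_self], simp)
    qed measurable
  qed (use iy in auto)
  have int': "integrable (lborel \<Otimes>\<^sub>M lborel) (\<lambda>(y, x). g y * (\<phi> (x - y) * u x))" using int unfolding f_def .
  have eq: "conv g \<phi> x * u x = (LINT y|lborel. g y * (\<phi> (x - y) * u x))" for x
    unfolding conv_def by (subst integral_mult_left_zero[symmetric]) (simp add: mult.assoc)
  have "(LINT x|lborel. conv g \<phi> x * u x) = (LINT x|lborel. LINT y|lborel. g y * (\<phi> (x - y) * u x))"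
    by (simp add: eq)
  also have "\<dots> = (LINT y|lborel. LINT x|lborel. g y * (\<phi> (x - y) * u x))"
    by (rule lborel_pair.Fubini_integral[OF int'])
  finally show ?thesis by simp
qed

lemma conv_character:
  fixes g \<phi> :: "real^'d::finite \<Rightarrow> complex"
  assumes g: "rapid g" and \<phi>: "rapid \<phi>"
  shows "(LINT x|lborel. conv g \<phi> x * character s x)
    = (LINT x|lborel. g x * character s x) * (LINT x|lborel. \<phi> x * character s x)"
proof -
  note rapid_measurable[OF g, measurable] rapid_measurable[OF \<phi>, measurable]
  have "(LINT x|lborel. \<phi> (x - y) * character s x) = character s y * (LINT x|lborel. \<phi> x * character s x)" for y
  proof -
    have "(LINT x|lborel. \<phi> (x - y) * character s x) = (LINT x|lborel. \<phi> (x - y) * (character s (x - y) * character s y))"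
      by (simp add: character_add[symmetric])
    also have "\<dots> = (LINT x|lborel. \<phi> x * (character s x * character s y))"
      by (rule integral_translate(2)[of "\<lambda>x. \<phi> x * (character s x * character s y)"]) measurable
    also have "\<dots> = (LINT x|lborel. character s y * (\<phi> x * character s x))" by (simp add: mult_ac)
    finally show ?thesis by simp
  qed
  then have "(LINT x|lborel. conv g \<phi> x * character s x)
      = (LINT y|lborel. (g y * character s y) * (LINT x|lborel. \<phi> x * character s x))"
    using conv_Fubini[OF g \<phi>, of "character s"] poly_bounded_bounded[of "character s" 1]
    by (simp add: mult_ac)
  then show ?thesis by simp
qed

section \<open>Young's inequality\<close>

lemma nn_integral_translate:
  fixes f :: "'a::euclidean_space \<Rightarrow> ennreal"
  assumes [measurable]: "f \<in> borel_measurable borel"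
  shows "(\<integral>\<^sup>+x. f (x - t) \<partial>lborel) = (\<integral>\<^sup>+x. f x \<partial>lborel)"
    and "(\<integral>\<^sup>+x. f (t - x) \<partial>lborel) = (\<integral>\<^sup>+x. f x \<partial>lborel)"
proof -
  have "(\<integral>\<^sup>+x. f x \<partial>lborel) = (\<integral>\<^sup>+x. f (- t + 1 *\<^sub>R x) \<partial>lborel)"
    by (subst lborel_affine[of 1 "- t"], simp, subst nn_integral_density) (auto simp: nn_integral_distr)
  then show "(\<integral>\<^sup>+x. f (x - t) \<partial>lborel) = (\<integral>\<^sup>+x. f x \<partial>lborel)" by simp
  have "(\<integral>\<^sup>+x. f x \<partial>lborel) = (\<integral>\<^sup>+x. f (t + (-1) *\<^sub>R x) \<partial>lborel)"
    by (subst lborel_affine[of "-1" t], simp, subst nn_integral_density) (auto simp: nn_integral_distr)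
  then show "(\<integral>\<^sup>+x. f (t - x) \<partial>lborel) = (\<integral>\<^sup>+x. f x \<partial>lborel)" by simp
qed

text \<open>Without integrability the Bochner integral is 0 and the inequality is trivial. It lets
  Young's inequality be stated for arbitrary measurable functions.\<close>

lemma norm_integral_le_nn_integral:
  "ennreal (norm (integral\<^sup>L M f)) \<le> (\<integral>\<^sup>+x. ennreal (norm (f x)) \<partial>M)"
proof (cases "integrable M f")
  case True
  then show ?thesis by (rule integral_norm_bound_ennreal)
qed (simp add: not_integrable_integral_eq)

text \<open>Cauchy-Schwarz for the measure with density \<open>norm (k (x - y))\<close>, followed by
  Tonelli. Everything takes place in the extended nonnegative reals, so finiteness is never an
  issue.\<close>

lemma Young_L2:
  fixes f k :: "'a::euclidean_space \<Rightarrow> complex"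
  assumes [measurable]: "f \<in> borel_measurable borel" "k \<in> borel_measurable borel"
  shows "(\<integral>\<^sup>+x. ennreal ((norm (conv f k x))\<^sup>2) \<partial>lborel)
    \<le> (\<integral>\<^sup>+x. ennreal (norm (k x)) \<partial>lborel)\<^sup>2 * (\<integral>\<^sup>+x. ennreal ((norm (f x))\<^sup>2) \<partial>lborel)"
proof -
  define K where "K = (\<integral>\<^sup>+x. ennreal (norm (k x)) \<partial>lborel)"
  have pt: "ennreal ((norm (conv f k x))\<^sup>2) \<le> (\<integral>\<^sup>+y. ennreal ((norm (f y))\<^sup>2 * norm (k (x - y))) \<partial>lborel) * K" for x
  proof -
    have "ennreal ((norm (conv f k x))\<^sup>2) = (ennreal (norm (conv f k x)))\<^sup>2" by (simp add: ennreal_power)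
    also have "\<dots> \<le> (\<integral>\<^sup>+y. ennreal (norm (f y * k (x - y))) \<partial>lborel)\<^sup>2"
      unfolding conv_def by (intro power_mono norm_integral_le_nn_integral) simp
    \<comment> \<open>The factor \<open>k\<close> is split into two square roots, one for each side
      of Cauchy-Schwarz.\<close>
    also have "(\<lambda>y. ennreal (norm (f y * k (x - y))))
        = (\<lambda>y. ennreal (norm (f y) * sqrt (norm (k (x - y)))) * ennreal (sqrt (norm (k (x - y)))))"
      by (simp add: norm_mult ennreal_mult[symmetric] mult.assoc)
    also have "(\<integral>\<^sup>+y. ennreal (norm (f y) * sqrt (norm (k (x - y)))) * ennreal (sqrt (norm (k (x - y)))) \<partial>lborel)\<^sup>2
       \<le> (\<integral>\<^sup>+y. (ennreal (norm (f y) * sqrt (norm (k (x - y)))))\<^sup>2 \<partial>lborel) * (\<integral>\<^sup>+y. (ennreal (sqrt (norm (k (x - y)))))\<^sup>2 \<partial>lborel)"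
      by (rule Cauchy_Schwarz_nn_integral) measurable
    also have "\<dots> = (\<integral>\<^sup>+y. ennreal ((norm (f y))\<^sup>2 * norm (k (x - y))) \<partial>lborel) * (\<integral>\<^sup>+y. ennreal (norm (k (x - y))) \<partial>lborel)"
      by (simp add: ennreal_power power_mult_distrib)
    also have "(\<integral>\<^sup>+y. ennreal (norm (k (x - y))) \<partial>lborel) = K"
      unfolding K_def by (rule nn_integral_translate(2)) measurable
    finally show ?thesis .
  qed
  have "(\<integral>\<^sup>+x. ennreal ((norm (conv f k x))\<^sup>2) \<partial>lborel)
    \<le> (\<integral>\<^sup>+x. (\<integral>\<^sup>+y. ennreal ((norm (f y))\<^sup>2 * norm (k (x - y))) \<partial>lborel) * K \<partial>lborel)"
    by (rule nn_integral_mono) (rule pt)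
  also have "\<dots> = (\<integral>\<^sup>+x. \<integral>\<^sup>+y. ennreal ((norm (f y))\<^sup>2 * norm (k (x - y))) \<partial>lborel \<partial>lborel) * K"
    by (rule nn_integral_multc) measurable
  also have "(\<integral>\<^sup>+x. \<integral>\<^sup>+y. ennreal ((norm (f y))\<^sup>2 * norm (k (x - y))) \<partial>lborel \<partial>lborel)
     = (\<integral>\<^sup>+y. \<integral>\<^sup>+x. ennreal ((norm (f y))\<^sup>2 * norm (k (x - y))) \<partial>lborel \<partial>lborel)"
    by (rule lborel_pair.Fubini[of "\<lambda>(y, x). ennreal ((norm (f y))\<^sup>2 * norm (k (x - y)))", unfolded case_prod_conv]) measurable
  also have "\<dots> = (\<integral>\<^sup>+y. ennreal ((norm (f y))\<^sup>2) * K \<partial>lborel)"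
  proof (rule nn_integral_cong)
    fix y
    have "(\<integral>\<^sup>+x. ennreal ((norm (f y))\<^sup>2 * norm (k (x - y))) \<partial>lborel) = (\<integral>\<^sup>+x. ennreal ((norm (f y))\<^sup>2) * ennreal (norm (k (x - y))) \<partial>lborel)"
      by (simp add: ennreal_mult)
    also have "\<dots> = ennreal ((norm (f y))\<^sup>2) * (\<integral>\<^sup>+x. ennreal (norm (k (x - y))) \<partial>lborel)"
      by (rule nn_integral_cmult) measurable
    also have "(\<integral>\<^sup>+x. ennreal (norm (k (x - y))) \<partial>lborel) = K"
      unfolding K_def by (rule nn_integral_translate(1)) measurable
    finally show "(\<integral>\<^sup>+x. ennreal ((norm (f y))\<^sup>2 * norm (k (x - y))) \<partial>lborel) = ennreal ((norm (f y))\<^sup>2) * K" .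
  qed
  also have "\<dots> = (\<integral>\<^sup>+y. ennreal ((norm (f y))\<^sup>2) \<partial>lborel) * K"
    by (rule nn_integral_multc) measurable
  finally show ?thesis unfolding K_def power2_eq_square by (simp add: mult_ac)
qed

section \<open>Gaussians and Fourier inversion\<close>

lemma gauss_pos: "0 < gauss s x" by (simp add: gauss_def)

lemma gauss_measurable [measurable]:
  "gauss s \<in> borel_measurable (borel :: 'a::euclidean_space measure)"
  unfolding gauss_def[abs_def] by measurable

lemma gauss_rapid:
  "s > 0 \<Longrightarrow> rapid (\<lambda>x::'a::euclidean_space. complex_of_real (gauss s x))"
  by (rule rapidI) (use gauss_decay[of s] in \<open>auto simp: less_imp_le[OF gauss_pos]\<close>)

lemma gauss_minus_commute: "gauss s (x - y) = gauss s (y - x)"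
  by (simp add: gauss_def norm_minus_commute)

lemma gauss_scale: "gauss s (r *\<^sub>R x) = gauss (s * r\<^sup>2) x"
  by (simp add: gauss_def power_mult_distrib mult_ac)

lemma character_bounded: "poly_bounded (character a)"
  by (rule poly_bounded_bounded[of _ 1]) simp

text \<open>The case \<open>s = 1\<close> is the characteristic function of the standard normal
  distribution; the substitution by \<open>1 / sqrt s\<close> yields the others.\<close>

lemma gauss_fourier_real:
  assumes s: "s > 0"
  shows "(LINT x|lborel. complex_of_real (gauss s x) * character t x)
    = complex_of_real (sqrt (2 * pi / s) * gauss (1 / s) (t :: real))"
proof -
  have std: "(LINT x|lborel. complex_of_real (gauss 1 x) * character r x)
      = complex_of_real (sqrt (2 * pi) * gauss 1 (r::real))" for r
  proof -
    have "complex_of_real (exp (- r\<^sup>2 / 2)) = char std_normal_distribution r"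
      by (simp add: char_std_normal_distribution)
    also have "\<dots> = (LINT x|lborel. std_normal_density x *\<^sub>R iexp (r * x))"
      unfolding char_def by (subst integral_density) auto
    also have "\<dots> = (LINT x|lborel. complex_of_real (1 / sqrt (2 * pi)) * (complex_of_real (gauss 1 x) * character r x))"
      by (simp add: std_normal_density_def gauss_def character_def scaleR_conv_of_real mult_ac)
    also have "\<dots> = complex_of_real (1 / sqrt (2 * pi)) * (LINT x|lborel. complex_of_real (gauss 1 x) * character r x)"
      by simp
    finally show ?thesis by (simp add: gauss_def field_simps)
  qed
  have "(LINT x|lborel. complex_of_real (gauss s x) * character t x)
    = \<bar>1 / sqrt s\<bar> ^ DIM(real) *\<^sub>R (LINT x|lborel. complex_of_real (gauss s (0 + (1 / sqrt s) *\<^sub>R x)) * character t (0 + (1 / sqrt s) *\<^sub>R x))"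
    by (rule integral_affine) (use s in auto)
  also have "\<dots> = complex_of_real (1 / sqrt s) * (LINT x|lborel. complex_of_real (gauss 1 x) * character (t / sqrt s) x)"
    using s by (simp only: add_0 gauss_scale) (simp add: power_divide character_def scaleR_conv_of_real)
  also have "\<dots> = complex_of_real (1 / sqrt s * (sqrt (2 * pi) * gauss 1 (t / sqrt s)))"
    by (simp add: std)
  also have "1 / sqrt s * (sqrt (2 * pi) * gauss 1 (t / sqrt s)) = sqrt (2 * pi / s) * gauss (1 / s) t"
    using s by (simp add: gauss_def real_sqrt_divide power_divide)
  finally show ?thesis .
qed

lemma gauss_prod: "gauss s x = (\<Prod>b\<in>Basis. gauss s (x \<bullet> b))" for x :: "'a::euclidean_space"
proof -
  have "(norm x)\<^sup>2 = (\<Sum>b\<in>Basis. (x \<bullet> b)\<^sup>2)"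
    unfolding power2_norm_eq_inner by (subst euclidean_inner) (simp add: power2_eq_square)
  then show ?thesis
    by (simp add: gauss_def exp_sum[symmetric] sum_negf sum_distrib_left sum_divide_distrib)
qed

lemma character_prod: "character t x = (\<Prod>b\<in>Basis. character (t \<bullet> b) (x \<bullet> b))" for x :: "'a::euclidean_space"
  unfolding character_def
  by (subst euclidean_inner) (simp add: exp_sum[symmetric] sum_distrib_left)

text \<open>Both factors are products over the coordinates, so the integral is a product of
  one-dimensional ones.\<close>

lemma gauss_fourier:
  fixes t :: "'a::euclidean_space"
  assumes s: "s > 0"
  shows "(LINT x|lborel. complex_of_real (gauss s x) * character t x)
    = complex_of_real (sqrt (2 * pi / s) ^ DIM('a) * gauss (1 / s) t)"
proof -
  interpret product_sigma_finite "\<lambda>_::'a. lborel :: real measure" by standard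
  let ?F = "\<lambda>b x. complex_of_real (gauss s x) * character (t \<bullet> b) x"
  have F: "complex_of_real (gauss s x) * character t x = (\<Prod>b\<in>Basis. ?F b (x \<bullet> b))" for x
    by (subst gauss_prod, subst character_prod) (simp add: prod.distrib)
  have "(LINT x|lborel. complex_of_real (gauss s x) * character t x)
    = (LINT f|(\<Pi>\<^sub>M b\<in>Basis. lborel). (\<Prod>b\<in>Basis. ?F b ((\<Sum>b\<in>Basis. f b *\<^sub>R b) \<bullet> b)))"
    unfolding F by (subst lborel_eq, subst integral_distr) auto
  also have "\<dots> = (LINT f|(\<Pi>\<^sub>M b\<in>Basis. lborel). (\<Prod>b\<in>(Basis::'a set). ?F b (f b)))"
    by (intro Bochner_Integration.integral_cong refl prod.cong) simp
  also have "\<dots> = (\<Prod>b\<in>Basis. LINT x|lborel. ?F b x)"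
    by (rule product_integral_prod)
       (auto intro!: rapid_mult_integrable gauss_rapid s character_bounded)
  also have "\<dots> = (\<Prod>b\<in>(Basis::'a set). complex_of_real (sqrt (2 * pi / s) * gauss (1 / s) (t \<bullet> b)))"
    by (simp only: gauss_fourier_real[OF s])
  also have "\<dots> = complex_of_real (sqrt (2 * pi / s) ^ DIM('a) * (\<Prod>b\<in>Basis. gauss (1 / s) (t \<bullet> b)))"
    by (simp add: prod.distrib)
  finally show ?thesis by (simp add: gauss_prod[of "1 / s" t])
qed

lemma gauss_integral:
  "(LINT x|lborel. complex_of_real (gauss 1 (x::'a::euclidean_space))) = complex_of_real (sqrt (2 * pi) ^ DIM('a))"
  using gauss_fourier[of 1 "0::'a"] by (simp add: gauss_def)

text \<open>The prefactor normalizes the Gaussian to integral 1. After the substitution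
  \<open>x = a + z / Suc n\<close> the Gaussian is fixed and only the argument of \<open>u\<close>
  depends on \<open>n\<close>, so the polynomial growth of \<open>u\<close> is dominated by one
  integrable function.\<close>

lemma gauss_approx_identity:
  fixes u :: "'a::euclidean_space \<Rightarrow> complex"
  assumes cont: "continuous_on UNIV u" and pb: "poly_bounded u"
  shows "(\<lambda>n. complex_of_real ((real (Suc n) / sqrt (2 * pi)) ^ DIM('a)) *
    (LINT x|lborel. u x * complex_of_real (gauss ((real (Suc n))\<^sup>2) (x - a)))) \<longlonglongrightarrow> u a"
proof -
  have [measurable]: "u \<in> borel_measurable borel" by (intro borel_measurable_continuous_onI cont)
  let ?v = "\<lambda>n z. u (a + (1 / real (Suc n)) *\<^sub>R z) * complex_of_real (gauss 1 z)"
  have eq: "complex_of_real ((real (Suc n) / sqrt (2 * pi)) ^ DIM('a)) *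
      (LINT x|lborel. u x * complex_of_real (gauss ((real (Suc n))\<^sup>2) (x - a)))
    = complex_of_real (1 / sqrt (2 * pi) ^ DIM('a)) * (LINT z|lborel. ?v n z)" for n
  proof -
    have "(LINT x|lborel. u x * complex_of_real (gauss ((real (Suc n))\<^sup>2) (x - a)))
      = \<bar>1 / real (Suc n)\<bar> ^ DIM('a) *\<^sub>R (LINT z|lborel. u (a + (1 / real (Suc n)) *\<^sub>R z)
         * complex_of_real (gauss ((real (Suc n))\<^sup>2) (a + (1 / real (Suc n)) *\<^sub>R z - a)))"
      by (rule integral_affine) auto
    also have "\<dots> = complex_of_real ((1 / real (Suc n)) ^ DIM('a)) * (LINT z|lborel. ?v n z)"
      by (simp only: add_diff_cancel_left' gauss_scale)
         (simp add: power_divide scaleR_conv_of_real del: of_nat_Suc)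
    finally show ?thesis by (simp add: power_divide del: of_nat_Suc)
  qed
  obtain C k where C: "\<And>x. norm (u x) \<le> C * (1 + norm x) ^ k" "C \<ge> 0" using pb by (rule poly_boundedE) blast
  have "(\<lambda>n. LINT z|lborel. ?v n z) \<longlonglongrightarrow> (LINT z|lborel. u a * complex_of_real (gauss 1 (z :: 'a)))"
  proof (rule integral_dominated_convergence)
    have "rapid (\<lambda>z::'a. complex_of_real (gauss 1 z))" by (rule gauss_rapid) simp
    then have "integrable lborel (\<lambda>z::'a. (1 + norm z) ^ k * norm (complex_of_real (gauss 1 z)))"
      unfolding rapid_def by blast
    then show "integrable lborel (\<lambda>z::'a. (C * (1 + norm a) ^ k) * ((1 + norm z) ^ k * norm (complex_of_real (gauss 1 z))))"
      by (rule integrable_mult_right)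
    have lim: "(\<lambda>n. u (a + (1 / real (Suc n)) *\<^sub>R z)) \<longlonglongrightarrow> u a" for z
    proof -
      have "(\<lambda>n. a + (1 / real (Suc n)) *\<^sub>R z) \<longlonglongrightarrow> a + 0 *\<^sub>R z"
        by (intro tendsto_intros LIMSEQ_Suc[OF lim_1_over_n])
      then have "(\<lambda>n. a + (1 / real (Suc n)) *\<^sub>R z) \<longlonglongrightarrow> a" by (simp del: of_nat_Suc)
      moreover have "isCont u a" using cont by (simp add: continuous_on_eq_continuous_at)
      ultimately show ?thesis by (rule isCont_tendsto_compose[rotated])
    qed
    show "AE z in lborel. (\<lambda>n. ?v n z) \<longlonglongrightarrow> u a * complex_of_real (gauss 1 z)"
      by (intro always_eventually allI tendsto_mult lim tendsto_const)
    fix n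
    have "norm (?v n z) \<le> (C * (1 + norm a) ^ k) * ((1 + norm z) ^ k * norm (complex_of_real (gauss 1 z)))" for z
    proof -
      have "norm (a + (1 / real (Suc n)) *\<^sub>R z) \<le> norm a + norm ((1 / real (Suc n)) *\<^sub>R z)"
        by (rule norm_triangle_ineq)
      also have "norm ((1 / real (Suc n)) *\<^sub>R z) = norm z / real (Suc n)" by simp
      also have "\<dots> \<le> norm z / 1" by (rule divide_left_mono) auto
      finally have "norm (a + (1 / real (Suc n)) *\<^sub>R z) \<le> norm a + norm z" by simp
      moreover have "0 \<le> norm a * norm z" by simp
      ultimately have 1: "1 + norm (a + (1 / real (Suc n)) *\<^sub>R z) \<le> (1 + norm a) * (1 + norm z)"
        unfolding ring_distribs by linarith
      have "norm (u (a + (1 / real (Suc n)) *\<^sub>R z)) \<le> C * ((1 + norm a) * (1 + norm z)) ^ k"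
        by (rule order_trans[OF C(1)]) (intro mult_left_mono power_mono 1 C(2), simp)
      then have "norm (?v n z) \<le> (C * ((1 + norm a) * (1 + norm z)) ^ k) * norm (complex_of_real (gauss 1 z))"
        unfolding norm_mult by (rule mult_right_mono) simp
      then show ?thesis by (simp add: power_mult_distrib mult_ac)
    qed
    then show "AE z in lborel. norm (?v n z) \<le> (C * (1 + norm a) ^ k) * ((1 + norm z) ^ k * norm (complex_of_real (gauss 1 z)))"
      by simp
  qed measurable
  also have "(LINT z|lborel. u a * complex_of_real (gauss 1 (z :: 'a))) = u a * complex_of_real (sqrt (2 * pi) ^ DIM('a))"
    by (simp only: integral_mult_right_zero gauss_integral)
  finally have "(\<lambda>n. LINT z|lborel. ?v n z) \<longlonglongrightarrow> u a * complex_of_real (sqrt (2 * pi) ^ DIM('a))" .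
  from tendsto_mult_left[OF this, of "complex_of_real (1 / sqrt (2 * pi) ^ DIM('a))"]
  show ?thesis unfolding eq by simp
qed

section \<open>The Fourier transform and its inversion\<close>

lemma fourier_constant:
  "(2 * pi) powr (- real n / 2) = 1 / sqrt (2 * pi) ^ n"
proof -
  have "(2 * pi) powr (- real n / 2) = ((2 * pi) powr (1/2)) powr (- real n)"
    by (simp add: powr_powr)
  also have "(2 * pi) powr (1/2) = sqrt (2 * pi)" by (rule powr_half_sqrt) simp
  also have "sqrt (2 * pi) powr (- real n) = inverse (sqrt (2 * pi) powr real n)" by (rule powr_minus)
  also have "sqrt (2 * pi) powr real n = sqrt (2 * pi) ^ n" by (rule powr_realpow) simp
  also have "inverse (sqrt (2 * pi) ^ n) = 1 / sqrt (2 * pi) ^ n" by (rule inverse_eq_divide)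
  finally show ?thesis .
qed

lemma fourier_eq:
  fixes \<gamma> :: "real^'d::finite \<Rightarrow> complex"
  assumes [measurable]: "\<gamma> \<in> borel_measurable borel"
  shows "fourier \<gamma> x = complex_of_real (1 / sqrt (2 * pi) ^ CARD('d)) * (LINT y|lborel. \<gamma> y * character (- x) y)"
  unfolding fourier_def fourier_constant
  by (subst integral_lebesgue_lborel) (simp_all add: character_def)

lemma fourier_modulate:
  fixes \<gamma> :: "real^'d::finite \<Rightarrow> complex"
  shows "fourier (\<lambda>y. character a y * \<gamma> y) x = fourier \<gamma> (x - a)"
proof -
  have "(character a y * \<gamma> y) * exp (- \<i> * complex_of_real (x \<bullet> y))
      = \<gamma> y * exp (- \<i> * complex_of_real ((x - a) \<bullet> y))" for y
  proof -
    have "(character a y * \<gamma> y) * exp (- \<i> * complex_of_real (x \<bullet> y))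
        = \<gamma> y * (exp (\<i> * complex_of_real (a \<bullet> y)) * exp (- \<i> * complex_of_real (x \<bullet> y)))"
      by (simp add: character_def)
    also have "exp (\<i> * complex_of_real (a \<bullet> y)) * exp (- \<i> * complex_of_real (x \<bullet> y))
        = exp (- \<i> * complex_of_real ((x - a) \<bullet> y))"
      by (subst exp_add[symmetric]) (simp add: inner_diff_left algebra_simps)
    finally show ?thesis .
  qed
  then show ?thesis unfolding fourier_def by (simp only:)
qed

lemma fourier_gauss:
  assumes s: "s > 0"
  shows "fourier (\<lambda>y::real^'d::finite. complex_of_real (gauss s y)) x
    = complex_of_real ((1 / sqrt s) ^ CARD('d) * gauss (1 / s) x)"
proof -
  have "fourier (\<lambda>y. complex_of_real (gauss s y)) x
      = complex_of_real (1 / sqrt (2 * pi) ^ CARD('d) * (sqrt (2 * pi / s) ^ CARD('d) * gauss (1 / s) (- x)))"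
    by (subst fourier_eq, measurable, subst gauss_fourier[OF s]) simp
  also have "1 / sqrt (2 * pi) ^ CARD('d) * (sqrt (2 * pi / s) ^ CARD('d) * gauss (1 / s) (- x))
      = (1 / sqrt s) ^ CARD('d) * gauss (1 / s) x"
    by (simp add: real_sqrt_divide power_divide gauss_def)
  finally show ?thesis .
qed

lemma Fourier_multiplication:
  fixes g u :: "'a::euclidean_space \<Rightarrow> complex"
  assumes g: "rapid g" and u: "rapid u"
  shows "(LINT x|lborel. g x * (LINT y|lborel. u y * character (- x) y))
    = (LINT y|lborel. u y * (LINT x|lborel. g x * character (- y) x))"
proof -
  note rapid_measurable[OF g, measurable] rapid_measurable[OF u, measurable]
  define f where "f = (\<lambda>(x, y). g x * (u y * character (- x) y))"
  have [measurable]: "f \<in> borel_measurable (lborel \<Otimes>\<^sub>M lborel)"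
    unfolding f_def character_def by measurable
  have iy: "integrable lborel (\<lambda>y. f (x, y))" for x
    unfolding f_def case_prod_conv
    by (intro integrable_mult_right rapid_mult_integrable u character_bounded) measurable
  have int: "integrable (lborel \<Otimes>\<^sub>M lborel) f"
  proof (rule lborel_pair.Fubini_integrable)
    have "(LINT y|lborel. norm (f (x, y))) = norm (g x) * (LINT y|lborel. norm (u y))" for x
      by (simp add: f_def norm_mult)
    then show "integrable lborel (\<lambda>x. LINT y|lborel. norm (f (x, y)))"
      by (simp add: rapid_integrable[OF g])
  qed (use iy in auto)
  have int': "integrable (lborel \<Otimes>\<^sub>M lborel) (\<lambda>(x, y). g x * (u y * character (- x) y))" using int unfolding f_def .
  have "(LINT y|lborel. u y * (LINT x|lborel. g x * character (- y) x))
    = (LINT y|lborel. LINT x|lborel. g x * (u y * character (- x) y))"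
  proof (rule Bochner_Integration.integral_cong[OF refl])
    fix y
    have "u y * (LINT x|lborel. g x * character (- y) x) = (LINT x|lborel. u y * (g x * character (- y) x))" by simp
    also have "\<dots> = (LINT x|lborel. g x * (u y * character (- x) y))"
      by (simp add: character_def inner_commute mult_ac)
    finally show "u y * (LINT x|lborel. g x * character (- y) x) = (LINT x|lborel. g x * (u y * character (- x) y))" .
  qed
  also have "\<dots> = (LINT x|lborel. LINT y|lborel. g x * (u y * character (- x) y))"
    by (rule lborel_pair.Fubini_integral[OF int'])
  finally show ?thesis by simp
qed

text \<open>A wide Gaussian factor is inserted, which dominated convergence removes in the limit
  because \<open>fourier u\<close> is integrable. With the factor present, the multiplication
  formula moves the transform from \<open>u\<close> to the modulated Gaussian, where it becomes an
  approximate identity at \<open>s\<close>. The constant is what remains of the normalization, since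
  the left side is an unnormalized inverse transform.\<close>

lemma Fourier_inversion:
  fixes u :: "real^'d::finite \<Rightarrow> complex"
  assumes u: "u \<in> schwartz" and fu: "fourier u \<in> schwartz"
  shows "(LINT x|lborel. fourier u x * character s x) = complex_of_real (sqrt (2 * pi) ^ CARD('d)) * u s"
proof -
  note schwartz_measurable[OF u, measurable] schwartz_measurable[OF fu, measurable]
  let ?c = "sqrt (2 * pi) ^ CARD('d)"
  let ?I = "\<lambda>n. LINT x|lborel. fourier u x * character s x * complex_of_real (gauss (1 / (real (Suc n))\<^sup>2) x)"
  have "?I \<longlonglongrightarrow> (LINT x|lborel. fourier u x * character s x)"
  proof (rule integral_dominated_convergence)
    show "integrable lborel (\<lambda>x. norm (fourier u x))"
      by (intro integrable_norm rapid_integrable schwartz_rapid fu)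
    have "(\<lambda>n. gauss (1 / (real (Suc n))\<^sup>2) x) \<longlonglongrightarrow> exp (- (0 * (norm x)\<^sup>2 / 2))" for x :: "real^'d"
      unfolding gauss_def by (intro tendsto_intros) (simp | real_asymp)+
    then have "(\<lambda>n. fourier u x * character s x * complex_of_real (gauss (1 / (real (Suc n))\<^sup>2) x))
        \<longlonglongrightarrow> fourier u x * character s x * complex_of_real (exp (- (0 * (norm x)\<^sup>2 / 2)))" for x
      by (intro tendsto_intros)
    then show "AE x in lborel. (\<lambda>n. fourier u x * character s x * complex_of_real (gauss (1 / (real (Suc n))\<^sup>2) x))
        \<longlonglongrightarrow> fourier u x * character s x" by simp
    fix n
    have "gauss (1 / (real (Suc n))\<^sup>2) x \<le> 1" for x :: "real^'d" by (simp add: gauss_def)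
    then show "AE x in lborel. norm (fourier u x * character s x * complex_of_real (gauss (1 / (real (Suc n))\<^sup>2) x))
        \<le> norm (fourier u x)"
      by (intro always_eventually allI)
         (simp add: norm_mult less_imp_le[OF gauss_pos] mult_left_le del: of_nat_Suc)
  qed measurable
  moreover have "?I n = complex_of_real ?c * (complex_of_real ((real (Suc n) / sqrt (2 * pi)) ^ DIM(real^'d)) *
    (LINT x|lborel. u x * complex_of_real (gauss ((real (Suc n))\<^sup>2) (x - s))))" for n
  proof -
    \<comment> \<open>Inverse variance \<open>?e\<close> turns into \<open>(real (Suc n))^2\<close>
      under the transform, the parameter of the approximate identity.\<close>
    let ?e = "1 / (real (Suc n))\<^sup>2"
    have e: "?e > 0" by simp
    define g where "g x = character s x * complex_of_real (gauss ?e x)" for x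
    have g: "rapid g" unfolding g_def[abs_def]
      using rapid_mult[OF gauss_rapid[OF e] character_bounded[of s]] by (simp add: mult.commute)
    note rapid_measurable[OF g, measurable]
    have inner: "(LINT x|lborel. g x * character (- y) x) = complex_of_real ((sqrt (2 * pi) * real (Suc n)) ^ CARD('d) * gauss ((real (Suc n))\<^sup>2) (y - s))" for y
    proof -
      have "(LINT x|lborel. g x * character (- y) x) = (LINT x|lborel. complex_of_real (gauss ?e x) * character (s - y) x)"
      proof -
        have "character (s - y) x = character s x * character (- y) x" for x
          using character_add_left[of s "- y" x] by simp
        then show ?thesis unfolding g_def by (simp only: mult_ac)
      qed
      also have "\<dots> = complex_of_real (sqrt (2 * pi / ?e) ^ CARD('d) * gauss (1 / ?e) (s - y))"
        by (subst gauss_fourier[OF e]) simp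
      finally show ?thesis by (simp add: real_sqrt_mult gauss_minus_commute[of _ s] del: of_nat_Suc)
    qed
    have "?I n = (LINT x|lborel. complex_of_real (1 / ?c) * (g x * (LINT y|lborel. u y * character (- x) y)))"
      by (simp add: g_def fourier_eq mult_ac)
    also have "\<dots> = complex_of_real (1 / ?c) * (LINT x|lborel. g x * (LINT y|lborel. u y * character (- x) y))"
      by (rule integral_mult_right_zero)
    also have "(LINT x|lborel. g x * (LINT y|lborel. u y * character (- x) y))
       = (LINT y|lborel. u y * (LINT x|lborel. g x * character (- y) x))"
      by (rule Fourier_multiplication[OF g schwartz_rapid[OF u]])
    also have "\<dots> = (LINT y|lborel. complex_of_real ((sqrt (2 * pi) * real (Suc n)) ^ CARD('d)) * (u y * complex_of_real (gauss ((real (Suc n))\<^sup>2) (y - s))))"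
      by (simp only: inner of_real_mult mult_ac)
    also have "\<dots> = complex_of_real ((sqrt (2 * pi) * real (Suc n)) ^ CARD('d)) * (LINT y|lborel. u y * complex_of_real (gauss ((real (Suc n))\<^sup>2) (y - s)))"
      by (rule integral_mult_right_zero)
    finally show ?thesis
      by (simp add: power_mult_distrib power_divide power2_eq_square[symmetric] real_sqrt_mult del: of_nat_Suc)
  qed
  moreover have "(\<lambda>n. complex_of_real ?c * (complex_of_real ((real (Suc n) / sqrt (2 * pi)) ^ DIM(real^'d)) *
    (LINT x|lborel. u x * complex_of_real (gauss ((real (Suc n))\<^sup>2) (x - s))))) \<longlonglongrightarrow> complex_of_real ?c * u s"
    by (intro tendsto_mult_left gauss_approx_identity schwartz_continuous schwartz_poly_bounded u)
  ultimately show ?thesis using LIMSEQ_unique by (simp only:)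
qed

section \<open>Translation-invariant operators\<close>

text \<open>Narrow Gaussians recover point values. Hence Schwartz functions can be identified by
  testing against translated Gaussians only.\<close>

lemma continuous_zero_gauss:
  fixes u :: "'a::euclidean_space \<Rightarrow> complex"
  assumes "continuous_on UNIV u" "poly_bounded u"
    and "\<And>n. (LINT x|lborel. u x * complex_of_real (gauss ((real (Suc n))\<^sup>2) (x - a))) = 0"
  shows "u a = 0"
  using gauss_approx_identity[OF assms(1,2), of a] LIMSEQ_unique[OF _ tendsto_const]
  unfolding assms(3) by fastforce

lemma schwartz_mult_integrable:
  "\<gamma> \<in> schwartz \<Longrightarrow> \<eta> \<in> schwartz \<Longrightarrow> integrable lborel (\<lambda>x. \<gamma> x * \<eta> x)"
  by (intro rapid_mult_integrable schwartz_rapid schwartz_poly_bounded schwartz_measurable)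

lemma schwartz_eqI:
  assumes u: "u \<in> schwartz" and v: "v \<in> schwartz"
    and eq: "\<And>\<eta>. \<eta> \<in> schwartz \<Longrightarrow> (LINT x|lborel. u x * \<eta> x) = (LINT x|lborel. v x * \<eta> x)"
  shows "u = v"
proof (rule ext)
  fix a
  have d: "(\<lambda>x. u x - v x) \<in> schwartz" by (intro schwartz_diff u v)
  have "u a - v a = 0"
  proof (rule continuous_zero_gauss[OF schwartz_continuous[OF d] schwartz_poly_bounded[OF d]])
    fix n
    have \<eta>: "(\<lambda>x. complex_of_real (gauss ((real (Suc n))\<^sup>2) (x - a))) \<in> schwartz" (is "?\<eta> \<in> _")
      by (rule schwartz_translate'[OF schwartz_gauss]) simp
    have "(LINT x|lborel. (u x - v x) * ?\<eta> x) = (LINT x|lborel. u x * ?\<eta> x - v x * ?\<eta> x)"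
      by (simp add: left_diff_distrib)
    also have "\<dots> = 0"
      by (subst Bochner_Integration.integral_diff) (simp_all only: schwartz_mult_integrable u v \<eta> eq[OF \<eta>] diff_self)
    finally show "(LINT x|lborel. (u x - v x) * ?\<eta> x) = 0" .
  qed
  then show "u a = v a" by simp
qed

section \<open>Operators with adjoints on Schwartz functions\<close>

locale distr_operator =
  fixes P Q :: "'d::finite distr \<Rightarrow> 'd distr"
  assumes operator: "distributional_operator P Q"
begin

lemma on_schwartz_P:
  assumes "\<gamma> \<in> schwartz"
  shows "on_schwartz P \<gamma> \<in> schwartz" and "P (distr_of \<gamma>) = distr_of (on_schwartz P \<gamma>)"
proof -
  have "\<exists>\<eta>. \<eta> \<in> schwartz \<and> P (distr_of \<gamma>) = distr_of \<eta>"
    using operator assms unfolding distributional_operator_def continuous_on_schwartz_def by blast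
  from someI_ex[OF this] show "on_schwartz P \<gamma> \<in> schwartz" "P (distr_of \<gamma>) = distr_of (on_schwartz P \<gamma>)"
    unfolding on_schwartz_def by auto
qed

lemma adjoint_P: "T \<in> tempered \<Longrightarrow> \<gamma> \<in> schwartz \<Longrightarrow> P T \<gamma> = T (on_schwartz Q \<gamma>)"
  using operator unfolding distributional_operator_def by blast

lemma tempered_P: "T \<in> tempered \<Longrightarrow> P T \<in> tempered"
  using operator unfolding distributional_operator_def distr_linear_def by blast

lemma swapped: "distr_operator Q P"
  using operator unfolding distr_operator_def distributional_operator_def by blast

lemmas on_schwartz_Q = distr_operator.on_schwartz_P[OF swapped]
lemmas adjoint_Q = distr_operator.adjoint_P[OF swapped]

lemma schwartz_tempered: "\<gamma> \<in> schwartz \<Longrightarrow> distr_of \<gamma> \<in> tempered"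
  by (intro distr_of_tempered schwartz_measurable schwartz_poly_bounded)

lemma duality:
  assumes "\<gamma> \<in> schwartz" "\<eta> \<in> schwartz"
  shows "(LINT x|lborel. on_schwartz P \<gamma> x * \<eta> x) = (LINT x|lborel. \<gamma> x * on_schwartz Q \<eta> x)"
  using adjoint_P[OF schwartz_tempered[OF assms(1)] assms(2)]
  by (simp add: on_schwartz_P on_schwartz_Q assms distr_of_eq schwartz_measurable)

lemma duality':
  assumes "\<gamma> \<in> schwartz" "\<eta> \<in> schwartz"
  shows "(LINT x|lborel. on_schwartz Q \<gamma> x * \<eta> x) = (LINT x|lborel. \<gamma> x * on_schwartz P \<eta> x)"
  using duality[OF assms(2,1)] by (simp add: mult.commute)

end

locale multiplier_operator = distr_operator +
  fixes p :: "real^'d::finite \<Rightarrow> complex"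
  assumes multiplier: "is_distr_fourier_transform p P"
begin

text \<open>The default values of \<open>fourier_distr\<close> and \<open>distr_of\<close> off the
  Schwartz space are kept as an explicit case distinction. Its users treat both branches, so
  \<open>p * \<gamma>\<close> need not be examined.\<close>

lemma multiplier_eq:
  assumes T: "f \<in> borel_measurable borel" "poly_bounded f" and \<gamma>: "\<gamma> \<in> schwartz" "fourier \<gamma> \<in> schwartz"
  shows "P (distr_of f) (fourier \<gamma>) = (if (\<lambda>x. p x * \<gamma> x) \<in> schwartz \<and> fourier (\<lambda>x. p x * \<gamma> x) \<in> schwartz
    then LINT x|lborel. f x * fourier (\<lambda>x. p x * \<gamma> x) x else 0)"
proof -
  have "fourier_distr (P (distr_of f)) \<gamma> = fourier_distr (distr_of f) (\<lambda>x. p x * \<gamma> x)"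
    using multiplier distr_of_tempered[OF T] \<gamma> unfolding is_distr_fourier_transform_def by blast
  then have "P (distr_of f) (fourier \<gamma>) = fourier_distr (distr_of f) (\<lambda>x. p x * \<gamma> x)"
    using \<gamma> by (simp add: fourier_distr_def)
  also have "\<dots> = (if (\<lambda>x. p x * \<gamma> x) \<in> schwartz \<and> fourier (\<lambda>x. p x * \<gamma> x) \<in> schwartz
    then LINT x|lborel. f x * fourier (\<lambda>x. p x * \<gamma> x) x else 0)"
    using distr_of_eq[OF _ T(1)] by (auto simp: fourier_distr_def) (simp add: distr_of_def)
  finally show ?thesis .
qed

text \<open>
  A translation of the argument becomes a modulation of the test function. If \<open>p * \<gamma>\<close> or its Fourier
  transform should fail to be a Schwartz function, then so do the modulated ones.
\<close>

lemma translation_P: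
  assumes \<phi>: "\<phi> \<in> schwartz"
  shows "on_schwartz P (\<lambda>x. \<phi> (x - v)) = (\<lambda>x. on_schwartz P \<phi> (x - v))"
proof (rule ext)
  fix a
  let ?\<psi> = "\<lambda>x. \<phi> (x - v)"
  have \<psi>: "?\<psi> \<in> schwartz" by (rule schwartz_translate'[OF \<phi>])
  let ?u = "on_schwartz P ?\<psi>" and ?w = "on_schwartz P \<phi>"
  have u: "?u \<in> schwartz" and w: "?w \<in> schwartz" by (intro on_schwartz_P \<psi> \<phi>)+
  have w': "(\<lambda>x. ?w (x - v)) \<in> schwartz" by (rule schwartz_translate'[OF w])
  have d: "(\<lambda>x. ?u x - ?w (x - v)) \<in> schwartz" by (intro schwartz_diff u w')
  have eq: "(LINT x|lborel. ?u x * fourier \<gamma> x) = (LINT x|lborel. ?w (x - v) * fourier \<gamma> x)"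
    if \<gamma>: "\<gamma> \<in> schwartz" "fourier \<gamma> \<in> schwartz" for \<gamma>
  proof -
    let ?\<gamma> = "\<lambda>y. character (- v) y * \<gamma> y" and ?p = "\<lambda>x. p x * \<gamma> x"
    have \<gamma>': "?\<gamma> \<in> schwartz" by (rule schwartz_character[OF \<gamma>(1)])
    have f\<gamma>': "fourier ?\<gamma> = (\<lambda>x. fourier \<gamma> (x + v))" by (simp add: fourier_modulate fun_eq_iff)
    have f\<gamma>'S: "fourier ?\<gamma> \<in> schwartz" unfolding f\<gamma>' by (rule schwartz_translate[OF \<gamma>(2)])
    have p\<gamma>': "(\<lambda>x. p x * ?\<gamma> x) = (\<lambda>x. character (- v) x * ?p x)" by (simp add: mult_ac)
    have fp\<gamma>': "fourier (\<lambda>x. p x * ?\<gamma> x) = (\<lambda>x. fourier ?p (x + v))"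
      unfolding p\<gamma>' by (simp add: fourier_modulate fun_eq_iff)
    have "(LINT x|lborel. ?u x * fourier \<gamma> x) = P (distr_of ?\<psi>) (fourier \<gamma>)"
      by (simp add: on_schwartz_P(2)[OF \<psi>] distr_of_eq \<gamma> schwartz_measurable u)
    also have "\<dots> = (if ?p \<in> schwartz \<and> fourier ?p \<in> schwartz
       then LINT x|lborel. ?\<psi> x * fourier ?p x else 0)"
      by (rule multiplier_eq) (intro schwartz_measurable schwartz_poly_bounded \<psi> \<gamma>)+
    also have "\<dots> = (if (\<lambda>x. p x * ?\<gamma> x) \<in> schwartz \<and> fourier (\<lambda>x. p x * ?\<gamma> x) \<in> schwartz
       then LINT x|lborel. \<phi> x * fourier (\<lambda>x. p x * ?\<gamma> x) x else 0)"
    proof -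
      have a: "(LINT x|lborel. ?\<psi> x * fourier ?p x) = (LINT x|lborel. \<phi> x * fourier ?p (x + v))" if "fourier ?p \<in> schwartz"
      proof -
        note schwartz_measurable[OF that, measurable] schwartz_measurable[OF \<phi>, measurable]
        show ?thesis using integral_translate(1)[of "\<lambda>x. ?\<psi> x * fourier ?p x" v] by simp
      qed
      have b: "(\<lambda>x. p x * ?\<gamma> x) \<in> schwartz \<longleftrightarrow> ?p \<in> schwartz"
        unfolding p\<gamma>' by (rule schwartz_character_iff)
      have c: "fourier (\<lambda>x. p x * ?\<gamma> x) \<in> schwartz \<longleftrightarrow> fourier ?p \<in> schwartz"
        unfolding fp\<gamma>' by (rule schwartz_translate_iff)
      show ?thesis unfolding b c
        by (rule if_cong[OF refl _ refl]) (simp only: fp\<gamma>', rule a, blast)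
    qed
    also have "\<dots> = P (distr_of \<phi>) (fourier ?\<gamma>)"
      by (rule multiplier_eq[symmetric]) (intro schwartz_measurable schwartz_poly_bounded \<phi> \<gamma>' f\<gamma>'S)+
    also have "\<dots> = (LINT x|lborel. ?w x * fourier \<gamma> (x + v))"
      using f\<gamma>'S unfolding f\<gamma>' by (simp add: on_schwartz_P(2)[OF \<phi>] distr_of_eq schwartz_measurable w)
    also have "\<dots> = (LINT x|lborel. ?w (x - v) * fourier \<gamma> x)"
    proof -
      note schwartz_measurable[OF w, measurable] schwartz_measurable[OF \<gamma>(2), measurable]
      show ?thesis using integral_translate(1)[of "\<lambda>x. ?w (x - v) * fourier \<gamma> x" v] by simp
    qed
    finally show ?thesis .
  qed
  have "?u a - ?w (a - v) = 0"
  proof (rule continuous_zero_gauss[OF schwartz_continuous[OF d] schwartz_poly_bounded[OF d]])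
    fix n
    \<comment> \<open>Modulated wide Gaussians are chosen because their transforms are multiples of
      the narrow Gaussians centred at \<open>a\<close>. Both are visibly Schwartz, so
      \<open>eq\<close> applies to them.\<close>
    let ?s = "1 / (real (Suc n))\<^sup>2" and ?g = "\<lambda>x. complex_of_real (gauss ((real (Suc n))\<^sup>2) (x - a))"
    let ?\<gamma> = "\<lambda>y. character a y * complex_of_real (gauss ?s y)"
    define c where "c = complex_of_real ((1 / sqrt ?s) ^ CARD('d))"
    have c: "c \<noteq> 0" by (simp add: c_def del: of_nat_Suc)
    have f\<gamma>: "fourier ?\<gamma> = (\<lambda>x. c * ?g x)"
      by (simp add: fourier_modulate fourier_gauss fun_eq_iff c_def del: of_nat_Suc)
    have g: "?g \<in> schwartz" by (rule schwartz_translate'[OF schwartz_gauss]) simp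
    have "?\<gamma> \<in> schwartz" by (rule schwartz_character[OF schwartz_gauss]) simp
    moreover have "fourier ?\<gamma> \<in> schwartz" unfolding f\<gamma> by (rule schwartz_cmult[OF g])
    ultimately have "(LINT x|lborel. ?u x * fourier ?\<gamma> x) = (LINT x|lborel. ?w (x - v) * fourier ?\<gamma> x)" by (rule eq)
    then have "c * (LINT x|lborel. ?u x * ?g x) = c * (LINT x|lborel. ?w (x - v) * ?g x)"
      unfolding f\<gamma> by (simp only: mult.left_commute[of _ c] integral_mult_right_zero)
    then have "(LINT x|lborel. ?u x * ?g x) = (LINT x|lborel. ?w (x - v) * ?g x)" using c by simp
    moreover have "(LINT x|lborel. (?u x - ?w (x - v)) * ?g x) = (LINT x|lborel. ?u x * ?g x) - (LINT x|lborel. ?w (x - v) * ?g x)"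
      unfolding left_diff_distrib by (intro Bochner_Integration.integral_diff schwartz_mult_integrable u w' g)
    ultimately show "(LINT x|lborel. (?u x - ?w (x - v)) * ?g x) = 0" by simp
  qed
  then show "?u a = ?w (a - v)" by simp
qed

end

text \<open>The adjoint comes without a multiplier of its own. Separating translation invariance
  from the multiplier allows the adjoint to be treated on the same footing, by interpreting this
  locale with \<open>P\<close> and \<open>Q\<close> exchanged.\<close>

locale translation_invariant = distr_operator +
  assumes translation_P: "\<phi> \<in> schwartz \<Longrightarrow> on_schwartz P (\<lambda>x. \<phi> (x - v)) = (\<lambda>x. on_schwartz P \<phi> (x - v))"
begin

lemma translation_Q:
  assumes \<phi>: "\<phi> \<in> schwartz"
  shows "on_schwartz Q (\<lambda>x. \<phi> (x - v)) = (\<lambda>x. on_schwartz Q \<phi> (x - v))"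
proof (rule schwartz_eqI)
  show "on_schwartz Q (\<lambda>x. \<phi> (x - v)) \<in> schwartz" "(\<lambda>x. on_schwartz Q \<phi> (x - v)) \<in> schwartz"
    by (intro on_schwartz_Q schwartz_translate' \<phi>)+
  fix \<eta> :: "real^'a \<Rightarrow> complex" assume \<eta>: "\<eta> \<in> schwartz"
  have \<eta>': "(\<lambda>x. \<eta> (x + v)) \<in> schwartz" by (rule schwartz_translate[OF \<eta>])
  have P: "on_schwartz P (\<lambda>x. \<eta> (x + v)) = (\<lambda>x. on_schwartz P \<eta> (x + v))"
    using translation_P[OF \<eta>, of "- v"] by simp
  note [measurable] = schwartz_measurable[OF \<phi>] schwartz_measurable[OF \<eta>]
    schwartz_measurable[OF on_schwartz_P(1)[OF \<eta>]] schwartz_measurable[OF on_schwartz_Q(1)[OF \<phi>]]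
  have "(LINT x|lborel. on_schwartz Q (\<lambda>x. \<phi> (x - v)) x * \<eta> x) = (LINT x|lborel. \<phi> (x - v) * on_schwartz P \<eta> x)"
    by (rule duality'[OF schwartz_translate'[OF \<phi>] \<eta>])
  also have "\<dots> = (LINT x|lborel. \<phi> x * on_schwartz P \<eta> (x + v))"
    using integral_translate(1)[of "\<lambda>x. \<phi> (x - v) * on_schwartz P \<eta> x" v] by simp
  also have "\<dots> = (LINT x|lborel. on_schwartz Q \<phi> x * \<eta> (x + v))"
    using duality'[OF \<phi> \<eta>'] by (simp add: P)
  also have "\<dots> = (LINT x|lborel. on_schwartz Q \<phi> (x - v) * \<eta> x)"
    using integral_translate(1)[of "\<lambda>x. on_schwartz Q \<phi> (x - v) * \<eta> x" v] by simp
  finally show "(LINT x|lborel. on_schwartz Q (\<lambda>x. \<phi> (x - v)) x * \<eta> x) = (LINT x|lborel. on_schwartz Q \<phi> (x - v) * \<eta> x)" .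
qed

text \<open>A convolution is a superposition of translates. In weak form, duality moves
  \<open>P\<close> past the integral to the test function and back onto each translate.\<close>

lemma conv_P:
  assumes g: "rapid g" and \<phi>: "\<phi> \<in> schwartz"
  shows "on_schwartz P (conv g \<phi>) = conv g (on_schwartz P \<phi>)"
proof (rule schwartz_eqI)
  have c: "conv g \<phi> \<in> schwartz" by (rule schwartz_conv[OF g \<phi>])
  show "on_schwartz P (conv g \<phi>) \<in> schwartz" by (rule on_schwartz_P(1)[OF c])
  show "conv g (on_schwartz P \<phi>) \<in> schwartz" by (intro schwartz_conv g on_schwartz_P \<phi>)
  fix \<eta> :: "real^'a \<Rightarrow> complex" assume \<eta>: "\<eta> \<in> schwartz"
  note S = schwartz_rapid schwartz_poly_bounded schwartz_measurable on_schwartz_P(1) on_schwartz_Q(1)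
  have "(LINT x|lborel. on_schwartz P (conv g \<phi>) x * \<eta> x) = (LINT x|lborel. conv g \<phi> x * on_schwartz Q \<eta> x)"
    by (rule duality[OF c \<eta>])
  also have "\<dots> = (LINT y|lborel. g y * (LINT x|lborel. \<phi> (x - y) * on_schwartz Q \<eta> x))"
    by (rule conv_Fubini) (intro g S \<phi> \<eta>)+
  also have "\<dots> = (LINT y|lborel. g y * (LINT x|lborel. on_schwartz P \<phi> (x - y) * \<eta> x))"
    by (simp only: duality[OF schwartz_translate'[OF \<phi>] \<eta>, symmetric] translation_P[OF \<phi>])
  also have "\<dots> = (LINT x|lborel. conv g (on_schwartz P \<phi>) x * \<eta> x)"
    by (rule conv_Fubini[symmetric]) (intro g S \<phi> \<eta>)+
  finally show "(LINT x|lborel. on_schwartz P (conv g \<phi>) x * \<eta> x) = (LINT x|lborel. conv g (on_schwartz P \<phi>) x * \<eta> x)" .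
qed

text \<open>The adjoint of a translation-invariant operator is its conjugate by reflection.
  Convolution is commutative and \<open>P\<close> may act on either factor, so
  \<open>conv \<phi> (P \<eta>)\<close> and \<open>conv \<eta> (P \<phi>)\<close> agree; their
  values at 0 are the two pairings to be compared.\<close>

lemma reflection_Q:
  assumes \<phi>: "\<phi> \<in> schwartz"
  shows "on_schwartz Q (\<lambda>x. \<phi> (v - x)) = (\<lambda>x. on_schwartz P \<phi> (v - x))"
proof -
  have "on_schwartz Q (\<lambda>x. \<phi> (0 - x)) = (\<lambda>x. on_schwartz P \<phi> (0 - x))"
  proof (rule schwartz_eqI)
    have r: "(\<lambda>x. \<phi> (0 - x)) \<in> schwartz" by (rule schwartz_reflect[OF \<phi>])
    show "on_schwartz Q (\<lambda>x. \<phi> (0 - x)) \<in> schwartz" by (rule on_schwartz_Q(1)[OF r])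
    show "(\<lambda>x. on_schwartz P \<phi> (0 - x)) \<in> schwartz" by (intro schwartz_reflect on_schwartz_P \<phi>)
    fix \<eta> :: "real^'a \<Rightarrow> complex" assume \<eta>: "\<eta> \<in> schwartz"
    have "(LINT x|lborel. on_schwartz Q (\<lambda>x. \<phi> (0 - x)) x * \<eta> x) = (LINT x|lborel. \<phi> (0 - x) * on_schwartz P \<eta> x)"
      by (rule duality'[OF r \<eta>])
    also have "\<dots> = conv (on_schwartz P \<eta>) \<phi> 0" by (simp add: conv_def mult.commute)
    also have "\<dots> = conv \<phi> (on_schwartz P \<eta>) 0"
      by (intro conv_commute schwartz_measurable on_schwartz_P \<phi> \<eta>)
    also have "\<dots> = on_schwartz P (conv \<phi> \<eta>) 0" by (subst conv_P) (auto intro: schwartz_rapid \<phi> \<eta>)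
    also have "conv \<phi> \<eta> = conv \<eta> \<phi>" by (intro ext conv_commute schwartz_measurable \<phi> \<eta>)
    also have "on_schwartz P (conv \<eta> \<phi>) 0 = conv \<eta> (on_schwartz P \<phi>) 0"
      by (subst conv_P) (auto intro: schwartz_rapid \<phi> \<eta>)
    also have "\<dots> = (LINT x|lborel. on_schwartz P \<phi> (0 - x) * \<eta> x)" by (simp add: conv_def mult.commute)
    finally show "(LINT x|lborel. on_schwartz Q (\<lambda>x. \<phi> (0 - x)) x * \<eta> x) = (LINT x|lborel. on_schwartz P \<phi> (0 - x) * \<eta> x)" .
  qed
  from translation_Q[OF schwartz_reflect[OF \<phi>, of 0], of v] this show ?thesis by (simp add: fun_eq_iff)
qed

text \<open>The adjoint acts on the reflected translate of \<phi>, where \<open>reflection_Q\<close>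
  turns it into \<open>P\<close>. This is the passage from \<open>P\<close> acting on \<phi> to
  \<open>P\<close> acting on \<open>f\<close> as a distribution, for which no decay of
  \<open>f\<close> is required.\<close>

lemma conv_distr:
  assumes f: "f \<in> borel_measurable borel" "poly_bounded f"
    and h: "h \<in> borel_measurable borel" and eq: "P (distr_of f) = distr_of h" and \<phi>: "\<phi> \<in> schwartz"
  shows "conv f (on_schwartz P \<phi>) x = conv h \<phi> x"
proof -
  have r: "(\<lambda>y. \<phi> (x - y)) \<in> schwartz" by (rule schwartz_reflect[OF \<phi>])
  have "conv f (on_schwartz P \<phi>) x = distr_of f (on_schwartz Q (\<lambda>y. \<phi> (x - y)))"
    using on_schwartz_Q(1)[OF r] by (simp add: distr_of_eq f reflection_Q[OF \<phi>] conv_def)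
  also have "\<dots> = P (distr_of f) (\<lambda>y. \<phi> (x - y))"
    by (rule adjoint_P[symmetric]) (intro distr_of_tempered f r)+
  also have "\<dots> = conv h \<phi> x" by (simp add: eq distr_of_eq[OF r h] conv_def)
  finally show ?thesis .
qed

end

sublocale multiplier_operator \<subseteq> translation_invariant
  by unfold_locales (rule translation_P)

section \<open>Vanishing moments\<close>

text \<open>An iterated first difference, with step \<open>t\<close>, of the characters as functions
  of the frequency. Divided by \<open>(\<i> t) ^ length is\<close> it tends to the monomial
  \<open>\<Prod>i\<leftarrow>is. x $ i\<close> as \<open>t\<close> tends to 0.\<close>

definition diff_product :: "real \<Rightarrow> 'd list \<Rightarrow> real^'d::finite \<Rightarrow> complex" where
  "diff_product t is x = (\<Prod>i\<leftarrow>is. character (t *\<^sub>R axis i 1) x - 1)"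

lemma diff_product_Cons:
  "diff_product t (i # is) x = (character (t *\<^sub>R axis i 1) x - 1) * diff_product t is x"
  by (simp add: diff_product_def)

lemma diff_product_measurable [measurable]: "diff_product t is \<in> borel_measurable borel"
proof (induction "is")
  case (Cons i "is")
  note Cons[measurable]
  show ?case unfolding diff_product_Cons[abs_def] by measurable
qed (simp add: diff_product_def[abs_def])

lemma diff_product_bounded: "poly_bounded (diff_product t is)"
proof -
  have "norm (diff_product t is x) \<le> 2 ^ length is" for x
  proof (induction "is")
    case (Cons i "is")
    have "norm (character (t *\<^sub>R axis i 1) x - 1) \<le> norm (character (t *\<^sub>R axis i 1) x) + norm (1::complex)"
      by (rule norm_triangle_ineq4)
    then have "norm (character (t *\<^sub>R axis i 1) x - 1) \<le> 2" by simp
    from mult_mono[OF this Cons] show ?case by (simp add: diff_product_Cons norm_mult)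
  qed (simp add: diff_product_def)
  then show ?thesis by (rule poly_bounded_bounded)
qed

text \<open>Expanding the product gives \<open>2 ^ length is\<close> integrals against characters
  with frequencies of norm at most \<open>norm s + length is * t\<close>. The frequency
  \<open>s\<close> is general because each factor shifts it by \<open>t\<close> along an
  axis.\<close>

lemma diff_product_integral_bound:
  fixes w :: "real^'d::finite \<Rightarrow> complex"
  assumes w: "rapid w" and t: "t \<ge> 0"
    and bound: "\<And>s. norm s \<le> \<rho> \<Longrightarrow> norm (LINT x|lborel. w x * character s x) \<le> C * norm s ^ m"
    and C: "C \<ge> 0"
  shows "norm s + real (length is) * t \<le> \<rho> \<Longrightarrow>
    norm (LINT x|lborel. w x * (character s x * diff_product t is x)) \<le> 2 ^ length is * (C * (norm s + real (length is) * t) ^ m)"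
proof (induction "is" arbitrary: s)
  case Nil
  then show ?case using bound[of s] by (simp add: diff_product_def)
next
  case (Cons i "is")
  let ?s = "s + t *\<^sub>R axis i 1"
  have "norm ?s \<le> norm s + t"
    using norm_triangle_ineq[of s "t *\<^sub>R axis i 1"] t by simp
  then have ns: "norm ?s + real (length is) * t \<le> norm s + real (length (i # is)) * t"
    by (simp add: algebra_simps)
  have int: "integrable lborel (\<lambda>x. w x * (character s x * diff_product t is x))" for s
    by (intro rapid_mult_integrable w poly_bounded_mult character_bounded diff_product_bounded) measurable
  have "w x * (character s x * diff_product t (i # is) x)
    = w x * (character ?s x * diff_product t is x) - w x * (character s x * diff_product t is x)" for x
    by (simp add: diff_product_Cons character_add_left algebra_simps)
  then have "(LINT x|lborel. w x * (character s x * diff_product t (i # is) x))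
    = (LINT x|lborel. w x * (character ?s x * diff_product t is x)) - (LINT x|lborel. w x * (character s x * diff_product t is x))"
    by (simp add: int)
  then have "norm (LINT x|lborel. w x * (character s x * diff_product t (i # is) x))
    \<le> norm (LINT x|lborel. w x * (character ?s x * diff_product t is x)) + norm (LINT x|lborel. w x * (character s x * diff_product t is x))"
    by (simp add: norm_triangle_ineq4)
  also have "\<dots> \<le> 2 ^ length is * (C * (norm ?s + real (length is) * t) ^ m) + 2 ^ length is * (C * (norm s + real (length is) * t) ^ m)"
    using ns Cons.prems t by (intro add_mono Cons.IH) (auto simp: algebra_simps)
  also have "\<dots> \<le> 2 ^ length is * (C * (norm s + real (length (i # is)) * t) ^ m) + 2 ^ length is * (C * (norm s + real (length (i # is)) * t) ^ m)"
  proof (rule add_mono)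
    show "2 ^ length is * (C * (norm ?s + real (length is) * t) ^ m) \<le> 2 ^ length is * (C * (norm s + real (length (i # is)) * t) ^ m)"
      using ns t C by (intro mult_left_mono power_mono) auto
    have "norm s + real (length is) * t \<le> norm s + real (length (i # is)) * t"
      using t by (simp add: algebra_simps)
    then show "2 ^ length is * (C * (norm s + real (length is) * t) ^ m) \<le> 2 ^ length is * (C * (norm s + real (length (i # is)) * t) ^ m)"
      using t C by (intro mult_left_mono power_mono) auto
  qed
  finally show ?case by (simp add: mult_ac)
qed

lemma exp_difference_quotient:
  fixes y t :: real
  assumes "t > 0"
  shows "norm ((exp (\<i> * complex_of_real (t * y)) - 1) / (\<i> * complex_of_real t)) \<le> \<bar>y\<bar>"
    and "norm ((exp (\<i> * complex_of_real (t * y)) - 1) / (\<i> * complex_of_real t) - complex_of_real y) \<le> t * y\<^sup>2 / 2"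
proof -
  have "norm (exp (\<i> * complex_of_real (t * y)) - 1) \<le> \<bar>t * y\<bar>"
    using iexp_approx1[of "t * y" 0] by simp
  then show "norm ((exp (\<i> * complex_of_real (t * y)) - 1) / (\<i> * complex_of_real t)) \<le> \<bar>y\<bar>"
    using assms by (simp add: norm_divide norm_mult abs_mult field_simps)
  have "norm (exp (\<i> * complex_of_real (t * y)) - 1 - \<i> * complex_of_real (t * y)) \<le> (t * y)\<^sup>2 / 2"
    using iexp_approx1[of "t * y" 1] by (simp add: numeral_2_eq_2 algebra_simps)
  moreover have "(exp (\<i> * complex_of_real (t * y)) - 1) / (\<i> * complex_of_real t) - complex_of_real y
     = (exp (\<i> * complex_of_real (t * y)) - 1 - \<i> * complex_of_real (t * y)) / (\<i> * complex_of_real t)"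
    using assms by (simp add: field_simps)
  ultimately show "norm ((exp (\<i> * complex_of_real (t * y)) - 1) / (\<i> * complex_of_real t) - complex_of_real y) \<le> t * y\<^sup>2 / 2"
    using assms by (simp add: norm_divide norm_mult field_simps power2_eq_square)
qed

lemma character_axis: "character (t *\<^sub>R axis i 1) x = exp (\<i> * complex_of_real (t * (x $ i)))"
  by (simp add: character_def cart_eq_inner_axis inner_commute)

lemma diff_product_quotient:
  fixes x :: "real^'d::finite"
  shows "t > 0 \<Longrightarrow> norm (diff_product t is x / (\<i> * complex_of_real t) ^ length is) \<le> (1 + norm x) ^ length is"
    and "(\<lambda>n. diff_product (1 / real (Suc n)) is x / (\<i> * complex_of_real (1 / real (Suc n))) ^ length is)
       \<longlonglongrightarrow> complex_of_real (\<Prod>i\<leftarrow>is. x $ i)"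
proof -
  have split: "diff_product t (i # is) x / (\<i> * complex_of_real t) ^ length (i # is)
    = ((exp (\<i> * complex_of_real (t * (x $ i))) - 1) / (\<i> * complex_of_real t))
      * (diff_product t is x / (\<i> * complex_of_real t) ^ length is)" for t i "is"
    by (simp add: diff_product_Cons character_axis)
  show "t > 0 \<Longrightarrow> norm (diff_product t is x / (\<i> * complex_of_real t) ^ length is) \<le> (1 + norm x) ^ length is"
  proof (induction "is")
    case (Cons i "is")
    have "\<bar>x $ i\<bar> \<le> 1 + norm x" using component_le_norm_cart[of x i] by linarith
    then have "norm ((exp (\<i> * complex_of_real (t * (x $ i))) - 1) / (\<i> * complex_of_real t)) \<le> 1 + norm x"
      using exp_difference_quotient(1)[OF Cons.prems, of "x $ i"] by linarith
    from mult_mono[OF this Cons.IH[OF Cons.prems]] show ?case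
      unfolding split norm_mult by simp
  qed (simp add: diff_product_def)
  show "(\<lambda>n. diff_product (1 / real (Suc n)) is x / (\<i> * complex_of_real (1 / real (Suc n))) ^ length is)
       \<longlonglongrightarrow> complex_of_real (\<Prod>i\<leftarrow>is. x $ i)"
  proof (induction "is")
    case (Cons i "is")
    let ?q = "\<lambda>n. (exp (\<i> * complex_of_real (1 / real (Suc n) * (x $ i))) - 1) / (\<i> * complex_of_real (1 / real (Suc n)))"
    have "(\<lambda>n. ?q n - complex_of_real (x $ i)) \<longlonglongrightarrow> 0"
    proof (rule Lim_null_comparison)
      show "\<forall>\<^sub>F n in sequentially. norm (?q n - complex_of_real (x $ i)) \<le> 1 / real (Suc n) * (x $ i)\<^sup>2 / 2"
        by (intro always_eventually allI exp_difference_quotient(2)) simp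
      show "(\<lambda>n. 1 / real (Suc n) * (x $ i)\<^sup>2 / 2) \<longlonglongrightarrow> 0"
        using tendsto_mult_right[OF LIMSEQ_Suc[OF lim_1_over_n], of "(x $ i)\<^sup>2 / 2"] by simp
    qed
    then have "?q \<longlonglongrightarrow> complex_of_real (x $ i)" by (simp only: LIM_zero_iff)
    from tendsto_mult[OF this Cons] show ?case unfolding split by simp
  qed (simp add: diff_product_def)
qed

text \<open>The moment is the limit of difference quotients of order \<open>k = length is\<close>.
  The differences are of size \<open>t ^ m\<close>, so the quotients are of size
  \<open>t ^ (m - k)\<close> and vanish in the limit since \<open>k < m\<close>.\<close>

lemma moments_vanish_list:
  fixes w :: "real^'d::finite \<Rightarrow> complex"
  assumes w: "rapid w" and \<rho>: "\<rho> > 0"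
    and bound: "\<And>s. norm s \<le> \<rho> \<Longrightarrow> norm (LINT x|lborel. w x * character s x) \<le> C * norm s ^ m"
    and len: "length is < m"
  shows "(LINT x|lborel. w x * complex_of_real (\<Prod>i\<leftarrow>is. x $ i)) = 0"
proof -
  note rapid_measurable[OF w, measurable]
  let ?k = "length is"
  define D where "D = \<bar>C\<bar>"
  have bound': "norm (LINT x|lborel. w x * character s x) \<le> D * norm s ^ m" if "norm s \<le> \<rho>" for s
    by (rule order_trans[OF bound[OF that]]) (auto simp: D_def intro!: mult_right_mono)
  let ?t = "\<lambda>n. 1 / real (Suc n)"
  let ?I = "\<lambda>n. LINT x|lborel. w x * (diff_product (?t n) is x / (\<i> * complex_of_real (?t n)) ^ ?k)"
  have prod_meas [measurable]: "(\<lambda>x::real^'d. \<Prod>i\<leftarrow>is. x $ i) \<in> borel_measurable borel" for "is"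
    by (induction "is") auto
  have lim: "?I \<longlonglongrightarrow> (LINT x|lborel. w x * complex_of_real (\<Prod>i\<leftarrow>is. x $ i))"
  proof (rule integral_dominated_convergence)
    show "integrable lborel (\<lambda>x. (1 + norm x) ^ ?k * norm (w x))" using w by (simp add: rapid_def)
    show "AE x in lborel. (\<lambda>n. w x * (diff_product (?t n) is x / (\<i> * complex_of_real (?t n)) ^ ?k))
        \<longlonglongrightarrow> w x * complex_of_real (\<Prod>i\<leftarrow>is. x $ i)"
      by (intro always_eventually allI tendsto_mult_left diff_product_quotient)
    fix n
    have "norm (w x * (diff_product (?t n) is x / (\<i> * complex_of_real (?t n)) ^ ?k)) \<le> norm (w x) * (1 + norm x) ^ ?k" for x
      unfolding norm_mult by (intro mult_left_mono diff_product_quotient(1)) auto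
    then show "AE x in lborel. norm (w x * (diff_product (?t n) is x / (\<i> * complex_of_real (?t n)) ^ ?k))
        \<le> (1 + norm x) ^ ?k * norm (w x)"
      by (simp add: mult.commute)
  qed measurable
  define K where "K = 2 ^ ?k * (D * real ?k ^ m)"
  have "?I \<longlonglongrightarrow> 0"
  proof (rule Lim_null_comparison)
    show "(\<lambda>n. K * ?t n) \<longlonglongrightarrow> 0"
      using tendsto_mult_left[OF LIMSEQ_Suc[OF lim_1_over_n], of K] by simp
    have "(\<lambda>n. real ?k * ?t n) \<longlonglongrightarrow> 0"
      using tendsto_mult_left[OF LIMSEQ_Suc[OF lim_1_over_n], of "real ?k"] by simp
    \<comment> \<open>All shifted frequencies must stay in the ball of radius \<rho>, so the
      estimate holds only for large \<open>n\<close>.\<close>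
    then have "\<forall>\<^sub>F n in sequentially. real ?k * ?t n < \<rho>" by (rule order_tendstoD(2)) (rule \<rho>)
    then show "\<forall>\<^sub>F n in sequentially. norm (?I n) \<le> K * ?t n"
    proof eventually_elim
      case (elim n)
      have t: "0 < ?t n" "?t n \<le> 1" by auto
      have "?I n = (LINT x|lborel. (w x * (character 0 x * diff_product (?t n) is x)) / (\<i> * complex_of_real (?t n)) ^ ?k)"
        by simp
      also have "\<dots> = (LINT x|lborel. w x * (character 0 x * diff_product (?t n) is x)) / (\<i> * complex_of_real (?t n)) ^ ?k"
        by (rule integral_divide_zero)
      finally have "norm (?I n) = norm (LINT x|lborel. w x * (character 0 x * diff_product (?t n) is x)) / ?t n ^ ?k"
      proof -
        have "norm (\<i> * complex_of_real (?t n)) = ?t n" using t by (simp only: norm_mult norm_of_real norm_ii)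
        then show "norm (?I n) = norm (LINT x|lborel. w x * (character 0 x * diff_product (?t n) is x)) / ?t n ^ ?k"
          if "?I n = (LINT x|lborel. w x * (character 0 x * diff_product (?t n) is x)) / (\<i> * complex_of_real (?t n)) ^ ?k"
          unfolding that by (simp only: norm_divide norm_power)
      qed
      also have "\<dots> \<le> (2 ^ ?k * (D * (norm (0::real^'d) + real ?k * ?t n) ^ m)) / ?t n ^ ?k"
        by (intro divide_right_mono diff_product_integral_bound[OF w _ bound']) (use elim in \<open>auto simp: D_def\<close>)
      also have "\<dots> = K * (?t n ^ m / ?t n ^ ?k)" by (simp add: K_def power_divide del: of_nat_Suc)
      also have "?t n ^ m / ?t n ^ ?k = ?t n ^ (m - ?k)"
        using t len by (subst power_diff) (auto simp del: of_nat_Suc)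
      \<comment> \<open>At least one power of the step remains, by \<open>k < m\<close>.\<close>
      also have "K * ?t n ^ (m - ?k) \<le> K * ?t n ^ 1"
        using t len by (intro mult_left_mono power_decreasing) (auto simp: K_def D_def)
      finally show ?case by simp
    qed
  qed
  with lim show ?thesis using LIMSEQ_unique by blast
qed

lemma monomial_list:
  fixes \<alpha> :: "'d::finite \<Rightarrow> nat"
  shows "\<exists>is. length is = sum \<alpha> UNIV \<and> (\<forall>x::real^'d. (\<Prod>i\<leftarrow>is. x $ i) = (\<Prod>i\<in>UNIV. (x $ i) ^ \<alpha> i))"
proof -
  have "\<exists>is. length is = sum \<alpha> I \<and> (\<forall>x::real^'d. (\<Prod>i\<leftarrow>is. x $ i) = (\<Prod>i\<in>I. (x $ i) ^ \<alpha> i))"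
    if "finite I" for I
    using that
  proof (induction I rule: finite_induct)
    case (insert i I)
    then obtain "is" where *: "length is = sum \<alpha> I" "\<And>x::real^'d. (\<Prod>i\<leftarrow>is. x $ i) = (\<Prod>i\<in>I. (x $ i) ^ \<alpha> i)"
      by blast
    show ?case
      by (rule exI[of _ "replicate (\<alpha> i) i @ is"])
         (simp add: insert.hyps *)
  next
    case empty
    then show ?case by (intro exI[of _ "[]"]) simp
  qed
  from this[OF finite] show ?thesis .
qed

lemma monomial_polynomial:
  "real_polynomial_function (\<lambda>x::real^'d::finite. \<Prod>i\<in>UNIV. (x $ i) ^ \<alpha> i)"
  by (intro real_polynomial_function_prod real_polynomial_function_power
      real_polynomial_function.intros(1) bounded_linear_vec_nth finite)

lemma poly_space_continuous_bounded:
  fixes q :: "real^'d::finite \<Rightarrow> real"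
  assumes "q \<in> poly_space m"
  shows "continuous_on UNIV q" and "poly_bounded q"
proof -
  obtain a where q: "q = (\<lambda>x. \<Sum>\<alpha>\<in>multi_indices m. a \<alpha> * (\<Prod>i\<in>UNIV. (x $ i) ^ \<alpha> i))"
    using assms by (auto simp: poly_space_def)
  show "continuous_on UNIV q" unfolding q by (intro continuous_intros)
  have "real_polynomial_function q"
    unfolding q
    by (intro real_polynomial_function_sum finite_multi_indices monomial_polynomial
        real_polynomial_function.intros(4)[OF real_polynomial_function.intros(2)])
  from polynomial_growth[OF this] show "poly_bounded q" by (auto simp: poly_bounded_def)
qed

lemma moments_vanish:
  fixes w :: "real^'d::finite \<Rightarrow> complex"
  assumes w: "rapid w" and \<rho>: "\<rho> > 0"
    and bound: "\<And>s. norm s \<le> \<rho> \<Longrightarrow> norm (LINT x|lborel. w x * character s x) \<le> C * norm s ^ m"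
    and q: "q \<in> poly_space m"
  shows "(LINT x|lborel. w x * complex_of_real (q x)) = 0"
proof -
  obtain a where q: "q = (\<lambda>x. \<Sum>\<alpha>\<in>multi_indices m. a \<alpha> * (\<Prod>i\<in>UNIV. (x $ i) ^ \<alpha> i))"
    using q by (auto simp: poly_space_def)
  have mono: "(LINT x|lborel. w x * complex_of_real (\<Prod>i\<in>UNIV. (x $ i) ^ \<alpha> i)) = 0"
    if \<alpha>: "\<alpha> \<in> multi_indices m" for \<alpha>
  proof -
    obtain "is" where "is": "length is = sum \<alpha> UNIV" "\<And>x::real^'d. (\<Prod>i\<leftarrow>is. x $ i) = (\<Prod>i\<in>UNIV. (x $ i) ^ \<alpha> i)"
      using monomial_list by blast
    from \<alpha> "is"(1) have "length is < m" by (simp add: multi_indices_def)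
    from moments_vanish_list[OF w \<rho> bound this] show ?thesis by (simp only: "is"(2))
  qed
  have int: "integrable lborel (\<lambda>x. w x * complex_of_real (\<Prod>i\<in>UNIV. (x $ i) ^ \<alpha> i))" for \<alpha>
  proof (rule rapid_mult_integrable[OF w])
    from polynomial_growth[OF monomial_polynomial] show "poly_bounded (\<lambda>x::real^'d. complex_of_real (\<Prod>i\<in>UNIV. (x $ i) ^ \<alpha> i))"
      by (simp only: poly_bounded_of_real) (simp add: poly_bounded_def)
  qed measurable
  have "(LINT x|lborel. w x * complex_of_real (q x))
    = (LINT x|lborel. (\<Sum>\<alpha>\<in>multi_indices m. complex_of_real (a \<alpha>) * (w x * complex_of_real (\<Prod>i\<in>UNIV. (x $ i) ^ \<alpha> i))))"
    by (simp add: q sum_distrib_left mult.left_commute)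
  also have "\<dots> = (\<Sum>\<alpha>\<in>multi_indices m. complex_of_real (a \<alpha>) * (LINT x|lborel. w x * complex_of_real (\<Prod>i\<in>UNIV. (x $ i) ^ \<alpha> i)))"
    by (subst Bochner_Integration.integral_sum) (auto intro!: integrable_mult_right int simp del: of_real_prod)
  also have "\<dots> = 0" by (intro sum.neutral ballI) (simp only: mono mult_zero_right)
  finally show ?thesis .
qed

context multiplier_operator
begin

text \<open>Formally \<open>P\<close> multiplies \<open>character s\<close> by \<open>p s\<close>,
  so the left integral would be \<open>p s\<close> times the same integral of \<gamma>. For the
  standard Gaussian, its own transform, inversion proves this, or else the default value 0 does no
  harm to an upper bound. Convolution with the Gaussian transfers the bound to \<gamma>.\<close>

lemma Q_character_bound:
  assumes \<gamma>: "\<gamma> \<in> schwartz" and s: "norm s \<le> 1"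
  shows "norm (LINT x|lborel. on_schwartz Q \<gamma> x * character s x)
    \<le> (LINT x|lborel. norm (\<gamma> x)) * exp (1/2) * norm (p s)"
proof -
  let ?c = "sqrt (2 * pi) ^ CARD('d)"
  let ?g = "\<lambda>x::real^'d. complex_of_real (gauss 1 x)"
  have g: "?g \<in> schwartz" by (rule schwartz_gauss) simp
  have fg: "fourier ?g = ?g" by (simp add: fourier_gauss fun_eq_iff)
  note S = schwartz_rapid schwartz_poly_bounded schwartz_measurable on_schwartz_Q(1)
  interpret Q: translation_invariant Q P
    by (intro translation_invariant.intro translation_invariant_axioms.intro swapped translation_Q)
  \<comment> \<open>The character is itself the tempered distribution to which \<open>P\<close> is
    applied.\<close>
  have "(LINT x|lborel. on_schwartz Q ?g x * character s x) = P (distr_of (character s)) (fourier ?g)"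
    unfolding fg
    by (subst adjoint_P[OF distr_of_tempered g])
       (auto simp: distr_of_eq on_schwartz_Q(1)[OF g] mult.commute intro: character_bounded)
  also have "\<dots> = (if (\<lambda>x. p x * ?g x) \<in> schwartz \<and> fourier (\<lambda>x. p x * ?g x) \<in> schwartz
    then LINT x|lborel. character s x * fourier (\<lambda>x. p x * ?g x) x else 0)"
    by (rule multiplier_eq) (auto intro: character_bounded g simp: fg)
  also have "norm \<dots> \<le> ?c * norm (p s)"
  proof (cases "(\<lambda>x. p x * ?g x) \<in> schwartz \<and> fourier (\<lambda>x. p x * ?g x) \<in> schwartz")
    case True
    have "(LINT x|lborel. character s x * fourier (\<lambda>x. p x * ?g x) x) = complex_of_real ?c * (p s * ?g s)"
      using Fourier_inversion[of "\<lambda>x. p x * ?g x" s] True by (simp add: mult.commute)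
    moreover have "norm (p s * ?g s) \<le> norm (p s) * 1"
      unfolding norm_mult by (intro mult_left_mono) (auto simp: gauss_def)
    moreover have "norm (complex_of_real ?c * z) = ?c * norm z" for z
      unfolding norm_mult norm_of_real by simp
    moreover have "0 \<le> ?c" by simp
    ultimately show ?thesis using True by (simp only: if_True simp_thms mult_left_mono mult_1_right)
  qed auto
  finally have Fg: "norm (LINT x|lborel. on_schwartz Q ?g x * character s x) \<le> ?c * norm (p s)" .
  \<comment> \<open>Both sides are \<open>Q\<close> applied to the convolution of \<gamma> with the
    Gaussian. Integrated against a character this becomes an identity of products, to be divided by
    the nonzero transform of the Gaussian.\<close>
  have "conv ?g (on_schwartz Q \<gamma>) = on_schwartz Q (conv ?g \<gamma>)"
    by (rule Q.conv_P[symmetric]) (intro S g \<gamma>)+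
  also have "conv ?g \<gamma> = conv \<gamma> ?g" by (intro ext conv_commute S g \<gamma>)
  also have "on_schwartz Q (conv \<gamma> ?g) = conv \<gamma> (on_schwartz Q ?g)"
    by (rule Q.conv_P) (intro S g \<gamma>)+
  finally have "(LINT x|lborel. ?g x * character s x) * (LINT x|lborel. on_schwartz Q \<gamma> x * character s x)
    = (LINT x|lborel. \<gamma> x * character s x) * (LINT x|lborel. on_schwartz Q ?g x * character s x)"
    using conv_character[OF schwartz_rapid[OF g] schwartz_rapid[OF on_schwartz_Q(1)[OF \<gamma>]], of s]
      conv_character[OF schwartz_rapid[OF \<gamma>] schwartz_rapid[OF on_schwartz_Q(1)[OF g]], of s] by simp
  then have "norm (LINT x|lborel. ?g x * character s x) * norm (LINT x|lborel. on_schwartz Q \<gamma> x * character s x)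
    = norm (LINT x|lborel. \<gamma> x * character s x) * norm (LINT x|lborel. on_schwartz Q ?g x * character s x)"
    by (simp only: norm_mult[symmetric])
  also have "\<dots> \<le> (LINT x|lborel. norm (\<gamma> x)) * (?c * norm (p s))"
  proof (intro mult_mono Fg)
    show "norm (LINT x|lborel. \<gamma> x * character s x) \<le> (LINT x|lborel. norm (\<gamma> x))"
      by (rule order_trans[OF integral_norm_bound]) (simp add: norm_mult)
  qed (auto intro!: Bochner_Integration.integral_nonneg)
  also have "norm (LINT x|lborel. ?g x * character s x) = ?c * gauss 1 s"
    by (subst gauss_fourier) (simp_all add: norm_mult less_imp_le[OF gauss_pos] norm_power)
  finally have main: "?c * (gauss 1 s * norm (LINT x|lborel. on_schwartz Q \<gamma> x * character s x))
    \<le> ?c * ((LINT x|lborel. norm (\<gamma> x)) * norm (p s))" by (simp add: mult_ac)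
  have "0 < ?c" by simp
  with main have "gauss 1 s * norm (LINT x|lborel. on_schwartz Q \<gamma> x * character s x) \<le> (LINT x|lborel. norm (\<gamma> x)) * norm (p s)"
    by (simp only: mult_le_cancel_left_pos)
  \<comment> \<open>The restriction \<open>norm s \<le> 1\<close> enters here: it bounds the divisor
    from below and produces the factor \<open>exp (1/2)\<close>.\<close>
  moreover have "exp (- 1/2) \<le> gauss 1 s"
    using s by (simp add: gauss_def power_le_one)
  then have "exp (- 1/2) * norm (LINT x|lborel. on_schwartz Q \<gamma> x * character s x) \<le> gauss 1 s * norm (LINT x|lborel. on_schwartz Q \<gamma> x * character s x)"
    by (intro mult_right_mono) auto
  ultimately have "exp (1/2) * (exp (- 1/2) * norm (LINT x|lborel. on_schwartz Q \<gamma> x * character s x)) \<le> exp (1/2) * ((LINT x|lborel. norm (\<gamma> x)) * norm (p s))"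
    by (intro mult_left_mono) auto
  then show ?thesis by (simp add: mult.assoc[symmetric] exp_add[symmetric]) (simp add: mult_ac)
qed

lemma Q_annihilates_polynomials:
  assumes \<gamma>: "\<gamma> \<in> schwartz" and \<rho>: "\<rho> > 0"
    and p: "\<And>s. norm s \<le> \<rho> \<Longrightarrow> norm (p s) \<le> C * norm s ^ m"
    and q: "q \<in> poly_space m"
  shows "(LINT x|lborel. on_schwartz Q \<gamma> x * complex_of_real (q x)) = 0"
proof (rule moments_vanish[OF schwartz_rapid[OF on_schwartz_Q(1)[OF \<gamma>]] _ _ q])
  \<comment> \<open>Radius \<rho> is for the bound on the multiplier, radius 1 for
    \<open>Q_character_bound\<close>.\<close>
  show "min \<rho> 1 > 0" using \<rho> by simp
  let ?K = "(LINT x|lborel. norm (\<gamma> x)) * exp (1/2)"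
  fix s :: "real^'d" assume s: "norm s \<le> min \<rho> 1"
  have "norm (LINT x|lborel. on_schwartz Q \<gamma> x * character s x) \<le> ?K * norm (p s)"
    by (rule Q_character_bound[OF \<gamma>]) (use s in simp)
  also have "\<dots> \<le> ?K * (C * norm s ^ m)"
    using s by (intro mult_left_mono p mult_nonneg_nonneg Bochner_Integration.integral_nonneg) auto
  finally show "norm (LINT x|lborel. on_schwartz Q \<gamma> x * character s x) \<le> (?K * C) * norm s ^ m"
    by (simp add: mult.assoc)
qed

end

section \<open>The energy estimate\<close>

lemma poly_bounded_const: "poly_bounded (\<lambda>_. c)"
  by (rule poly_bounded_bounded[of _ "norm c"]) simp

lemma poly_bounded_uminus: "poly_bounded u \<Longrightarrow> poly_bounded (\<lambda>x. - u x)"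
  by (simp add: poly_bounded_def)

lemma poly_bounded_diff: "poly_bounded u \<Longrightarrow> poly_bounded v \<Longrightarrow> poly_bounded (\<lambda>x. u x - v x)"
  using poly_bounded_add[OF _ poly_bounded_uminus, of u v] by simp

lemma poly_bounded_sum:
  assumes "\<And>i. i \<in> I \<Longrightarrow> poly_bounded (u i)"
  shows "poly_bounded (\<lambda>x. \<Sum>i\<in>I. u i x)"
  using assms
proof (induction I rule: infinite_finite_induct)
  case (insert i I)
  then show ?case using poly_bounded_add[of "u i" "\<lambda>x. \<Sum>i\<in>I. u i x"] by simp
qed (auto intro: poly_bounded_const)

lemma poly_bounded_pairing:
  assumes "\<And>x. poly_bounded (h x :: 'b::real_normed_vector \<Rightarrow> real)"
  shows "poly_bounded (\<lambda>y. pairing c (\<lambda>x. h x y))"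
  unfolding pairing_def by (intro poly_bounded_sum poly_bounded_mult poly_bounded_const assms)

lemma continuous_on_pairing:
  assumes "\<And>x. continuous_on UNIV (h x)"
  shows "continuous_on UNIV (\<lambda>y. pairing c (\<lambda>x. h x y))"
  unfolding pairing_def by (intro continuous_intros assms)

lemma pairing_integral:
  fixes h :: "'b \<Rightarrow> 'a::euclidean_space \<Rightarrow> real"
  assumes "\<And>x. integrable lborel (h x)"
  shows "pairing c (\<lambda>x. LINT y|lborel. h x y) = (LINT y|lborel. pairing c (\<lambda>x. h x y))"
  unfolding pairing_def by (subst Bochner_Integration.integral_sum) (auto intro!: integrable_mult_right assms)

lemma rapid_Re_integrable:
  assumes "rapid A" and "continuous_on UNIV u" "poly_bounded u"
  shows "integrable lborel (\<lambda>y. Re (A y) * u y)"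
    and "(LINT y|lborel. Re (A y) * u y) = Re (LINT y|lborel. A y * complex_of_real (u y))"
proof -
  have [measurable]: "u \<in> borel_measurable borel" by (intro borel_measurable_continuous_onI assms)
  have i: "integrable lborel (\<lambda>y. A y * complex_of_real (u y))"
    by (intro rapid_mult_integrable assms) (simp_all add: poly_bounded_of_real assms)
  from integrable_Re[OF i] show "integrable lborel (\<lambda>y. Re (A y) * u y)" by simp
  from integral_Re[OF i] show "(LINT y|lborel. Re (A y) * u y) = Re (LINT y|lborel. A y * complex_of_real (u y))" by simp
qed

locale green_setting =
  fixes P Padj :: "'n::finite \<Rightarrow> 'd::finite distr \<Rightarrow> 'd distr"
    and p :: "'n \<Rightarrow> real^'d \<Rightarrow> complex"
    and G :: "real^'d \<Rightarrow> real" and m :: nat and \<Xi> :: "(real^'d) set"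
    and \<rho> C :: real
  assumes op: "\<And>j. multiplier_operator (P j) (Padj j) (p j)"
    and \<rho>: "\<rho> > 0" and p_bound: "\<And>j s. norm s \<le> \<rho> \<Longrightarrow> norm (p j s) \<le> C * norm s ^ m"
    and G_cont: "continuous_on UNIV G" and G_bounded: "poly_bounded G"
    and G_even: "\<And>x. G (- x) = G x"
    and G_green: "green_function (adj_compose Padj P) (distr_of (\<lambda>x. complex_of_real (G x)))"
    and G_cpd: "cond_pos_def m G"
    and \<Xi>: "unisolvent m \<Xi>"
begin

definition L :: "(real^'d \<Rightarrow> complex) \<Rightarrow> real^'d \<Rightarrow> complex" where
  "L \<psi> x = (\<Sum>j\<in>UNIV. on_schwartz (Padj j) (on_schwartz (P j) \<psi>) x)"

lemma op': "distr_operator (P j) (Padj j)" "translation_invariant (P j) (Padj j)"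
proof -
  interpret multiplier_operator "P j" "Padj j" "p j" by (rule op)
  show "distr_operator (P j) (Padj j)" "translation_invariant (P j) (Padj j)" by unfold_locales
qed

lemmas P_schwartz = distr_operator.on_schwartz_P(1)[OF op'(1)]
lemmas Padj_schwartz = distr_operator.on_schwartz_Q(1)[OF op'(1)]

lemma L_schwartz: "\<psi> \<in> schwartz \<Longrightarrow> L \<psi> \<in> schwartz"
  unfolding L_def[abs_def] by (intro schwartz_sum Padj_schwartz P_schwartz finite)

lemma L_mult_integral:
  fixes u :: "real^'d \<Rightarrow> complex"
  assumes \<psi>: "\<psi> \<in> schwartz" and u: "continuous_on UNIV u" "poly_bounded u"
  shows "(LINT x|lborel. L \<psi> x * u x) = (\<Sum>j\<in>UNIV. LINT x|lborel. on_schwartz (Padj j) (on_schwartz (P j) \<psi>) x * u x)"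
  unfolding L_def sum_distrib_right
  by (intro Bochner_Integration.integral_sum rapid_mult_integrable schwartz_rapid Padj_schwartz P_schwartz \<psi> u
      borel_measurable_continuous_onI)

lemma G_measurable [measurable]: "G \<in> borel_measurable borel"
  by (intro borel_measurable_continuous_onI G_cont)

lemma Gc: "continuous_on UNIV (\<lambda>x. complex_of_real (G x))" "poly_bounded (\<lambda>x. complex_of_real (G x))"
  by (intro continuous_intros G_cont) (simp add: poly_bounded_of_real G_bounded)

text \<open>Both operators are moved from \<open>G\<close> to the test function. Each turns into its
  partner and the order is reversed, so the composition \<open>Padj j\<close> after
  \<open>P j\<close> reproduces itself and \<open>L\<close> is formally self-adjoint.\<close>

lemma green_at_zero:
  assumes \<gamma>: "\<gamma> \<in> schwartz"
  shows "(LINT y|lborel. L \<gamma> y * complex_of_real (G y)) = \<gamma> 0"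
proof -
  let ?G = "distr_of (\<lambda>x. complex_of_real (G x))"
  have T: "?G \<in> tempered" using G_green by (simp add: green_function_def)
  have "\<gamma> 0 = adj_compose Padj P ?G \<gamma>"
    using G_green \<gamma> by (simp add: green_function_def dirac0_def)
  also have "\<dots> = (\<Sum>j\<in>UNIV. ?G (on_schwartz (Padj j) (on_schwartz (P j) \<gamma>)))"
    unfolding adj_compose_def
  proof (rule sum.cong[OF refl])
    fix j
    interpret o: distr_operator "P j" "Padj j" by (rule op')
    show "Padj j (P j ?G) \<gamma> = ?G (on_schwartz (Padj j) (on_schwartz (P j) \<gamma>))"
      by (simp only: o.adjoint_Q[OF o.tempered_P[OF T] \<gamma>] o.adjoint_P[OF T P_schwartz[OF \<gamma>]])
  qed
  also have "\<dots> = (\<Sum>j\<in>UNIV. LINT y|lborel. on_schwartz (Padj j) (on_schwartz (P j) \<gamma>) y * complex_of_real (G y))"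
    by (simp add: distr_of_eq Padj_schwartz P_schwartz \<gamma> mult.commute)
  also have "\<dots> = (LINT y|lborel. L \<gamma> y * complex_of_real (G y))"
    by (rule L_mult_integral[OF \<gamma> Gc, symmetric])
  finally show ?thesis by simp
qed

text \<open>\<open>L\<close> commutes with translations, which carry the identity from 0 to
  \<open>x\<close>; evenness of \<open>G\<close> puts the result in the form of a
  convolution.\<close>

lemma green_representation:
  assumes \<psi>: "\<psi> \<in> schwartz"
  shows "(LINT y|lborel. L \<psi> y * complex_of_real (G (x - y))) = \<psi> x"
proof -
  have \<gamma>: "(\<lambda>y. \<psi> (y + x)) \<in> schwartz" by (rule schwartz_translate[OF \<psi>])
  have "on_schwartz (Padj j) (on_schwartz (P j) (\<lambda>y. \<psi> (y + x)))
      = (\<lambda>y. on_schwartz (Padj j) (on_schwartz (P j) \<psi>) (y + x))" for j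
  proof -
    interpret t: translation_invariant "P j" "Padj j" by (rule op')
    show ?thesis
      using t.translation_P[OF \<psi>, of "- x"] t.translation_Q[OF P_schwartz[OF \<psi>], of j "- x"] by simp
  qed
  then have L: "L (\<lambda>y. \<psi> (y + x)) = (\<lambda>y. L \<psi> (y + x))" by (simp add: L_def fun_eq_iff)
  note [measurable] = schwartz_measurable[OF L_schwartz[OF \<psi>]]
  have even: "G (x - y) = G (y - x)" for y using G_even[of "x - y"] by simp
  have "(LINT y|lborel. L \<psi> y * complex_of_real (G (x - y))) = (LINT y|lborel. L \<psi> (y + x) * complex_of_real (G y))"
    using integral_translate(1)[of "\<lambda>y. L \<psi> y * complex_of_real (G (y - x))" x] by (simp add: even)
  also have "\<dots> = \<psi> (0 + x)" using green_at_zero[OF \<gamma>] by (simp add: L)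
  finally show ?thesis by simp
qed

text \<open>The zero of order \<open>m\<close> is supplied by the outer \<open>Padj j\<close> alone;
  the inner \<open>P j \<psi>\<close> only has to be a Schwartz function.\<close>

lemma L_annihilates:
  assumes \<psi>: "\<psi> \<in> schwartz" and q: "q \<in> poly_space m"
  shows "(LINT y|lborel. L \<psi> y * complex_of_real (q y)) = 0"
proof -
  note qq = poly_space_continuous_bounded[OF q]
  have "(LINT y|lborel. L \<psi> y * complex_of_real (q y))
    = (\<Sum>j\<in>UNIV. LINT y|lborel. on_schwartz (Padj j) (on_schwartz (P j) \<psi>) y * complex_of_real (q y))"
    by (intro L_mult_integral \<psi> continuous_intros qq) (simp add: poly_bounded_of_real qq)
  also have "\<dots> = 0"
  proof (rule sum.neutral, rule ballI)
    fix j
    interpret o: multiplier_operator "P j" "Padj j" "p j" by (rule op)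
    show "(LINT y|lborel. on_schwartz (Padj j) (on_schwartz (P j) \<psi>) y * complex_of_real (q y)) = 0"
      by (rule o.Q_annihilates_polynomials[OF P_schwartz[OF \<psi>] \<rho> p_bound q])
  qed
  finally show ?thesis .
qed

text \<open>The pairing is bilinear, so duality gives integrals of \<open>(P j \<psi>)^2\<close>
  without conjugation; the real part is estimated by the modulus.\<close>

lemma L_energy:
  assumes \<psi>: "\<psi> \<in> schwartz"
  shows "Re (LINT y|lborel. L \<psi> y * \<psi> y) \<le> (\<Sum>j\<in>UNIV. LINT y|lborel. (norm (on_schwartz (P j) \<psi> y))\<^sup>2)"
proof -
  have "(LINT y|lborel. L \<psi> y * \<psi> y)
    = (\<Sum>j\<in>UNIV. LINT y|lborel. on_schwartz (Padj j) (on_schwartz (P j) \<psi>) y * \<psi> y)"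
    by (intro L_mult_integral \<psi> schwartz_continuous schwartz_poly_bounded)
  also have "\<dots> = (\<Sum>j\<in>UNIV. LINT y|lborel. on_schwartz (P j) \<psi> y * on_schwartz (P j) \<psi> y)"
    by (intro sum.cong refl distr_operator.duality'[OF op'(1)] P_schwartz \<psi>)
  finally have "Re (LINT y|lborel. L \<psi> y * \<psi> y)
    = (\<Sum>j\<in>UNIV. Re (LINT y|lborel. on_schwartz (P j) \<psi> y * on_schwartz (P j) \<psi> y))" by simp
  also have "\<dots> \<le> (\<Sum>j\<in>UNIV. LINT y|lborel. (norm (on_schwartz (P j) \<psi> y))\<^sup>2)"
  proof (rule sum_mono)
    fix j
    have "Re (LINT y|lborel. on_schwartz (P j) \<psi> y * on_schwartz (P j) \<psi> y)
      \<le> norm (LINT y|lborel. on_schwartz (P j) \<psi> y * on_schwartz (P j) \<psi> y)" by (rule complex_Re_le_cmod)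
    also have "\<dots> \<le> (LINT y|lborel. norm (on_schwartz (P j) \<psi> y * on_schwartz (P j) \<psi> y))"
      by (rule integral_norm_bound)
    finally show "Re (LINT y|lborel. on_schwartz (P j) \<psi> y * on_schwartz (P j) \<psi> y)
      \<le> (LINT y|lborel. (norm (on_schwartz (P j) \<psi> y))\<^sup>2)" by (simp add: norm_mult power2_eq_square)
  qed
  finally show ?thesis .
qed

text \<open>
  The functional \<open>c \<mapsto> pairing c \<psi>\<close> is represented by a sequence in \<open>annihilators m\<close> whose squared norms tend to
  \<open>\<integral> \<psi> L \<psi>\<close>: apply the sequence to \<open>\<psi> = \<integral> kernel_form G \<cdot> (interp_error y) (L \<psi> y) dy\<close> and pass to the limit
  under the integral sign.
\<close>

lemma energy_bound:
  assumes \<psi>: "(\<lambda>x. complex_of_real (\<psi> x)) \<in> schwartz" and c: "c \<in> annihilators m"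
  shows "(pairing c \<psi>)\<^sup>2 \<le> (\<Sum>j\<in>UNIV. LINT y|lborel. (norm (on_schwartz (P j) (\<lambda>x. complex_of_real (\<psi> x)) y))\<^sup>2) * kernel_form G c c"
proof -
  let ?\<psi> = "\<lambda>x. complex_of_real (\<psi> x)"
  have fin: "finite \<Xi>" using \<Xi> by (simp add: unisolvent_def)
  interpret si: semi_inner_space "annihilators m" "\<lambda>a c d x. a * c x + d x" "kernel_form G"
    by (rule semi_inner_annihilators[OF G_cpd])
  define ie where "ie = interp_error m \<Xi>"
  have ie: "ie y \<in> annihilators m" for y unfolding ie_def by (rule interp_error_annihilators[OF \<Xi>])
  have pairing_ie: "pairing (ie y) h = h y - (\<Sum>\<xi>\<in>\<Xi>. lagrange m \<Xi> \<xi> y * h \<xi>)" for y h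
    unfolding ie_def by (rule pairing_interp_error[OF fin])
  have lag: "continuous_on UNIV (lagrange m \<Xi> \<xi>)" "poly_bounded (lagrange m \<Xi> \<xi>)" if "\<xi> \<in> \<Xi>" for \<xi>
    by (rule poly_space_continuous_bounded[OF lagrange_props(1)[OF \<Xi> that]])+
  define A where "A = L ?\<psi>"
  have A: "rapid A" unfolding A_def by (intro schwartz_rapid L_schwartz \<psi>)
  \<comment> \<open>As \<psi>, \<open>G\<close> and the Lagrange polynomials are real, the real part
    of \<open>L \<psi>\<close> inherits the Green representation and the vanishing moments.\<close>
  define w where "w y = Re (A y)" for y
  note Re_int = rapid_Re_integrable[OF A, folded w_def]
  have w_meas [measurable]: "w \<in> borel_measurable borel"
    using rapid_measurable[OF A] unfolding w_def[abs_def] by measurable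
  have \<psi>_cont: "continuous_on UNIV \<psi>"
    using continuous_on_Re[OF schwartz_continuous[OF \<psi>]] by simp
  have \<psi>_pb: "poly_bounded \<psi>" using schwartz_poly_bounded[OF \<psi>] by (simp add: poly_bounded_of_real)
  have Gx: "continuous_on UNIV (\<lambda>y. G (x - y))" "poly_bounded (\<lambda>y. G (x - y))" for x
    by (intro continuous_on_compose2[OF G_cont] continuous_intros, simp)
       (rule poly_bounded_translate(2)[OF G_bounded])
  have w_ann: "(LINT y|lborel. w y * lagrange m \<Xi> \<xi> y) = 0" if "\<xi> \<in> \<Xi>" for \<xi>
    using Re_int(2)[OF lag[OF that]] L_annihilates[OF \<psi> lagrange_props(1)[OF \<Xi> that]] by (simp add: A_def)
  have w_G: "(LINT y|lborel. w y * G (x - y)) = \<psi> x" for x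
    using Re_int(2)[OF Gx] green_representation[OF \<psi>, of x] by (simp add: A_def)
  define I where "I = (LINT y|lborel. w y * \<psi> y)"
  have I_le: "I \<le> (\<Sum>j\<in>UNIV. LINT y|lborel. (norm (on_schwartz (P j) ?\<psi> y))\<^sup>2)"
    using Re_int(2)[OF \<psi>_cont \<psi>_pb] L_energy[OF \<psi>] by (simp add: I_def A_def)

  \<comment> \<open>\<open>ie y\<close> differs from evaluation at \<open>y\<close> by Lagrange
    polynomials in \<open>y\<close>, and these integrate to zero against \<open>w\<close>.\<close>
  have h_ie: "(LINT y|lborel. w y * pairing (ie y) h) = (LINT y|lborel. w y * h y)"
    and h_ie_props: "continuous_on UNIV (\<lambda>y. pairing (ie y) h)" "poly_bounded (\<lambda>y. pairing (ie y) h)"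
    if h: "continuous_on UNIV h" "poly_bounded h" for h
  proof -
    have i: "integrable lborel (\<lambda>y. w y * h y)" by (rule Re_int(1)[OF h])
    have j: "integrable lborel (\<lambda>y. h \<xi> * (w y * lagrange m \<Xi> \<xi> y))" if "\<xi> \<in> \<Xi>" for \<xi>
      by (intro integrable_mult_right Re_int(1) lag that)
    have "(LINT y|lborel. w y * pairing (ie y) h)
      = (LINT y|lborel. w y * h y - (\<Sum>\<xi>\<in>\<Xi>. h \<xi> * (w y * lagrange m \<Xi> \<xi> y)))"
      by (simp add: pairing_ie right_diff_distrib sum_distrib_left mult_ac)
    also have "\<dots> = (LINT y|lborel. w y * h y) - (\<Sum>\<xi>\<in>\<Xi>. LINT y|lborel. h \<xi> * (w y * lagrange m \<Xi> \<xi> y))"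
      by (subst Bochner_Integration.integral_diff)
         (auto intro!: i j Bochner_Integration.integrable_sum simp: Bochner_Integration.integral_sum[OF j])
    also have "(\<Sum>\<xi>\<in>\<Xi>. LINT y|lborel. h \<xi> * (w y * lagrange m \<Xi> \<xi> y)) = 0"
      by (intro sum.neutral ballI) (simp add: w_ann)
    finally show "(LINT y|lborel. w y * pairing (ie y) h) = (LINT y|lborel. w y * h y)" by simp
    show "continuous_on UNIV (\<lambda>y. pairing (ie y) h)"
      unfolding pairing_ie by (intro continuous_intros h lag)
    show "poly_bounded (\<lambda>y. pairing (ie y) h)"
      unfolding pairing_ie by (intro poly_bounded_diff poly_bounded_sum poly_bounded_mult poly_bounded_const h lag)
  qed
  have kernel_form_ie: "kernel_form G c (ie y) = pairing c (\<lambda>x. pairing (ie y) (\<lambda>z. G (x - z)))" for c y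
    by (simp add: kernel_form_def)
  have kernel_form_ie_props: "continuous_on UNIV (\<lambda>y. kernel_form G c (ie y))" "poly_bounded (\<lambda>y. kernel_form G c (ie y))" for c
    unfolding kernel_form_ie by (intro continuous_on_pairing poly_bounded_pairing h_ie_props Gx)+
  \<comment> \<open>The Green representation with \<open>G (x - y)\<close> replaced by its
    interpolation error in \<open>y\<close>. The integrand thereby contains the form with
    \<open>ie y\<close>, to which Cauchy-Schwarz and the Riesz limits apply.\<close>
  have rep: "pairing c \<psi> = (LINT y|lborel. w y * kernel_form G c (ie y))" for c
  proof -
    have "pairing c \<psi> = pairing c (\<lambda>x. LINT y|lborel. w y * pairing (ie y) (\<lambda>z. G (x - z)))"
      by (simp only: h_ie[OF Gx] w_G)
    also have "\<dots> = (LINT y|lborel. pairing c (\<lambda>x. w y * pairing (ie y) (\<lambda>z. G (x - z))))"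
      by (intro pairing_integral Re_int(1) h_ie_props Gx)
    finally show ?thesis by (simp only: pairing_cmult_right kernel_form_ie)
  qed
  define E where "E y = kernel_form G (ie y) (ie y)" for y
  have E_eq: "E y = pairing (ie y) (\<lambda>z. G (y - z)) - (\<Sum>\<xi>\<in>\<Xi>. lagrange m \<Xi> \<xi> y * pairing (ie y) (\<lambda>z. G (\<xi> - z)))" for y
    unfolding E_def kernel_form_ie by (subst pairing_ie) simp
  have pairing_ie_G: "pairing (ie y) (\<lambda>z. G (y - z)) = G 0 - (\<Sum>\<xi>\<in>\<Xi>. lagrange m \<Xi> \<xi> y * G (y - \<xi>))" for y
    by (simp add: pairing_ie)
  have Gx': "continuous_on UNIV (\<lambda>y. G (y - x))" "poly_bounded (\<lambda>y. G (y - x))" for x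
    by (intro continuous_on_compose2[OF G_cont] continuous_intros, simp)
       (use poly_bounded_translate(1)[OF G_bounded, of "- x"] in simp)
  have E_cont: "continuous_on UNIV E"
    unfolding E_eq[abs_def] pairing_ie_G by (intro continuous_intros lag h_ie_props Gx Gx')
  have E_pb: "poly_bounded E"
    unfolding E_eq[abs_def] pairing_ie_G
    by (intro poly_bounded_diff poly_bounded_sum poly_bounded_mult poly_bounded_const lag h_ie_props Gx Gx')
  have E0: "E y \<ge> 0" for y unfolding E_def by (rule si.Q_nonneg[OF ie])
  \<comment> \<open>Bounding \<open>sqrt (E y)\<close> by \<open>1 + E y\<close> gives a continuous,
    polynomially bounded majorant directly.\<close>
  have CS: "\<bar>kernel_form G c (ie y)\<bar> \<le> sqrt (kernel_form G c c) * (1 + E y)" if "c \<in> annihilators m" for c y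
  proof -
    have "\<bar>kernel_form G c (ie y)\<bar> \<le> sqrt (kernel_form G c c) * sqrt (E y)"
      using real_sqrt_le_mono[OF si.Cauchy_Schwarz[OF that ie[of y]]] by (simp add: real_sqrt_mult E_def)
    also have "sqrt (E y) \<le> 1 + E y"
      by (rule real_le_lsqrt) (use E0[of y] in \<open>auto simp: power2_eq_square algebra_simps\<close>)
    finally show ?thesis using si.Q_nonneg[OF that] by (simp add: mult_left_mono)
  qed
  have wE: "integrable lborel (\<lambda>y. \<bar>w y\<bar> * (1 + E y))"
  proof -
    have "integrable lborel (\<lambda>y. w y * (1 + E y))"
      by (intro Re_int(1) continuous_intros E_cont poly_bounded_add poly_bounded_const E_pb)
    from integrable_abs[OF this] show ?thesis using E0 by (simp add: abs_mult)
  qed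
  define B where "B = (LINT y|lborel. \<bar>w y\<bar> * (1 + E y))"
  \<comment> \<open>The constant \<open>B^2\<close> is crude and unrelated to the energy. It merely
    establishes boundedness, so that the Riesz sequence exists.\<close>
  have l_bound: "(pairing c \<psi>)\<^sup>2 \<le> B\<^sup>2 * kernel_form G c c" if c: "c \<in> annihilators m" for c
  proof -
    have "norm (pairing c \<psi>) \<le> (LINT y|lborel. sqrt (kernel_form G c c) * (\<bar>w y\<bar> * (1 + E y)))"
      unfolding rep
    proof (rule Bochner_Integration.integral_norm_bound_integral)
      show "integrable lborel (\<lambda>y. w y * kernel_form G c (ie y))" by (intro Re_int(1) kernel_form_ie_props)
      show "integrable lborel (\<lambda>y. sqrt (kernel_form G c c) * (\<bar>w y\<bar> * (1 + E y)))"
        by (intro integrable_mult_right wE)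
      fix y
      show "norm (w y * kernel_form G c (ie y)) \<le> sqrt (kernel_form G c c) * (\<bar>w y\<bar> * (1 + E y))"
        using mult_left_mono[OF CS[OF c, of y], of "\<bar>w y\<bar>"] by (simp add: abs_mult mult_ac)
    qed
    then have "\<bar>pairing c \<psi>\<bar> \<le> B * sqrt (kernel_form G c c)" by (simp add: B_def mult.commute)
    then have "(pairing c \<psi>)\<^sup>2 \<le> (B * sqrt (kernel_form G c c))\<^sup>2"
      by (metis abs_ge_zero power2_abs power_mono)
    then show ?thesis using si.Q_nonneg[OF c] by (simp add: power_mult_distrib)
  qed
  have ne: "annihilators m \<noteq> ({} :: (real^'d \<Rightarrow> real) set)" using ie by blast
  have l_lc: "pairing (\<lambda>x. a * c x + d x) \<psi> = a * pairing c \<psi> + pairing d \<psi>"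
    if "c \<in> annihilators m" "d \<in> annihilators m" for a c d using that by (intro pairing_lc annihilators_fsupp)
  obtain \<sigma> K where \<sigma>: "\<And>n. \<sigma> n \<in> annihilators m"
    and lim: "\<And>c. c \<in> annihilators m \<Longrightarrow> (\<lambda>n. kernel_form G (\<sigma> n) c) \<longlonglongrightarrow> pairing c \<psi>"
    and K: "\<And>n. kernel_form G (\<sigma> n) (\<sigma> n) \<le> K"
    and lim0: "(\<lambda>n. kernel_form G (\<sigma> n) (\<sigma> n) - pairing (\<sigma> n) \<psi>) \<longlonglongrightarrow> 0"
    by (rule si.Riesz_sequence[of "\<lambda>c. pairing c \<psi>" "B\<^sup>2", OF ne l_lc l_bound], assumption, assumption, assumption, rule that) blast+
  \<comment> \<open>By \<open>rep\<close> the left integrals are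
    \<open>pairing (\<sigma> n) \<psi>\<close>; by \<open>h_ie\<close> the limit is
    \<open>I\<close>. The squared norms of \<open>\<sigma> n\<close> differ from these pairings by a
    null sequence.\<close>
  have "(\<lambda>n. LINT y|lborel. w y * kernel_form G (\<sigma> n) (ie y)) \<longlonglongrightarrow> (LINT y|lborel. w y * pairing (ie y) \<psi>)"
  proof (rule integral_dominated_convergence)
    show "integrable lborel (\<lambda>y. sqrt K * (\<bar>w y\<bar> * (1 + E y)))" by (intro integrable_mult_right wE)
    show "AE y in lborel. (\<lambda>n. w y * kernel_form G (\<sigma> n) (ie y)) \<longlonglongrightarrow> w y * pairing (ie y) \<psi>"
      by (intro always_eventually allI tendsto_mult_left lim ie)
    show "(\<lambda>y. w y * kernel_form G (\<sigma> n) (ie y)) \<in> borel_measurable lborel" for n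
      by (rule borel_measurable_integrable[OF Re_int(1)[OF kernel_form_ie_props]])
    show "(\<lambda>y. w y * pairing (ie y) \<psi>) \<in> borel_measurable lborel"
      by (rule borel_measurable_integrable[OF Re_int(1)[OF h_ie_props[OF \<psi>_cont \<psi>_pb]]])
    fix n
    have "norm (w y * kernel_form G (\<sigma> n) (ie y)) \<le> sqrt K * (\<bar>w y\<bar> * (1 + E y))" for y
    proof -
      have "\<bar>kernel_form G (\<sigma> n) (ie y)\<bar> \<le> sqrt (kernel_form G (\<sigma> n) (\<sigma> n)) * (1 + E y)" by (rule CS[OF \<sigma>])
      also have "\<dots> \<le> sqrt K * (1 + E y)" using K E0[of y] by (intro mult_right_mono) auto
      finally have "\<bar>kernel_form G (\<sigma> n) (ie y)\<bar> \<le> sqrt K * (1 + E y)" .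
      from mult_left_mono[OF this, of "\<bar>w y\<bar>"] show ?thesis by (simp add: abs_mult mult_ac)
    qed
    then show "AE y in lborel. norm (w y * kernel_form G (\<sigma> n) (ie y)) \<le> sqrt K * (\<bar>w y\<bar> * (1 + E y))" by simp
  qed
  then have "(\<lambda>n. pairing (\<sigma> n) \<psi>) \<longlonglongrightarrow> I"
    by (simp only: rep[symmetric] h_ie[OF \<psi>_cont \<psi>_pb] I_def)
  from tendsto_add[OF lim0 this] have limI: "(\<lambda>n. kernel_form G (\<sigma> n) (\<sigma> n)) \<longlonglongrightarrow> I" by simp
  \<comment> \<open>Cauchy-Schwarz for \<open>\<sigma> n\<close> and \<open>c\<close> in the limit;
    this replaces \<open>B^2\<close> by the sharp constant \<open>I\<close>.\<close>
  have "(pairing c \<psi>)\<^sup>2 \<le> I * kernel_form G c c"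
  proof (rule LIMSEQ_le)
    show "(\<lambda>n. (kernel_form G (\<sigma> n) c)\<^sup>2) \<longlonglongrightarrow> (pairing c \<psi>)\<^sup>2" by (intro tendsto_power lim c)
    show "(\<lambda>n. kernel_form G (\<sigma> n) (\<sigma> n) * kernel_form G c c) \<longlonglongrightarrow> I * kernel_form G c c" by (intro tendsto_mult_right limI)
    show "\<exists>N. \<forall>n\<ge>N. (kernel_form G (\<sigma> n) c)\<^sup>2 \<le> kernel_form G (\<sigma> n) (\<sigma> n) * kernel_form G c c"
      using si.Cauchy_Schwarz[OF \<sigma> c] by blast
  qed
  also have "\<dots> \<le> (\<Sum>j\<in>UNIV. LINT y|lborel. (norm (on_schwartz (P j) ?\<psi> y))\<^sup>2) * kernel_form G c c"
    by (intro mult_right_mono I_le si.Q_nonneg c)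
  finally show ?thesis .
qed

end

section \<open>Borel representatives of square integrable functions\<close>

lemma lebesgue_borel_representative:
  fixes h :: "real^'d \<Rightarrow> complex"
  assumes "h \<in> borel_measurable lebesgue"
  shows "\<exists>h'\<in>borel_measurable borel. AE x in lborel. h x = h' x"
proof -
  have "(\<lambda>x. Re (h x)) \<in> borel_measurable lebesgue" "(\<lambda>x. Im (h x)) \<in> borel_measurable lebesgue"
    using assms by (auto intro: borel_measurable_Re[THEN measurable_compose[OF assms]] borel_measurable_Im[THEN measurable_compose[OF assms]])
  then obtain a b where ab: "a \<in> borel_measurable lborel" "AE x in lborel. Re (h x) = a x"
    "b \<in> borel_measurable lborel" "AE x in lborel. Im (h x) = b x"
    using completion_ex_borel_measurable_real by blast
  show ?thesis
  proof (intro bexI)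
    show "AE x in lborel. h x = complex_of_real (a x) + \<i> * complex_of_real (b x)"
      using ab(2,4) by eventually_elim (metis complex_eq)
    show "(\<lambda>x. complex_of_real (a x) + \<i> * complex_of_real (b x)) \<in> borel_measurable borel"
      using ab(1,3) by simp
  qed
qed

text \<open>Neither the distribution nor the \<open>L2\<close> norm sees null sets. A Borel version
  is wanted because convolutions and Young's inequality are formulated for the Borel measure
  \<open>lborel\<close>.\<close>

lemma square_integrable_representative:
  fixes h :: "real^'d::finite \<Rightarrow> complex"
  assumes h: "square_integrable h"
  shows "\<exists>h'. h' \<in> borel_measurable borel \<and> distr_of h' = distr_of h \<and>
    (\<exists>H\<ge>0. (\<integral>\<^sup>+x. ennreal ((norm (h' x))\<^sup>2) \<partial>lborel) = ennreal H)"
proof -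
  have hm: "h \<in> borel_measurable lebesgue" and hi: "integrable lebesgue (\<lambda>x. (norm (h x))\<^sup>2)"
    using h by (auto simp: square_integrable_def)
  obtain h' where h': "h' \<in> borel_measurable borel" and ae: "AE x in lborel. h x = h' x"
    using lebesgue_borel_representative[OF hm] by blast
  have ae': "AE x in lebesgue. h x = h' x" by (rule AE_completion[OF ae])
  have h'm: "h' \<in> borel_measurable lebesgue" using h' by (simp add: measurable_completion)
  have "distr_of h' = distr_of h"
  proof (rule ext)
    fix \<gamma> :: "real^'d \<Rightarrow> complex"
    show "distr_of h' \<gamma> = distr_of h \<gamma>"
    proof (cases "\<gamma> \<in> schwartz")
      case True
      have \<gamma>: "\<gamma> \<in> borel_measurable lebesgue" using schwartz_measurable[OF True] by (simp add: measurable_completion)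
      have "(LINT x|lebesgue. h' x * \<gamma> x) = (LINT x|lebesgue. h x * \<gamma> x)"
        by (rule integral_cong_AE) (use hm h'm \<gamma> ae' in auto)
      then show ?thesis by (simp add: distr_of_def True)
    qed (simp add: distr_of_def)
  qed
  moreover have "(\<integral>\<^sup>+x. ennreal ((norm (h' x))\<^sup>2) \<partial>lborel) = ennreal (LINT x|lebesgue. (norm (h x))\<^sup>2)"
  proof -
    have "(\<integral>\<^sup>+x. ennreal ((norm (h' x))\<^sup>2) \<partial>lborel) = (\<integral>\<^sup>+x. ennreal ((norm (h x))\<^sup>2) \<partial>lborel)"
      by (rule nn_integral_cong_AE) (use ae in auto)
    also have "\<dots> = (\<integral>\<^sup>+x. ennreal ((norm (h x))\<^sup>2) \<partial>lebesgue)"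
      by (rule nn_integral_completion[symmetric])
    also have "\<dots> = ennreal (LINT x|lebesgue. (norm (h x))\<^sup>2)"
      by (rule nn_integral_eq_integral[OF hi]) simp
    finally show ?thesis .
  qed
  ultimately show ?thesis
    using h' by (intro exI[of _ h'] exI[of _ "LINT x|lebesgue. (norm (h x))\<^sup>2"] conjI) simp_all
qed

lemma norm_diff_square_le: "(norm (a - b :: complex))\<^sup>2 \<le> 2 * (norm a)\<^sup>2 + 2 * (norm b)\<^sup>2"
proof -
  have "(norm (a - b))\<^sup>2 \<le> (norm a + norm b)\<^sup>2"
    by (intro power_mono norm_triangle_ineq4) simp
  also have "\<dots> \<le> 2 * (norm a)\<^sup>2 + 2 * (norm b)\<^sup>2"
    using sum_squares_bound[of "norm a" "norm b"] by (simp add: power2_sum)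
  finally show ?thesis .
qed

context green_setting
begin

text \<open>
  \<open>f\<close> is cut off to a ball and then mollified by \<open>\<phi>\<close>. The cut-off part \<open>f - f 1\<^sub>R\<close> is small in \<open>L\<^sub>2\<close> and
  is convolved with the integrable \<open>P j \<phi>\<close>, whereas \<open>f * P j \<phi> = P j f * \<phi>\<close>.
\<close>

lemma mollified_bound:
  fixes f \<phi> :: "real^'d \<Rightarrow> real" and h :: "'n \<Rightarrow> real^'d \<Rightarrow> complex"
  assumes f: "continuous_on UNIV f" "poly_bounded f" and f2: "integrable lborel (\<lambda>x. (f x)\<^sup>2)"
    and h [measurable]: "\<And>j. h j \<in> borel_measurable borel"
    and Pf: "\<And>j. P j (distr_of (\<lambda>x. complex_of_real (f x))) = distr_of (h j)"
    and H: "\<And>j. (\<integral>\<^sup>+x. ennreal ((norm (h j x))\<^sup>2) \<partial>lborel) = ennreal (H j)" "\<And>j. H j \<ge> 0"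
    and \<phi>: "(\<lambda>x. complex_of_real (\<phi> x)) \<in> schwartz"
    and \<phi>1: "(\<integral>\<^sup>+x. ennreal (norm (complex_of_real (\<phi> x))) \<partial>lborel) \<le> 1"
    and c: "c \<in> annihilators m"
  shows "(pairing c (\<lambda>x. LINT y|lborel. f y * \<phi> (x - y)))\<^sup>2 \<le> (\<Sum>j\<in>UNIV. 2 * H j) * kernel_form G c c"
proof -
  let ?\<phi> = "\<lambda>x. complex_of_real (\<phi> x)" and ?f = "\<lambda>x. complex_of_real (f x)"
  let ?k = "\<lambda>j. on_schwartz (P j) ?\<phi>"
  have [measurable]: "f \<in> borel_measurable borel" by (intro borel_measurable_continuous_onI f)
  have \<phi>_cont: "continuous_on UNIV \<phi>" using continuous_on_Re[OF schwartz_continuous[OF \<phi>]] by simp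
  then have [measurable]: "\<phi> \<in> borel_measurable borel" by (rule borel_measurable_continuous_onI)
  have k: "?k j \<in> schwartz" for j by (rule P_schwartz[OF \<phi>])
  note [measurable] = schwartz_measurable[OF k] schwartz_measurable[OF \<phi>]
  have fpb: "poly_bounded ?f" by (simp add: poly_bounded_of_real f)
  \<comment> \<open>A sharp cut-off is enough: \<open>fR n\<close> is rapid, and convolution with
    \<phi> provides the smoothness.\<close>
  define fR where "fR n x = (if norm x \<le> real n then f x else 0)" for n :: nat and x :: "real^'d"
  have [measurable]: "fR n \<in> borel_measurable borel" for n unfolding fR_def[abs_def] by measurable
  have fR_le: "\<bar>fR n x\<bar> \<le> \<bar>f x\<bar>" for n x by (simp add: fR_def)
  have fR_rapid: "rapid (\<lambda>x. complex_of_real (fR n x))" for n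
  proof (rule rapidI)
    have "compact (f ` cball 0 (real n))"
      by (intro compact_continuous_image continuous_on_subset[OF f(1)]) auto
    then obtain B where B: "\<And>x. x \<in> cball 0 (real n) \<Longrightarrow> norm (f x) \<le> B"
      using compact_imp_bounded bounded_iff by (metis imageI)
    fix k
    have "(1 + norm x) ^ k * norm (complex_of_real (fR n x)) \<le> (1 + real n) ^ k * \<bar>B\<bar>" for x
    proof (cases "norm x \<le> real n")
      case True
      then show ?thesis using B[of x] by (intro mult_mono power_mono) (auto simp: fR_def)
    qed (simp add: fR_def)
    then show "\<exists>C. \<forall>x. (1 + norm x) ^ k * norm (complex_of_real (fR n x)) \<le> C" by blast
  qed measurable
  define F where "F x = (LINT y|lborel. f y * \<phi> (x - y))" for x
  define \<psi> where "\<psi> n x = (LINT y|lborel. fR n y * \<phi> (x - y))" for n x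
  have \<psi>_conv: "(\<lambda>x. complex_of_real (\<psi> n x)) = conv (\<lambda>x. complex_of_real (fR n x)) ?\<phi>" for n
    by (simp add: \<psi>_def conv_def fun_eq_iff flip: of_real_mult)
  have \<psi>: "(\<lambda>x. complex_of_real (\<psi> n x)) \<in> schwartz" for n
    unfolding \<psi>_conv by (rule schwartz_conv[OF fR_rapid \<phi>])
  have P\<psi>: "on_schwartz (P j) (\<lambda>x. complex_of_real (\<psi> n x)) = conv (\<lambda>x. complex_of_real (fR n x)) (?k j)" for n j
    unfolding \<psi>_conv by (rule translation_invariant.conv_P[OF op'(2) fR_rapid \<phi>])
  have int_f: "integrable lborel (\<lambda>y. ?f y * k (x - y))" if "k \<in> schwartz" for k x
    using rapid_mult_integrable[OF schwartz_rapid[OF schwartz_reflect[OF that]] fpb, of x]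
    by (simp add: mult.commute)
  have int_\<phi>: "integrable lborel (\<lambda>y. f y * \<phi> (x - y))" for x
    using integrable_Re[OF int_f[OF \<phi>, of x]] by simp
  have \<psi>_lim: "(\<lambda>n. \<psi> n x) \<longlonglongrightarrow> F x" for x
    unfolding \<psi>_def F_def
  proof (rule integral_dominated_convergence)
    show "integrable lborel (\<lambda>y. \<bar>f y * \<phi> (x - y)\<bar>)" by (rule integrable_abs[OF int_\<phi>])
    show "AE y in lborel. (\<lambda>n. fR n y * \<phi> (x - y)) \<longlonglongrightarrow> f y * \<phi> (x - y)"
    proof (rule always_eventually, rule allI, rule tendsto_mult_right, rule tendsto_eventually)
      fix y :: "real^'d"
      obtain N where "norm y \<le> real N" using real_arch_simple by blast
      then show "\<forall>\<^sub>F n in sequentially. fR n y = f y"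
        unfolding eventually_sequentially fR_def by (intro exI[of _ N]) auto
    qed
    show "AE y in lborel. norm (fR n y * \<phi> (x - y)) \<le> \<bar>f y * \<phi> (x - y)\<bar>" for n
      by (simp add: abs_mult mult_right_mono fR_le)
  qed measurable
  define tail where "tail n = (LINT x|lborel. (f x - fR n x)\<^sup>2)" for n
  have tail_int: "integrable lborel (\<lambda>x. (f x - fR n x)\<^sup>2)" for n
    by (rule Bochner_Integration.integrable_bound[OF f2]) (auto simp: fR_def)
  have tail_lim: "tail \<longlonglongrightarrow> 0"
  proof -
    have "tail \<longlonglongrightarrow> (LINT x|(lborel :: (real^'d) measure). (0::real))" unfolding tail_def
    proof (rule integral_dominated_convergence[OF _ _ f2])
      show "AE x in lborel. (\<lambda>n. (f x - fR n x)\<^sup>2) \<longlonglongrightarrow> 0"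
      proof (rule always_eventually, rule allI, rule tendsto_eventually)
        fix x :: "real^'d"
        obtain N where "norm x \<le> real N" using real_arch_simple by blast
        then show "\<forall>\<^sub>F n in sequentially. (f x - fR n x)\<^sup>2 = 0"
          unfolding eventually_sequentially fR_def by (intro exI[of _ N]) auto
      qed
      show "AE x in lborel. norm ((f x - fR n x)\<^sup>2) \<le> (f x)\<^sup>2" for n by (auto simp: fR_def)
    qed measurable
    then show ?thesis by simp
  qed
  \<comment> \<open>This norm depends on \<phi> and need not stay bounded as \<phi> narrows. It only
    multiplies \<open>tail n\<close>, which tends to 0 while \<phi> is held fixed.\<close>
  define K where "K j = (LINT x|lborel. norm (?k j x))" for j
  have K0: "K j \<ge> 0" for j by (simp add: K_def Bochner_Integration.integral_nonneg)
  have K: "(\<integral>\<^sup>+x. ennreal (norm (?k j x)) \<partial>lborel) = ennreal (K j)" for j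
    unfolding K_def by (rule nn_integral_eq_integral) (auto intro!: integrable_norm rapid_integrable schwartz_rapid k)
  have tail0: "tail n \<ge> 0" for n by (simp add: tail_def Bochner_Integration.integral_nonneg)
  \<comment> \<open>The first term stems from \<open>P j f\<close> convolved with \<phi>, whose
    \<open>L1\<close> norm is at most 1; the second from the cut-off error. The factors 2 come from
    the square of a difference.\<close>
  have energy: "(LINT x|lborel. (norm (on_schwartz (P j) (\<lambda>x. complex_of_real (\<psi> n x)) x))\<^sup>2)
      \<le> 2 * H j + 2 * ((K j)\<^sup>2 * tail n)" for n j
  proof -
    let ?g = "\<lambda>x. ?f x - complex_of_real (fR n x)"
    \<comment> \<open>\<open>conv_distr\<close> applies to the uncut \<open>f\<close>, so the
      cut-off is written as \<open>f\<close> minus its remainder \<open>?g\<close>.\<close>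
    have conv_eq: "conv (\<lambda>x. complex_of_real (fR n x)) (?k j) x = conv (h j) ?\<phi> x - conv ?g (?k j) x" for x
    proof -
      have "conv ?f (?k j) x = conv (h j) ?\<phi> x"
        by (rule translation_invariant.conv_distr[OF op'(2) _ fpb h Pf \<phi>]) measurable
      moreover have "conv ?g (?k j) x = conv ?f (?k j) x - conv (\<lambda>x. complex_of_real (fR n x)) (?k j) x"
        unfolding conv_def left_diff_distrib
        by (intro Bochner_Integration.integral_diff int_f k conv_integrable fR_rapid schwartz_poly_bounded schwartz_measurable)
      ultimately show ?thesis by simp
    qed
    have conv_meas [measurable]: "conv a b \<in> borel_measurable borel"
      if [measurable]: "a \<in> borel_measurable borel" "b \<in> borel_measurable borel" for a b :: "real^'d \<Rightarrow> complex"
      unfolding conv_def[abs_def] by measurable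
    have int: "integrable lborel (\<lambda>x. (norm (on_schwartz (P j) (\<lambda>x. complex_of_real (\<psi> n x)) x))\<^sup>2)"
      using integrable_norm[OF schwartz_mult_integrable[OF P_schwartz[OF \<psi>[of n]] P_schwartz[OF \<psi>[of n]], of j j]]
      by (simp add: norm_mult power2_eq_square)
    have "ennreal (LINT x|lborel. (norm (on_schwartz (P j) (\<lambda>x. complex_of_real (\<psi> n x)) x))\<^sup>2)
      = (\<integral>\<^sup>+x. ennreal ((norm (conv (h j) ?\<phi> x - conv ?g (?k j) x))\<^sup>2) \<partial>lborel)"
      by (subst nn_integral_eq_integral[OF int, symmetric]) (simp_all add: P\<psi> conv_eq)
    also have "\<dots> \<le> (\<integral>\<^sup>+x. 2 * ennreal ((norm (conv (h j) ?\<phi> x))\<^sup>2) + 2 * ennreal ((norm (conv ?g (?k j) x))\<^sup>2) \<partial>lborel)"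
    proof (rule nn_integral_mono)
      fix x
      have "ennreal ((norm (conv (h j) ?\<phi> x - conv ?g (?k j) x))\<^sup>2)
        \<le> ennreal (2 * (norm (conv (h j) ?\<phi> x))\<^sup>2 + 2 * (norm (conv ?g (?k j) x))\<^sup>2)"
        by (intro ennreal_leI norm_diff_square_le)
      also have "\<dots> = 2 * ennreal ((norm (conv (h j) ?\<phi> x))\<^sup>2) + 2 * ennreal ((norm (conv ?g (?k j) x))\<^sup>2)"
        by (simp add: ennreal_plus ennreal_mult del: ennreal_plus[symmetric])
      finally show "ennreal ((norm (conv (h j) ?\<phi> x - conv ?g (?k j) x))\<^sup>2)
        \<le> 2 * ennreal ((norm (conv (h j) ?\<phi> x))\<^sup>2) + 2 * ennreal ((norm (conv ?g (?k j) x))\<^sup>2)" .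
    qed
    also have "\<dots> = 2 * (\<integral>\<^sup>+x. ennreal ((norm (conv (h j) ?\<phi> x))\<^sup>2) \<partial>lborel)
        + 2 * (\<integral>\<^sup>+x. ennreal ((norm (conv ?g (?k j) x))\<^sup>2) \<partial>lborel)"
      by (subst nn_integral_add) (auto simp: nn_integral_cmult)
    also have "\<dots> \<le> 2 * ((\<integral>\<^sup>+x. ennreal (norm (?\<phi> x)) \<partial>lborel)\<^sup>2 * (\<integral>\<^sup>+x. ennreal ((norm (h j x))\<^sup>2) \<partial>lborel))
        + 2 * ((\<integral>\<^sup>+x. ennreal (norm (?k j x)) \<partial>lborel)\<^sup>2 * (\<integral>\<^sup>+x. ennreal ((norm (?g x))\<^sup>2) \<partial>lborel))"
      by (intro add_mono mult_left_mono Young_L2) auto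
    also have "\<dots> \<le> 2 * (1 * ennreal (H j)) + 2 * ((ennreal (K j))\<^sup>2 * ennreal (tail n))"
    proof (intro add_mono mult_left_mono mult_mono)
      show "(\<integral>\<^sup>+x. ennreal (norm (?\<phi> x)) \<partial>lborel)\<^sup>2 \<le> 1"
        using power_mono[OF \<phi>1, of 2] by simp
      have "(\<integral>\<^sup>+x. ennreal ((norm (?g x))\<^sup>2) \<partial>lborel) = (\<integral>\<^sup>+x. ennreal ((f x - fR n x)\<^sup>2) \<partial>lborel)"
        by (simp flip: of_real_diff)
      also have "\<dots> = ennreal (tail n)"
        unfolding tail_def by (rule nn_integral_eq_integral[OF tail_int]) simp
      finally show "(\<integral>\<^sup>+x. ennreal ((norm (?g x))\<^sup>2) \<partial>lborel) \<le> ennreal (tail n)" by simp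
    qed (auto simp: H K)
    also have "\<dots> = ennreal (2 * H j + 2 * ((K j)\<^sup>2 * tail n))"
      using H(2)[of j] K0[of j] tail0[of n] by (simp add: ennreal_power ennreal_mult del: ennreal_plus[symmetric])
    finally show ?thesis
      using H(2)[of j] tail0[of n] by (subst (asm) ennreal_le_iff) auto
  qed
  have "(pairing c F)\<^sup>2 \<le> (\<Sum>j\<in>UNIV. 2 * H j + 2 * ((K j)\<^sup>2 * 0)) * kernel_form G c c"
  proof (rule LIMSEQ_le)
    show "(\<lambda>n. (pairing c (\<psi> n))\<^sup>2) \<longlonglongrightarrow> (pairing c F)\<^sup>2"
      unfolding pairing_def by (intro tendsto_intros \<psi>_lim)
    show "(\<lambda>n. (\<Sum>j\<in>UNIV. 2 * H j + 2 * ((K j)\<^sup>2 * tail n)) * kernel_form G c c)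
      \<longlonglongrightarrow> (\<Sum>j\<in>UNIV. 2 * H j + 2 * ((K j)\<^sup>2 * 0)) * kernel_form G c c"
      by (intro tendsto_intros tail_lim)
    have f0: "0 \<le> kernel_form G c c" by (rule semi_inner_space.Q_nonneg[OF semi_inner_annihilators[OF G_cpd] c])
    have "(pairing c (\<psi> n))\<^sup>2 \<le> (\<Sum>j\<in>UNIV. 2 * H j + 2 * ((K j)\<^sup>2 * tail n)) * kernel_form G c c" for n
      by (rule order_trans[OF energy_bound[OF \<psi> c]]) (intro mult_right_mono sum_mono energy f0)
    then show "\<exists>N. \<forall>n\<ge>N. (pairing c (\<psi> n))\<^sup>2 \<le> (\<Sum>j\<in>UNIV. 2 * H j + 2 * ((K j)\<^sup>2 * tail n)) * kernel_form G c c" by blast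
  qed
  then show ?thesis by (simp add: F_def[abs_def])
qed

text \<open>The mollified estimate has a constant independent of \<phi>, and a finite pairing passes
  to the limit under pointwise convergence. So no convergence of the energies is required as the
  Gaussians narrow.\<close>

lemma sobolev_bound:
  fixes f :: "real^'d \<Rightarrow> real" and h :: "'n \<Rightarrow> real^'d \<Rightarrow> complex"
  assumes f: "continuous_on UNIV f" "poly_bounded f" and f2: "integrable lborel (\<lambda>x. (f x)\<^sup>2)"
    and h: "\<And>j. h j \<in> borel_measurable borel"
    and Pf: "\<And>j. P j (distr_of (\<lambda>x. complex_of_real (f x))) = distr_of (h j)"
    and H: "\<And>j. (\<integral>\<^sup>+x. ennreal ((norm (h j x))\<^sup>2) \<partial>lborel) = ennreal (H j)" "\<And>j. H j \<ge> 0"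
    and c: "c \<in> annihilators m"
  shows "(pairing c f)\<^sup>2 \<le> (\<Sum>j\<in>UNIV. 2 * H j) * kernel_form G c c"
proof -
  \<comment> \<open>Normalization to integral 1, which gives both the \<open>L1\<close> bound on
    \<phi> and convergence to \<open>f\<close>.\<close>
  define a where "a n = (real (Suc n) / sqrt (2 * pi)) ^ DIM(real^'d)" for n
  define \<phi> where "\<phi> n x = a n * gauss ((real (Suc n))\<^sup>2) x" for n and x :: "real^'d"
  have a0: "a n > 0" for n unfolding a_def by (intro zero_less_power divide_pos_pos) auto
  have \<phi>0: "\<phi> n x \<ge> 0" for n x using a0[of n] by (simp add: \<phi>_def less_imp_le[OF gauss_pos])
  have \<phi>: "(\<lambda>x. complex_of_real (\<phi> n x)) \<in> schwartz" for n
    unfolding \<phi>_def of_real_mult by (rule schwartz_cmult[OF schwartz_gauss]) simp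
  have \<phi>1: "(\<integral>\<^sup>+x. ennreal (norm (complex_of_real (\<phi> n x))) \<partial>lborel) \<le> 1" for n
  proof -
    have s: "(real (Suc n))\<^sup>2 > 0" by simp
    have i: "integrable lborel (\<lambda>x. complex_of_real (\<phi> n x))" by (intro rapid_integrable schwartz_rapid \<phi>)
    have "complex_of_real (LINT x|lborel. \<phi> n x) = (LINT x|lborel. complex_of_real (\<phi> n x))"
      by (rule integral_complex_of_real[symmetric])
    also have "\<dots> = complex_of_real (a n) * (LINT x|lborel. complex_of_real (gauss ((real (Suc n))\<^sup>2) (x::real^'d)) * character 0 x)"
      by (simp add: \<phi>_def)
    also have "\<dots> = complex_of_real (a n * (sqrt (2 * pi / (real (Suc n))\<^sup>2) ^ DIM(real^'d) * gauss (1 / (real (Suc n))\<^sup>2) (0::real^'d)))"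
      by (subst gauss_fourier[OF s]) simp
    also have "a n * (sqrt (2 * pi / (real (Suc n))\<^sup>2) ^ DIM(real^'d) * gauss (1 / (real (Suc n))\<^sup>2) (0::real^'d)) = 1"
      by (simp add: a_def gauss_def real_sqrt_divide power_divide del: of_nat_Suc)
    finally have "(LINT x|lborel. \<phi> n x) = 1" by (simp only: of_real_eq_iff)
    moreover have "integrable lborel (\<phi> n)" using integrable_Re[OF i] by simp
    ultimately show ?thesis
      using nn_integral_eq_integral[of lborel "\<phi> n"] \<phi>0 by simp
  qed
  have lim: "(\<lambda>n. LINT y|lborel. f y * \<phi> n (x - y)) \<longlonglongrightarrow> f x" for x
  proof -
    have "complex_of_real (LINT y|lborel. f y * \<phi> n (x - y))
      = complex_of_real (a n) * (LINT y|lborel. complex_of_real (f y) * complex_of_real (gauss ((real (Suc n))\<^sup>2) (y - x)))" for n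
    proof -
      have "complex_of_real (LINT y|lborel. f y * \<phi> n (x - y)) = complex_of_real (a n * (LINT y|lborel. f y * gauss ((real (Suc n))\<^sup>2) (y - x)))"
        by (simp add: \<phi>_def gauss_minus_commute[of _ x] mult.left_commute del: of_nat_Suc)
      then show ?thesis by (simp flip: of_real_mult del: of_nat_Suc)
    qed
    then have "(\<lambda>n. complex_of_real (LINT y|lborel. f y * \<phi> n (x - y))) \<longlonglongrightarrow> complex_of_real (f x)"
      unfolding a_def
      by (simp only:) (intro gauss_approx_identity continuous_intros f, simp add: poly_bounded_of_real f)
    then show ?thesis by (simp only: tendsto_of_real_iff)
  qed
  show ?thesis
  proof (rule LIMSEQ_le_const2)
    show "(\<lambda>n. (pairing c (\<lambda>x. LINT y|lborel. f y * \<phi> n (x - y)))\<^sup>2) \<longlonglongrightarrow> (pairing c f)\<^sup>2"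
      unfolding pairing_def by (intro tendsto_intros lim)
    show "\<exists>N. \<forall>n\<ge>N. (pairing c (\<lambda>x. LINT y|lborel. f y * \<phi> n (x - y)))\<^sup>2 \<le> (\<Sum>j\<in>UNIV. 2 * H j) * kernel_form G c c"
      by (intro exI allI impI mollified_bound[OF f f2 h Pf H \<phi> \<phi>1 c])
  qed
qed

end

section \<open>The multiplier near the origin and the final assembly\<close>

text \<open>The asymptotic relation at 0 says nothing about the value at 0 itself, while the bound
  for characters is needed on a full ball. Continuity of the components fills the gap by passing to
  the limit.\<close>

lemma multiplier_order_bound:
  fixes p :: "real^'d::finite \<Rightarrow> complex^'n::finite"
  assumes FT: "\<And>j. (\<lambda>x. p x $ j) \<in> FT_class"
    and \<Theta>: "(\<lambda>x. norm (p x)) \<in> \<Theta>[at 0](\<lambda>x. norm x ^ m)"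
  shows "\<exists>\<rho>>0. \<exists>C. \<forall>j s. norm s \<le> \<rho> \<longrightarrow> norm (p s $ j) \<le> C * norm s ^ m"
proof -
  have "(\<lambda>x. norm (p x)) \<in> O[at 0](\<lambda>x. norm x ^ m)" using \<Theta> by (simp add: bigtheta_def)
  then obtain C where "\<forall>\<^sub>F x in at 0. norm (norm (p x)) \<le> C * norm (norm x ^ m)" by (rule landau_o.bigE)
  then obtain d where d: "d > 0" "\<And>x. x \<noteq> 0 \<Longrightarrow> dist x 0 < d \<Longrightarrow> norm (p x) \<le> C * norm x ^ m"
    by (auto simp: eventually_at)
  have comp: "norm (p x $ j) \<le> norm (p x)" for x j by (rule Finite_Cartesian_Product.norm_nth_le)
  have near: "norm (p x $ j) \<le> C * norm x ^ m" if "x \<noteq> 0" "norm x < d" for x j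
    using order_trans[OF comp d(2)] that by simp
  have zero: "norm (p 0 $ j) \<le> C * norm (0::real^'d) ^ m" for j
  proof (rule tendsto_le[of "at (0::real^'d)"])
    have "partials [] (\<lambda>x. p x $ j) differentiable_on UNIV"
      using FT[of j] unfolding FT_class_def smooth_def by blast
    then have "continuous_on UNIV (\<lambda>x. p x $ j)" by (simp add: differentiable_imp_continuous_on)
    then have "isCont (\<lambda>x. p x $ j) 0" by (simp add: continuous_on_eq_continuous_at)
    then show "((\<lambda>x. norm (p x $ j)) \<longlongrightarrow> norm (p 0 $ j)) (at 0)"
      by (intro tendsto_norm) (simp add: isCont_def)
    show "((\<lambda>x::real^'d. C * norm x ^ m) \<longlongrightarrow> C * norm (0::real^'d) ^ m) (at 0)"
    proof -
      have "isCont (\<lambda>x::real^'d. C * norm x ^ m) (0::real^'d)" by (intro continuous_intros)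
      then show ?thesis by (simp only: isCont_def)
    qed
    show "\<forall>\<^sub>F x in at 0. norm (p x $ j) \<le> C * norm x ^ m"
      unfolding eventually_at using d(1) near by (intro exI[of _ d]) auto
  qed simp
  \<comment> \<open>Halving the radius turns the open punctured ball into a closed one.\<close>
  have "norm (p s $ j) \<le> C * norm s ^ m" if "norm s \<le> d / 2" for j s
    using near[of s j] zero[of j] that d(1) by (cases "s = 0") auto
  then show ?thesis using d(1) by (intro exI[of _ "d / 2"] conjI exI[of _ C]) auto
qed

theorem lemma4p5:
  fixes P Padj :: "'n::finite \<Rightarrow> 'd::finite distr \<Rightarrow> 'd distr"
    and p :: "real^'d \<Rightarrow> complex^'n"
    and G :: "real^'d \<Rightarrow> real"
    and m :: nat
    and \<Xi> :: "(real^'d) set"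
  assumes "\<And>j. distributional_operator (P j) (Padj j)"
    and "\<And>j. complex_adjoint_invariant (P j)"
    and "\<And>j. is_distr_fourier_transform (\<lambda>x. p x $ j) (P j)"
    and "\<And>x. x \<noteq> 0 \<Longrightarrow> p x \<noteq> 0"
    and "slowly_increasing (\<lambda>x. inverse (norm (p x)))"
    and "(\<lambda>x. norm (p x)) \<in> \<Theta>[at 0](\<lambda>x. norm x ^ m)"
    and "continuous_on UNIV G"
    and "slowly_increasing G"
    and "\<And>x. G (- x) = G x"
    and "green_function (adj_compose Padj P) (distr_of (\<lambda>x. complex_of_real (G x)))"
    and "cond_pos_def m G"
    and "unisolvent m \<Xi>"
  shows "gen_sobolev P \<inter> {f. continuous_on UNIV f} \<inter> {f. square_integrable f}
           \<subseteq> native_space G m \<Xi>"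
proof
  fix f assume "f \<in> gen_sobolev P \<inter> {f. continuous_on UNIV f} \<inter> {f. square_integrable f}"
  then have f: "f \<in> gen_sobolev P" and f_cont: "continuous_on UNIV f" and f_L2: "square_integrable f" by auto
  have "\<And>j. (\<lambda>x. p x $ j) \<in> FT_class"
    using assms(3) by (simp add: is_distr_fourier_transform_def)
  from multiplier_order_bound[OF this assms(6)]
  obtain \<rho> C where \<rho>: "\<rho> > 0" "\<And>j s. norm s \<le> \<rho> \<Longrightarrow> norm (p s $ j) \<le> C * norm s ^ m" by blast
  interpret green_setting P Padj "\<lambda>j x. p x $ j" G m \<Xi> \<rho> C
  proof (rule green_setting.intro)
    show "multiplier_operator (P j) (Padj j) (\<lambda>x. p x $ j)" for j
      by (intro multiplier_operator.intro distr_operator.intro multiplier_operator_axioms.intro assms(1,3))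
    show "poly_bounded G" by (rule continuous_slowly_increasing_poly_bounded[OF assms(7,8)])
  qed (use assms \<rho> in auto)
  have f_pb: "poly_bounded f"
    using f by (intro continuous_slowly_increasing_poly_bounded f_cont) (simp add: gen_sobolev_def)
  have f2: "integrable lborel (\<lambda>x. (f x)\<^sup>2)"
  proof -
    have [measurable]: "f \<in> borel_measurable borel" by (intro borel_measurable_continuous_onI f_cont)
    have "integrable lebesgue (\<lambda>x. (f x)\<^sup>2)" using f_L2 by (simp add: square_integrable_def)
    then show ?thesis by (subst (asm) integrable_completion) auto
  qed
  have "\<forall>j. \<exists>h H. h \<in> borel_measurable borel \<and> P j (distr_of (\<lambda>x. complex_of_real (f x))) = distr_of h \<and>
      (\<integral>\<^sup>+x. ennreal ((norm (h x))\<^sup>2) \<partial>lborel) = ennreal H \<and> H \<ge> 0"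
  proof
    fix j
    obtain h where "square_integrable h" "P j (distr_of (\<lambda>x. complex_of_real (f x))) = distr_of h"
      using f by (auto simp: gen_sobolev_def)
    then show "\<exists>h H. h \<in> borel_measurable borel \<and> P j (distr_of (\<lambda>x. complex_of_real (f x))) = distr_of h \<and>
      (\<integral>\<^sup>+x. ennreal ((norm (h x))\<^sup>2) \<partial>lborel) = ennreal H \<and> H \<ge> 0"
      using square_integrable_representative[of h] by metis
  qed
  then obtain h H where h: "\<And>j. h j \<in> borel_measurable borel"
    "\<And>j. P j (distr_of (\<lambda>x. complex_of_real (f x))) = distr_of (h j)"
    "\<And>j. (\<integral>\<^sup>+x. ennreal ((norm (h j x))\<^sup>2) \<partial>lborel) = ennreal (H j)" "\<And>j. H j \<ge> 0" by metis
  show "f \<in> native_space G m \<Xi>"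
    \<comment> \<open>The constant of the criterion is \<open>\<Sum>j. 2 * H j\<close>, with
      \<open>H j\<close> the squared \<open>L2\<close> norm of \<open>P j f\<close>.\<close>
    by (rule native_space_criterion[OF assms(11,12)]) (rule sobolev_bound[OF f_cont f_pb f2 h])
qed

end
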